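(* Consider a Markov decision process $(\mathbb{X},\mathbb{A},\{A(x):x\in\mathbb{X}\},c,q)$ satisfying the standing assumptions listed in the context (in particular $c\ge0$ and $w^*<+\infty$). Let Assumption ${\rm S}^*$ hold: (1) for each $x\in\mathbb{X}$ the function $a\mapsto c(x,a)$ is inf-compact on $A(x)$; (2) for each $x\in\mathbb{X}$ and every bounded measurable $f:\mathbb{X}\to\mathbb{R}$ the function $a\mapsto\int_{\mathbb{X}}f(z)q(dz|x,a)$ is continuous on $A(x)$. Let also Assumption $\underline{\rm B}$ hold: $u(x):=\liminf_{\alpha\uparrow1}u_\alpha(x)<+\infty$ for all $x\in\mathbb{X}$. Then for infinite-horizon average costs per unit time there exists a stationary optimal policy $\phi$ satisfying $$\overline{w}+u(x)\ge\eta^1_u(x,\phi(x)),\qquad x\in\mathbb{X},\qquad (1)$$ and for this policy $$w(x)=w^\phi(x)=\limsup_{\alpha\uparrow1}(1-\alpha)v_\alpha(x)=\overline{w}=w^*,\qquad x\in\mathbb{X}.\qquad (2)$$ Moreover, the following statements hold, where $A^u(x):=\{a\in A(x):\overline{w}+u(x)\ge\eta^1_u(x,a)\}$ and $A_u(x):=\{a\in A(x):\min_{a^*\in A(x)}\eta^1_u(x,a^* )=\eta^1_u(x,a)\}$, $x\in\mathbb{X}$: (a) the function $u:\mathbb{X}\to[0,+\infty)$ is Borel measurable; (b) the sets $A^u(x)$, $x\in\mathbb{X}$, are nonempty and satisfy: ($b_1$) ${\rm Gr}(A^u)=\{(x,a): x\in\mathbb{X}, a\in A^u(x)\}\in\mathcal{B}(\mathbb{X}\times\mathbb{A})$;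 ($b_2$) for each $x\in\mathbb{X}$ the set $A^u(x)$ is compact; (c) if $\varphi$ is a stationary policy with $\varphi(x)\in A^u(x)$ for all $x\in\mathbb{X}$, then $\varphi$ satisfies (1) and (2) with $\phi=\varphi$, and $\varphi$ is optimal for average costs per unit time; (d) the sets $A_u(x)$ are compact and $A_u(x)\subset A^u(x)$ for all $x\in\mathbb{X}$, and there exists a stationary policy $\varphi$ with $\varphi(x)\in A_u(x)\subset A^u(x)$ for all $x\in\mathbb{X}$.
   Context: A Borel space is a Borel subset of a Polish space, with Borel $\sigma$-algebra $\mathcal{B}(\cdot)$. $\overline{\mathbb{R}}=\mathbb{R}\cup\{+\infty\}$. A function $f:E\to\overline{\mathbb{R}}$ on a subset $E$ of a metric space is inf-compact on $E$ if $\{e\in E: f(e)\le\lambda\}$ is compact for every $\lambda\in\mathbb{R}$. MDP and standing assumptions: $\mathbb{X}$ (states) and $\mathbb{A}$ (actions) are Borel spaces; $A(x)\subset\mathbb{A}$, $x\in\mathbb{X}$, are nonempty Borel sets of feasible actions; ${\rm Gr}(A)=\{(x,a): x\in\mathbb{X}, a\in A(x)\}\in\mathcal{B}(\mathbb{X}\times\mathbb{A})$; there exists a Borel mapping $\varphi:\mathbb{X}\to\mathbb{A}$ with $\varphi(x)\in A(x)$ for all $x$; the one-step cost $c:{\rm Gr}(A)\to\overline{\mathbb{R}}$ is Borel measurable and $c\ge 0$; $q(\,\cdot\,|x,a)$ is a probability measure on $(\mathbb{X},\mathcal{B}(\mathbb{X}))$ for each $(x,a)\in{\rm Gr}(A)$,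 and $(x,a)\mapsto q(B|x,a)$ is Borel measurable on ${\rm Gr}(A)$ for each $B\in\mathcal{B}(\mathbb{X})$. Policies: $\mathbb{H}_t=(\mathbb{X}\times\mathbb{A})^t\times\mathbb{X}$ is the set of histories up to epoch $t=0,1,\ldots$. A policy is a sequence $\pi=\{\pi_t\}_{t=0,1,\ldots}$, where $\pi_t(\,\cdot\,|h_t)$ is a regular transition probability from $\mathbb{H}_t$ to $\mathbb{A}$ concentrated on $A(x_t)$; $\Pi$ is the set of all policies. A stationary policy is a Borel mapping $\phi:\mathbb{X}\to\mathbb{A}$ with $\phi(x)\in A(x)$ for all $x$ (action $\phi(x)$ is chosen whenever the state is $x$). For an initial state $x$ and policy $\pi$, $\mathbb{E}_x^\pi$ is the expectation with respect to the probability on trajectories $(x_0,a_0,x_1,a_1,\ldots)$ with $x_0=x$ determined by $\pi$ and $q$ (Ionescu Tulcea theorem). Costs: for $\alpha\in[0,1]$ and $T=1,2,\ldots$, $v^\pi_{T,\alpha}(x)=\mathbb{E}^\pi_x\sum_{t=0}^{T-1}\alpha^tc(x_t,a_t)$; for $\alpha\in[0,1)$, $v^\pi_\alpha(x)=\mathbb{E}^\pi_x\sum_{t=0}^{\infty}\alpha^tc(x_t,a_t)$ (with $0^0=1$) and $v_\alpha(x)=\inf_{\pi\in\Pi}v^\pi_\alpha(x)$. Average cost per unit time: $w^\pi(x)=\limsup_{T\to\infty}\frac1T v^\pi_{T,1}(x)$, $w(x)=\inf_{\pi\in\Pi}w^\pi(x)$; $\pi$ is (average-cost) optimal if $w^\pi(x)=w(x)$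 for all $x\in\mathbb{X}$. It is assumed that $w^*:=\inf_{x\in\mathbb{X}}w(x)<+\infty$. For $\alpha\in[0,1)$: $m_\alpha=\inf_{x\in\mathbb{X}}v_\alpha(x)$, $u_\alpha(x)=v_\alpha(x)-m_\alpha$; $\overline{w}=\limsup_{\alpha\uparrow1}(1-\alpha)m_\alpha$. (It is known that $0\le\overline{w}\le w^*<+\infty$; in particular $m_\alpha$ is finite.) For a nonnegative Borel function $w:\mathbb{X}\to\overline{\mathbb{R}}$ and $\alpha\ge0$, $\eta^\alpha_w(x,a)=c(x,a)+\alpha\int_{\mathbb{X}}w(z)q(dz|x,a)$, $(x,a)\in{\rm Gr}(A)$; in particular $\eta^1_u(x,a)=c(x,a)+\int_{\mathbb{X}}u(z)q(dz|x,a)$. *)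

theory Defs
  imports "HOL-Probability.Probability"
begin

abbreviation borel_on :: "'s::topological_space set \<Rightarrow> 's measure" where
  "borel_on S \<equiv> restrict_space borel S"

definition inf_compact_on :: "'s::topological_space set \<Rightarrow> ('s \<Rightarrow> ereal) \<Rightarrow> bool" where
  "inf_compact_on E f \<longleftrightarrow> (\<forall>l::real. compact {e \<in> E. f e \<le> ereal l})"

text \<open>
  A Borel space is rendered as a Borel subset of a type of class \<open>polish_space\<close>; the data
  of the decision process matter only on their carriers: \<open>feasible\<close> on the state set, \<open>cost\<close> and
  \<open>transition\<close> on the graph of \<open>feasible\<close>. Costs take values in \<open>[0, \<infinity>]\<close>, hence
  the type \<^typ>\<open>ennreal\<close>.
\<close>

record ('x, 'a) mdp =
  states :: "'x set"
  actions :: "'a set"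
  feasible :: "'x \<Rightarrow> 'a set"
  cost :: "'x \<times> 'a \<Rightarrow> ennreal"
  transition :: "'x \<times> 'a \<Rightarrow> 'x measure"

definition graph_of :: "('x, 'a, 'z) mdp_scheme \<Rightarrow> ('x \<Rightarrow> 'a set) \<Rightarrow> ('x \<times> 'a) set" where
  "graph_of M F = {(x, a). x \<in> states M \<and> a \<in> F x}"

abbreviation Gr :: "('x, 'a, 'z) mdp_scheme \<Rightarrow> ('x \<times> 'a) set" where
  "Gr M \<equiv> graph_of M (feasible M)"

context
  fixes M :: "('x::polish_space, 'a::polish_space, 'z) mdp_scheme"
begin

definition state_space :: "'x measure" where
  "state_space = borel_on (states M)"

definition action_space :: "'a measure" where
  "action_space = borel_on (actions M)"

definition step_space :: "('x \<times> 'a) measure" where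
  "step_space = borel_on (states M \<times> actions M)"

definition stationary_policy :: "('x \<Rightarrow> 'a) \<Rightarrow> bool" where
  "stationary_policy \<phi> \<longleftrightarrow>
     \<phi> \<in> state_space \<rightarrow>\<^sub>M action_space \<and> (\<forall>x\<in>states M. \<phi> x \<in> feasible M x)"

definition is_mdp :: bool where
  "is_mdp \<longleftrightarrow>
     states M \<in> sets borel \<and>
     actions M \<in> sets borel \<and>
     (\<forall>x\<in>states M. feasible M x \<noteq> {} \<and> feasible M x \<subseteq> actions M \<and> feasible M x \<in> sets borel) \<and>
     Gr M \<in> sets step_space \<and>
     (\<exists>\<phi>. stationary_policy \<phi>) \<and>
     cost M \<in> borel_measurable (borel_on (Gr M)) \<and>
     transition M \<in> borel_on (Gr M) \<rightarrow>\<^sub>M prob_algebra state_space"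

text \<open>
  A history up to epoch \<open>t\<close> is a pair \<open>(\<omega>, y)\<close>: \<open>\<omega> i = (x\<^sub>i, a\<^sub>i)\<close> for \<open>i < t\<close>, and \<open>y = x\<^sub>t\<close>
  is the current state. Histories need not be feasible.
\<close>

definition history_space :: "nat \<Rightarrow> ((nat \<Rightarrow> 'x \<times> 'a) \<times> 'x) measure" where
  "history_space t = PiM {0..<t} (\<lambda>_. step_space) \<Otimes>\<^sub>M state_space"

definition policies :: "(nat \<Rightarrow> (nat \<Rightarrow> 'x \<times> 'a) \<times> 'x \<Rightarrow> 'a measure) set" where
  "policies = {\<pi>. \<forall>t. \<pi> t \<in> history_space t \<rightarrow>\<^sub>M prob_algebra action_space \<and>
     (\<forall>h\<in>space (history_space t). emeasure (\<pi> t h) (feasible M (snd h)) = 1)}"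

definition of_stationary :: "('x \<Rightarrow> 'a) \<Rightarrow> nat \<Rightarrow> (nat \<Rightarrow> 'x \<times> 'a) \<times> 'x \<Rightarrow> 'a measure" where
  "of_stationary \<phi> t h = return action_space (\<phi> (snd h))"

text \<open>
  The Ionescu Tulcea construction requires kernels on all of \<open>(states M \<times> actions M)\<^sup>t\<close>, whereas
  \<open>transition M\<close> is given on \<open>Gr M\<close> only. The kernel is therefore extended arbitrarily (the state is
  left unchanged) to infeasible pairs, which occur with probability 0 under any policy.
\<close>

definition transition_ext :: "'x \<times> 'a \<Rightarrow> 'x measure" where
  "transition_ext p = (if p \<in> Gr M then transition M p else return state_space (fst p))"

definition step_kernel ::
  "'x \<Rightarrow> (nat \<Rightarrow> (nat \<Rightarrow> 'x \<times> 'a) \<times> 'x \<Rightarrow> 'a measure) \<Rightarrow> nat \<Rightarrow> (nat \<Rightarrow> 'x \<times> 'a) \<Rightarrow> ('x \<times> 'a) measure"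
where
  "step_kernel x \<pi> t \<omega> =
     (if t = 0 then return state_space x else transition_ext (\<omega> (t - 1))) \<bind>
       (\<lambda>y. \<pi> t (\<omega>, y) \<bind> (\<lambda>a. return step_space (y, a)))"

definition trajectory_law ::
  "'x \<Rightarrow> (nat \<Rightarrow> (nat \<Rightarrow> 'x \<times> 'a) \<times> 'x \<Rightarrow> 'a measure) \<Rightarrow> (nat \<Rightarrow> 'x \<times> 'a) measure"
where
  "trajectory_law x \<pi> =
     projective_family.lim UNIV
       (Ionescu_Tulcea.CI (step_kernel x \<pi>) (\<lambda>_. step_space)) (\<lambda>_. step_space)"

definition finite_cost ::
  "nat \<Rightarrow> real \<Rightarrow> (nat \<Rightarrow> (nat \<Rightarrow> 'x \<times> 'a) \<times> 'x \<Rightarrow> 'a measure) \<Rightarrow> 'x \<Rightarrow> ennreal"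
where
  "finite_cost T \<alpha> \<pi> x = (\<integral>\<^sup>+\<omega>. (\<Sum>t<T. ennreal (\<alpha> ^ t) * cost M (\<omega> t)) \<partial>trajectory_law x \<pi>)"

definition discounted_cost ::
  "real \<Rightarrow> (nat \<Rightarrow> (nat \<Rightarrow> 'x \<times> 'a) \<times> 'x \<Rightarrow> 'a measure) \<Rightarrow> 'x \<Rightarrow> ennreal"
where
  "discounted_cost \<alpha> \<pi> x = (\<integral>\<^sup>+\<omega>. (\<Sum>t. ennreal (\<alpha> ^ t) * cost M (\<omega> t)) \<partial>trajectory_law x \<pi>)"

definition discounted_value :: "real \<Rightarrow> 'x \<Rightarrow> ennreal" where
  "discounted_value \<alpha> x = (INF \<pi>\<in>policies. discounted_cost \<alpha> \<pi> x)"

definition average_cost ::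
  "(nat \<Rightarrow> (nat \<Rightarrow> 'x \<times> 'a) \<times> 'x \<Rightarrow> 'a measure) \<Rightarrow> 'x \<Rightarrow> ennreal"
where
  "average_cost \<pi> x = limsup (\<lambda>T. finite_cost T 1 \<pi> x / of_nat T)"

definition average_value :: "'x \<Rightarrow> ennreal" where
  "average_value x = (INF \<pi>\<in>policies. average_cost \<pi> x)"

definition average_optimal :: "(nat \<Rightarrow> (nat \<Rightarrow> 'x \<times> 'a) \<times> 'x \<Rightarrow> 'a measure) \<Rightarrow> bool" where
  "average_optimal \<pi> \<longleftrightarrow>
     \<pi> \<in> policies \<and> (\<forall>x\<in>states M. average_cost \<pi> x = average_value x)"

definition w_star :: ennreal where
  "w_star = (INF x\<in>states M. average_value x)"

definition min_discounted_value :: "real \<Rightarrow> ennreal" where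
  "min_discounted_value \<alpha> = (INF x\<in>states M. discounted_value \<alpha> x)"

text \<open>
  Subtraction on \<^typ>\<open>ennreal\<close> is genuine here: the subtrahend is a lower bound of the minuend,
  and it is finite for \<open>0 \<le> \<alpha> < 1\<close> whenever \<open>w_star < \<infinity>\<close>.
\<close>

definition relative_value :: "real \<Rightarrow> 'x \<Rightarrow> ennreal" where
  "relative_value \<alpha> x = discounted_value \<alpha> x - min_discounted_value \<alpha>"

definition w_bar :: ennreal where
  "w_bar = Limsup (at_left 1) (\<lambda>\<alpha>. ennreal (1 - \<alpha>) * min_discounted_value \<alpha>)"

definition u_fun :: "'x \<Rightarrow> ennreal" where
  "u_fun x = Liminf (at_left 1) (\<lambda>\<alpha>. relative_value \<alpha> x)"

definition eta :: "real \<Rightarrow> ('x \<Rightarrow> ennreal) \<Rightarrow> 'x \<times> 'a \<Rightarrow> ennreal" where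
  "eta \<alpha> f p = cost M p + ennreal \<alpha> * (\<integral>\<^sup>+z. f z \<partial>transition M p)"

definition assumption_S_star :: bool where
  "assumption_S_star \<longleftrightarrow>
     (\<forall>x\<in>states M. inf_compact_on (feasible M x) (\<lambda>a. enn2ereal (cost M (x, a)))) \<and>
     (\<forall>x\<in>states M. \<forall>f::'x \<Rightarrow> real. f \<in> borel_measurable state_space \<and> bounded (f ` states M) \<longrightarrow>
        continuous_on (feasible M x) (\<lambda>a. \<integral>z. f z \<partial>transition M (x, a)))"

definition assumption_B :: bool where
  "assumption_B \<longleftrightarrow> (\<forall>x\<in>states M. u_fun x < \<infinity>)"

definition ineq_actions :: "'x \<Rightarrow> 'a set" where
  "ineq_actions x = {a \<in> feasible M x. w_bar + u_fun x \<ge> eta 1 u_fun (x, a)}"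

definition min_actions :: "'x \<Rightarrow> 'a set" where
  "min_actions x =
     {a. is_arg_min (\<lambda>b. eta 1 u_fun (x, b)) (\<lambda>b. b \<in> feasible M x) a}"

definition satisfies_ineq :: "('x \<Rightarrow> 'a) \<Rightarrow> bool" where
  "satisfies_ineq \<phi> \<longleftrightarrow>
     (\<forall>x\<in>states M. w_bar + u_fun x \<ge> eta 1 u_fun (x, \<phi> x))"

definition satisfies_values :: "('x \<Rightarrow> 'a) \<Rightarrow> bool" where
  "satisfies_values \<phi> \<longleftrightarrow>
     (\<forall>x\<in>states M.
        average_value x = average_cost (of_stationary \<phi>) x \<and>
        average_cost (of_stationary \<phi>) x =
          Limsup (at_left 1) (\<lambda>\<alpha>. ennreal (1 - \<alpha>) * discounted_value \<alpha> x) \<and>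
        Limsup (at_left 1) (\<lambda>\<alpha>. ennreal (1 - \<alpha>) * discounted_value \<alpha> x) = w_bar \<and>
        w_bar = w_star)"

end

end

theory Submission
  imports Defs
begin

text \<open>
  The average-cost problem is a limit of discounted problems. Write \<open>v\<^sub>\<alpha>\<close> for the discounted value
  function, \<open>m\<^sub>\<alpha>\<close> for its infimum and \<open>u\<^sub>\<alpha> = v\<^sub>\<alpha> - m\<^sub>\<alpha>\<close>. Value iteration from below converges to
  \<open>v\<^sub>\<alpha>\<close>, which is therefore a Borel function with \<open>min\<^sub>a [c + \<alpha> \<integral> v\<^sub>\<alpha> dq] \<le> v\<^sub>\<alpha>\<close>. Subtracting
  \<open>\<alpha> m\<^sub>\<alpha>\<close> on both sides gives \<open>min\<^sub>a [c + \<alpha> \<integral> u\<^sub>\<alpha> dq] \<le> (1 - \<alpha>) m\<^sub>\<alpha> + u\<^sub>\<alpha>\<close>. The infimum of \<open>u\<^sub>\<alpha>\<close>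
  over \<open>\<alpha> \<in> [\<beta>, 1)\<close> increases to \<open>u\<close> as \<open>\<beta>\<close> tends to \<open>1\<close>, so monotone convergence of the
  integrals, together with an exchange of the limit and the minimum over actions, turns the
  discounted inequalities into \<open>min\<^sub>a [c + \<integral> u dq] \<le> w_bar + u\<close>
  (\<open>average_optimality_inequality\<close>). The exchange is where inf-compactness enters: nested nonempty
  compact sets of nearly optimal actions have a common point (\<open>bellman_SUP\<close>).

  A stationary policy whose actions satisfy the last inequality can be followed for \<open>T\<close> steps at
  expected cost at most \<open>T w_bar + u\<close>, because the terms in \<open>u\<close> telescope. Its average cost is thus
  at most \<open>w_bar\<close>. On the other hand Abel means are dominated in the upper limit by Cesaro means
  (\<open>limsup_abel_le_limsup_cesaro\<close>), so that \<open>w_bar\<close> is at most the upper limit of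
  \<open>(1 - \<alpha>) v\<^sub>\<alpha>\<close>, and this is at most the average cost of every policy. All quantities in the
  chain coincide.

  Two measurability questions remain. The first is to minimize over actions in a Borel way. The
  cost is jointly Borel and inf-compact in the action, but need not depend on the state in any
  regular way, so sublevel sets of the minimum are projections of Borel sets with compact sections.
  That these projections are Borel, and that the sets have Borel selectors, is a theorem of Novikov.
  It is derived here from Novikov's separation theorem for countably many analytic sets, which is
  proved by a direct construction. The second question is the measurability of \<open>u\<close>, a lower limit
  over uncountably many discount factors. Both \<open>v\<^sub>\<alpha>\<close> and \<open>m\<^sub>\<alpha>\<close> are nondecreasing in \<open>\<alpha>\<close>, and
  \<open>m\<^sub>\<alpha>\<close> does not depend on the state; the rational discount factors and the countably many
  discontinuities of \<open>m\<^sub>\<alpha>\<close> therefore determine the infima (\<open>countable_INF_difference_of_mono\<close>).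
\<close>

section \<open>Separation of countably many analytic sets\<close>

definition borel_separable :: "(nat \<Rightarrow> 'b::topological_space set) \<Rightarrow> bool" where
  "borel_separable A \<longleftrightarrow> (\<exists>B. (\<forall>n. B n \<in> sets borel \<and> A n \<subseteq> B n) \<and> (\<Inter>n. B n) = {})"

text \<open>
  Intersecting, respectively uniting, the separating sets of the pieces separates the whole. Read
  contrapositively: when one member of a non-separable sequence is cut into countably many pieces,
  some piece leaves the sequence non-separable.
\<close>

lemma borel_separable_split:
  fixes A :: "nat \<Rightarrow> 'b::topological_space set"
  assumes sub: "A j \<subseteq> (\<Union>i::nat. E i)"
    and sep: "\<And>i. borel_separable (A(j := E i))"
  shows "borel_separable A"
proof -
  from sep have "\<forall>i. \<exists>B. (\<forall>n. B n \<in> sets borel \<and> (A(j := E i)) n \<subseteq> B n) \<and> (\<Inter>n. B n) = {}"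
    by (simp add: borel_separable_def)
  then obtain B where B: "\<And>i n. B i n \<in> sets borel" "\<And>i n. (A(j := E i)) n \<subseteq> B i n"
      "\<And>i. (\<Inter>n. B i n) = {}"
    by metis
  define B' where "B' n = (if n = j then \<Union>i. B i j else \<Inter>i. B i n)" for n
  have "B' n \<in> sets borel" for n
    unfolding B'_def using B(1) by auto
  moreover have "A n \<subseteq> B' n" for n
  proof (cases "n = j")
    case True
    have "E i \<subseteq> B i j" for i using B(2)[of i j] by simp
    then have "(\<Union>i. E i) \<subseteq> (\<Union>i. B i j)" by blast
    with True sub show ?thesis by (simp add: B'_def)
  next
    case False
    then have "A n \<subseteq> B i n" for i using B(2)[of i n] by simp
    with False show ?thesis by (auto simp: B'_def)
  qed
  moreover have "(\<Inter>n. B' n) = {}"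
  proof (rule equals0I)
    fix p assume p: "p \<in> (\<Inter>n. B' n)"
    then have "p \<in> B' j" by blast
    then obtain i where i: "p \<in> B i j" by (auto simp: B'_def)
    have "p \<in> B i n" for n
    proof (cases "n = j")
      case False
      from p have "p \<in> B' n" by blast
      with False show ?thesis by (auto simp: B'_def)
    qed (use i in simp)
    with B(3)[of i] show False by blast
  qed
  ultimately show ?thesis unfolding borel_separable_def by blast
qed

lemma dense_sequence_exists:
  obtains d :: "nat \<Rightarrow> 'w::{second_countable_topology, metric_space}"
  where "\<And>x e. e > 0 \<Longrightarrow> \<exists>i. dist x (d i) < e"
proof -
  obtain D :: "'w set" where D: "countable D" "\<And>X. open X \<Longrightarrow> X \<noteq> {} \<Longrightarrow> \<exists>d \<in> D. d \<in> X"
    using countable_dense_setE by blast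
  have ne: "D \<noteq> {}" using D(2)[of UNIV] by auto
  show ?thesis
  proof (rule that[of "from_nat_into D"])
    fix x :: 'w and e :: real assume "e > 0"
    then have "ball x e \<noteq> {}" by (metis centre_in_ball empty_iff)
    then obtain y where "y \<in> D" "y \<in> ball x e" using D(2)[of "ball x e"] by auto
    then show "\<exists>i. dist x (from_nat_into D i) < e"
      using from_nat_into_surj[OF D(1)] by (metis mem_ball)
  qed
qed

text \<open>
  Cutting the sets \<open>C n\<close> again and again into pieces of small diameter, a sequence whose images are
  not separable is refined to sequences with the same defect that shrink to points \<open>z n\<close>.
  If the points \<open>f (z n)\<close> coincide, they lie in every image. If two of them differ, then disjoint
  open neighbourhoods of these two separate the images at a late stage.
\<close>

lemma borel_separable_closed_images:
  fixes C :: "nat \<Rightarrow> 'w::polish_space set" and f :: "'w \<Rightarrow> 'b::t2_space"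
  assumes cl: "\<And>n. closed (C n)" and f: "continuous_on UNIV f"
    and disj: "(\<Inter>n. f ` C n) = {}"
  shows "borel_separable (\<lambda>n. f ` C n)"
proof (rule ccontr)
  assume nsep: "\<not> ?thesis"
  obtain d :: "nat \<Rightarrow> 'w" where d: "\<And>x e. e > 0 \<Longrightarrow> \<exists>i. dist x (d i) < e"
    using dense_sequence_exists by blast
  define P where "P D \<longleftrightarrow> (\<forall>n. closed (D n)) \<and> \<not> borel_separable (\<lambda>n. f ` D n)" for D :: "nat \<Rightarrow> 'w set"
  \<comment> \<open>Step \<open>k\<close> shrinks the member with index \<open>fst (prod_decode k)\<close>. Every index occurs for arbitrarily
    large \<open>k\<close>, so the diameters of each member tend to \<open>0\<close>.\<close>
  define Q where "Q k D D' \<longleftrightarrow> (\<forall>n. D' n \<subseteq> D n) \<and>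
     (\<exists>c. D' (fst (prod_decode k)) \<subseteq> cball c (1 / Suc k))" for k and D D' :: "nat \<Rightarrow> 'w set"
  have step: "\<exists>D'. P D' \<and> Q k D D'" if "P D" for D k
  proof -
    define j where "j = fst (prod_decode k)"
    define E where "E i = D j \<inter> cball (d i) (1 / Suc k)" for i
    have cov: "D j \<subseteq> (\<Union>i. E i)"
    proof
      fix x assume "x \<in> D j"
      obtain i where "dist x (d i) < 1 / Suc k" using d[of "1 / Suc k" x] by auto
      with \<open>x \<in> D j\<close> show "x \<in> (\<Union>i. E i)" unfolding E_def by (auto simp: dist_commute intro!: exI[of _ i])
    qed
    have "\<exists>i. \<not> borel_separable ((\<lambda>n. f ` D n)(j := f ` E i))"
    proof (rule ccontr)
      assume "\<not> ?thesis"
      then have "\<And>i. borel_separable ((\<lambda>n. f ` D n)(j := f ` E i))" by blast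
      moreover have "f ` D j \<subseteq> (\<Union>i. f ` E i)" using cov by blast
      ultimately have "borel_separable (\<lambda>n. f ` D n)"
        using borel_separable_split[of "\<lambda>n. f ` D n" j "\<lambda>i. f ` E i"] by blast
      with that show False by (simp add: P_def)
    qed
    then obtain i where i: "\<not> borel_separable ((\<lambda>n. f ` D n)(j := f ` E i))" ..
    have eq: "(\<lambda>n. f ` (D(j := E i)) n) = (\<lambda>n. f ` D n)(j := f ` E i)" by (rule ext) simp
    have "P (D(j := E i))"
      using that i unfolding P_def eq by (auto simp: E_def)
    moreover have "Q k D (D(j := E i))"
      unfolding Q_def j_def[symmetric] by (auto simp: E_def)
    ultimately show ?thesis by blast
  qed
  have "\<exists>D. \<forall>k. (P (D k) \<and> (k = 0 \<longrightarrow> D k = C)) \<and> Q k (D k) (D (Suc k))"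
    by (rule dependent_nat_choice) (use cl nsep step in \<open>auto simp: P_def\<close>)
  then obtain D where D: "\<And>k. P (D k)" "D 0 = C" "\<And>k. Q k (D k) (D (Suc k))"
    by metis
  have dec: "D l n \<subseteq> D k n" if "k \<le> l" for k l n
    using that by (rule lift_Suc_antimono_le[rotated]) (use D(3) in \<open>auto simp: Q_def\<close>)
  have ne: "D k n \<noteq> {}" for k n
  proof
    assume "D k n = {}"
    then have "borel_separable (\<lambda>n. f ` D k n)"
      unfolding borel_separable_def by (intro exI[of _ "\<lambda>m. if m = n then {} else UNIV"]) auto
    with D(1)[of k] show False by (simp add: P_def)
  qed
  have small: "\<exists>k. \<forall>x\<in>D k n. \<forall>y\<in>D k n. dist x y < e" if "e > 0" for n e
  proof -
    obtain m :: nat where m: "2 / e < Suc m" using reals_Archimedean2 by (metis less_Suc_eq of_nat_less_iff order_less_trans)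
    define k where "k = prod_encode (n, m)"
    have "m \<le> k" by (simp add: k_def le_prod_encode_2)
    then have "2 / e < Suc k" using m by simp
    then have r: "2 / Suc k < e" using that by (simp add: field_simps)
    obtain c where "D (Suc k) n \<subseteq> cball c (1 / Suc k)" using D(3)[of k] by (auto simp: Q_def k_def)
    then have "dist x y < e" if "x \<in> D (Suc k) n" "y \<in> D (Suc k) n" for x y
    proof -
      have "dist c x \<le> 1 / Suc k" "dist c y \<le> 1 / Suc k"
        using that \<open>D (Suc k) n \<subseteq> cball c (1 / Suc k)\<close> by auto
      moreover have "2 / Suc k = 1 / Suc k + 1 / real (Suc k)" by simp
      ultimately show ?thesis using r dist_triangle3[of x y c] by linarith
    qed
    then show ?thesis by blast
  qed
  have "\<exists>z. \<forall>k. z \<in> D k n" for n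
  proof -
    have "\<And>k. closed (D k n)" using D(1) by (simp add: P_def)
    then show ?thesis
      using decreasing_closed_nest[of "\<lambda>k. D k n"] ne dec small by metis
  qed
  then obtain z where z: "\<And>n k. z n \<in> D k n" by metis
  have near: "\<exists>k. \<forall>l\<ge>k. f ` D l n \<subseteq> U" if "open U" "f (z n) \<in> U" for U n
  proof -
    have "open (f -` U)" using f that(1) by (simp add: open_vimage)
    then obtain e where e: "e > 0" "ball (z n) e \<subseteq> f -` U" using \<open>f (z n) \<in> U\<close> by (metis openE vimageI)
    obtain k where "\<forall>x\<in>D k n. \<forall>y\<in>D k n. dist x y < e" using small[OF e(1)] by blast
    then have "D k n \<subseteq> ball (z n) e" using z[of n k] by auto
    with e dec show ?thesis by (intro exI[of _ k]) blast
  qed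
  show False
  proof (cases "\<forall>n. f (z n) = f (z 0)")
    case True
    then have "f (z 0) \<in> f ` C n" for n using z[of n 0] D(2) by (metis imageI)
    with disj show False by blast
  next
    case False
    then obtain n where n: "f (z n) \<noteq> f (z 0)" by blast
    then obtain U V where UV: "open U" "open V" "f (z n) \<in> U" "f (z 0) \<in> V" "U \<inter> V = {}"
      using hausdorff[OF n] by blast
    obtain k1 k2 where k: "\<forall>l\<ge>k1. f ` D l n \<subseteq> U" "\<forall>l\<ge>k2. f ` D l 0 \<subseteq> V"
      using near[OF UV(1,3)] near[OF UV(2,4)] by blast
    define k where "k = max k1 k2"
    define B where "B m = (if m = n then U else if m = 0 then V else UNIV)" for m
    have "n \<noteq> 0" using n by metis
    then have "B n = U" "B 0 = V" by (auto simp: B_def)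
    then have "(\<Inter>m. B m) = {}" using UV(5) by blast
    moreover have "B m \<in> sets borel" for m using UV(1,2) by (simp add: B_def)
    moreover have "f ` D k m \<subseteq> B m" for m using k by (simp add: B_def k_def)
    ultimately have "borel_separable (\<lambda>n. f ` D k n)" unfolding borel_separable_def by blast
    with D(1)[of k] show False by (simp add: P_def)
  qed
qed

instance prod :: (polish_space, polish_space) polish_space ..

text \<open>
  Projections of closed sets along the space of real sequences include all closed and open sets and
  are stable under countable unions and intersections. For a union, the parameter starts with
  the index of the set that is used; for an intersection, it interleaves one parameter for each set.
  Indices are coded as real numbers, so that the parameters range over a Polish type.
\<close>

lemma borel_set_projection_of_closed:
  fixes S :: "'w::polish_space set"
  assumes "S \<in> sets borel"
  shows "\<exists>C :: ('w \<times> (nat \<Rightarrow> real)) set. closed C \<and> S = fst ` C"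
proof -
  define pc where "pc S \<longleftrightarrow> (\<exists>C :: ('w \<times> (nat \<Rightarrow> real)) set. closed C \<and> S = fst ` C)" for S :: "'w set"
  have cl: "pc S" if "closed S" for S
    unfolding pc_def by (intro exI[of _ "S \<times> UNIV"]) (use that in \<open>auto intro: closed_Times\<close>)
  have coord: "continuous_on UNIV (\<lambda>p :: 'w \<times> (nat \<Rightarrow> real). snd p i)" for i
    by (rule continuous_on_compose2[OF continuous_on_product_coordinates continuous_on_snd[OF continuous_on_id]]) simp
  have un: "pc (\<Union>n. S n)" if "\<And>n. pc (S n)" for S :: "nat \<Rightarrow> 'w set"
  proof -
    obtain C :: "nat \<Rightarrow> ('w \<times> (nat \<Rightarrow> real)) set"
      where C: "\<And>n. closed (C n)" "\<And>n. S n = fst ` C n"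
      using \<open>\<And>n. pc (S n)\<close> unfolding pc_def by metis
    define sh where "sh p = (fst p, \<lambda>i. snd p (Suc i))" for p :: "'w \<times> (nat \<Rightarrow> real)"
    define z0 where "z0 p = snd p (0::nat)" for p :: "'w \<times> (nat \<Rightarrow> real)"
    have cont_sh: "continuous_on UNIV sh"
      unfolding sh_def
      by (intro continuous_on_Pair continuous_on_coordinatewise_then_product coord continuous_on_fst continuous_on_id)
    have cont_z0: "continuous_on UNIV z0"
      unfolding z0_def by (rule coord)
    define K where "K = (z0 -` \<nat>) \<inter> (\<Inter>n. z0 -` (\<nat> - {real n}) \<union> sh -` C n)"
    have "closed (\<nat> - {real n} :: real set)" for n
      by (rule closed_subset_Ints) (auto simp: Nats_altdef1)
    moreover have "closed (\<nat> :: real set)"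
      by (rule closed_subset_Ints) (auto simp: Nats_altdef1)
    ultimately have "closed K"
      unfolding K_def using C(1) cont_sh cont_z0
      by (intro closed_Int closed_INT closed_Un ballI closed_vimage) auto
    moreover have "(\<Union>n. S n) = fst ` K"
    proof (intro equalityI subsetI)
      fix x assume "x \<in> (\<Union>n. S n)"
      then obtain n z where "(x, z) \<in> C n" using C(2) by auto
      then have "(x, case_nat (real n) z) \<in> K" by (auto simp: K_def z0_def sh_def)
      then show "x \<in> fst ` K" by force
    next
      fix x assume "x \<in> fst ` K"
      then obtain z where z: "(x, z) \<in> K" by auto
      then obtain n where "z 0 = real n" by (auto simp: K_def z0_def Nats_def)
      with z have "sh (x, z) \<in> C n" by (auto simp: K_def z0_def)
      then have "x \<in> S n" unfolding C(2) sh_def by force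
      then show "x \<in> (\<Union>n. S n)" by blast
    qed
    ultimately show ?thesis unfolding pc_def by blast
  qed
  have int: "pc (\<Inter>n. S n)" if "\<And>n. pc (S n)" for S :: "nat \<Rightarrow> 'w set"
  proof -
    obtain C :: "nat \<Rightarrow> ('w \<times> (nat \<Rightarrow> real)) set"
      where C: "\<And>n. closed (C n)" "\<And>n. S n = fst ` C n"
      using \<open>\<And>n. pc (S n)\<close> unfolding pc_def by metis
    define row where "row n p = (fst p, \<lambda>i. snd p (prod_encode (n, i)))" for n and p :: "'w \<times> (nat \<Rightarrow> real)"
    have cont_row: "continuous_on UNIV (row n)" for n
      unfolding row_def
      by (intro continuous_on_Pair continuous_on_coordinatewise_then_product coord continuous_on_fst continuous_on_id)
    have "closed (\<Inter>n. row n -` C n)"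
      using C(1) cont_row by (intro closed_INT ballI closed_vimage) auto
    moreover have "(\<Inter>n. S n) = fst ` (\<Inter>n. row n -` C n)"
    proof (intro equalityI subsetI)
      fix x assume "x \<in> (\<Inter>n. S n)"
      then have "\<forall>n. \<exists>z. (x, z) \<in> C n" using C(2) by force
      then obtain z where z: "\<And>n. (x, z n) \<in> C n" by metis
      have "(x, \<lambda>k. z (fst (prod_decode k)) (snd (prod_decode k))) \<in> (\<Inter>n. row n -` C n)"
        using z by (auto simp: row_def)
      then show "x \<in> fst ` (\<Inter>n. row n -` C n)" by force
    next
      fix x assume "x \<in> fst ` (\<Inter>n. row n -` C n)"
      then obtain z where z: "\<forall>n. row n (x, z) \<in> C n" by auto
      then have "x \<in> S n" for n unfolding C(2) row_def by force
      then show "x \<in> (\<Inter>n. S n)" by blast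
    qed
    ultimately show ?thesis unfolding pc_def by blast
  qed
  have op: "pc S" if "open S" for S
  proof (cases "S = UNIV")
    case True
    then show ?thesis using cl by simp
  next
    case False
    then have ne: "- S \<noteq> {}" by blast
    define F where "F n = {x. infdist x (- S) \<ge> 1 / Suc n}" for n
    have "closed (F n)" for n
      unfolding F_def by (intro closed_Collect_le continuous_intros)
    moreover have "S = (\<Union>n. F n)"
    proof (intro equalityI subsetI)
      fix x assume "x \<in> S"
      then have "infdist x (- S) \<noteq> 0" using that ne in_closed_iff_infdist_zero[of "- S" x] by auto
      then have "infdist x (- S) > 0" using infdist_nonneg[of x "- S"] by linarith
      then obtain n where "inverse (Suc n) < infdist x (- S)" using reals_Archimedean by blast
      then show "x \<in> (\<Union>n. F n)" by (auto simp: F_def field_simps intro!: exI[of _ n])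
    next
      fix x assume "x \<in> (\<Union>n. F n)"
      then obtain n where "infdist x (- S) \<ge> 1 / Suc n" by (auto simp: F_def)
      then show "x \<in> S" using infdist_zero[of x "- S"] by (cases "x \<in> S") auto
    qed
    ultimately show ?thesis using un[of F] cl by simp
  qed
  \<comment> \<open>Carrying the complement along makes the induction pass through complements.\<close>
  have "S \<in> sigma_sets UNIV {S. open S}" using assms by (simp add: borel_def)
  then have "pc S \<and> pc (- S)"
  proof induction
    case (Basic a)
    then show ?case using op cl by (auto simp: closed_Compl)
  next
    case Empty
    then show ?case using cl by simp
  next
    case (Compl a)
    then show ?case by (simp add: Compl_eq_Diff_UNIV[symmetric])
  next
    case (Union a)
    then show ?case using un[of a] int[of "\<lambda>n. - a n"] by simp
  qed
  then show ?thesis by (simp add: pc_def)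
qed

text \<open>
  By \<open>borel_set_projection_of_closed\<close> the images of Borel sets are images of closed sets in a larger
  Polish space.
\<close>

theorem novikov_separation:
  fixes S :: "nat \<Rightarrow> 'w::polish_space set" and f :: "'w \<Rightarrow> 'b::t2_space"
  assumes S: "\<And>n. S n \<in> sets borel" and f: "continuous_on UNIV f"
    and disj: "(\<Inter>n. f ` S n) = {}"
  shows "borel_separable (\<lambda>n. f ` S n)"
proof -
  obtain C :: "nat \<Rightarrow> ('w \<times> (nat \<Rightarrow> real)) set" where C: "\<And>n. closed (C n)" "\<And>n. S n = fst ` C n"
    using borel_set_projection_of_closed[OF S] by metis
  have eq: "f ` S n = (f \<circ> fst) ` C n" for n by (simp add: C(2) image_comp)
  show ?thesis
    unfolding eq
  proof (rule borel_separable_closed_images)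
    show "continuous_on UNIV (f \<circ> (fst :: 'w \<times> (nat \<Rightarrow> real) \<Rightarrow> 'w))"
      by (intro continuous_on_compose continuous_intros continuous_on_subset[OF f]) auto
    show "closed (C n)" for n by (rule C(1))
    show "(\<Inter>n. (f \<circ> fst) ` C n) = {}" using disj unfolding eq .
  qed
qed

text \<open>
  Novikov's theorem for the sequence \<open>S, T, T, T, \<dots>\<close>.
\<close>

corollary lusin_separation:
  fixes S T :: "'w::polish_space set" and f :: "'w \<Rightarrow> 'b::t2_space"
  assumes S: "S \<in> sets borel" and T: "T \<in> sets borel" and f: "continuous_on UNIV f"
    and disj: "f ` S \<inter> f ` T = {}"
  obtains B where "B \<in> sets borel" "f ` S \<subseteq> B" "B \<inter> f ` T = {}"
proof -
  let ?A = "\<lambda>n::nat. if n = 0 then S else T"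
  have "(\<Inter>n. f ` ?A n) \<subseteq> f ` ?A 0 \<inter> f ` ?A 1" by blast
  then have "(\<Inter>n. f ` ?A n) = {}" using disj by simp
  then have "borel_separable (\<lambda>n. f ` ?A n)"
    using S T f by (intro novikov_separation) auto
  then obtain B where B: "\<And>n. B n \<in> sets borel" "\<And>n. f ` (if n = (0::nat) then S else T) \<subseteq> B n" "(\<Inter>n. B n) = {}"
    unfolding borel_separable_def by metis
  have "x \<notin> B 0" if "x \<in> f ` T" for x
  proof
    assume "x \<in> B 0"
    moreover have "x \<in> B n" if "n \<noteq> 0" for n using B(2)[of n] that \<open>x \<in> f ` T\<close> by auto
    ultimately have "x \<in> (\<Inter>n. B n)" by (metis INT_I)
    with B(3) show False by blast
  qed
  then show ?thesis using that[of "B 0"] B(1)[of 0] B(2)[of 0] by auto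
qed

section \<open>Borel sets with compact sections\<close>

text \<open>
  The largest set \<open>X n\<close> that could be used consists of the \<open>x\<close> for which \<open>V n\<close> misses the section of
  \<open>B\<close>, and this set is only coanalytic. The complements of these maximal rectangles, together with
  \<open>- B\<close>, are analytic with empty intersection, because the sections of \<open>- B\<close> are open. Novikov
  separation shrinks the rectangles to Borel sets that still cover \<open>- B\<close>, and Lusin
  separation replaces the projections of these Borel sets by Borel sets.
\<close>

theorem kunugui_novikov:
  fixes B :: "('x::polish_space \<times> 'y::polish_space) set" and V :: "nat \<Rightarrow> 'y set"
  assumes B: "B \<in> sets borel" and V: "\<And>n. open (V n)"
    and basis: "\<And>U y. open U \<Longrightarrow> y \<in> U \<Longrightarrow> \<exists>n. y \<in> V n \<and> V n \<subseteq> U"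
    and cl: "\<And>x. closed {y. (x, y) \<in> B}"
  obtains X where "\<And>n. X n \<in> sets borel" "- B = (\<Union>n. X n \<times> V n)"
proof -
  \<comment> \<open>\<open>fst ` S 0\<close> is \<open>- B\<close>, and \<open>fst ` S (Suc n)\<close> is the complement of the \<open>n\<close>-th maximal rectangle.\<close>
  define S :: "nat \<Rightarrow> (('x \<times> 'y) \<times> 'y) set" where
    "S k = (case k of 0 \<Rightarrow> fst -` (- B)
      | Suc n \<Rightarrow> (\<lambda>p. (fst (fst p), snd p)) -` B \<inter> snd -` V n \<union> (\<lambda>p. snd (fst p)) -` (- V n))" for k
  have pre: "g -` A \<in> sets borel" if "A \<in> sets borel" "continuous_on UNIV g"
    for g :: "(('x \<times> 'y) \<times> 'y) \<Rightarrow> 'b::topological_space" and A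
    using measurable_sets_borel[OF borel_measurable_continuous_onI[OF that(2)] that(1)] by simp
  have "S k \<in> sets borel" for k
  proof (cases k)
    case 0
    have "fst -` (- B) \<in> sets (borel :: (('x \<times> 'y) \<times> 'y) measure)"
      using B by (intro pre continuous_on_fst continuous_on_id borel_comp)
    then show ?thesis by (simp add: S_def 0)
  next
    case (Suc n)
    have "(\<lambda>p. (fst (fst p), snd p)) -` B \<in> sets (borel :: (('x \<times> 'y) \<times> 'y) measure)"
      using B by (intro pre continuous_on_Pair continuous_on_fst continuous_on_snd continuous_on_id)
    moreover have "snd -` V n \<in> sets (borel :: (('x \<times> 'y) \<times> 'y) measure)"
      using V by (intro borel_open open_vimage continuous_on_snd continuous_on_id)
    moreover have "(\<lambda>p. snd (fst p)) -` (- V n) \<in> sets (borel :: (('x \<times> 'y) \<times> 'y) measure)"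
      using V by (intro borel_closed closed_vimage continuous_on_fst continuous_on_snd continuous_on_id closed_Compl)
    ultimately show ?thesis unfolding S_def Suc nat.case by blast
  qed
  moreover have "(\<Inter>k. fst ` S k) = {}"
  proof (rule equals0I)
    fix p assume p: "p \<in> (\<Inter>k. fst ` S k)"
    obtain x y where xy: "p = (x, y)" by (cases p)
    have "p \<in> fst ` S 0" using p by blast
    then have "(x, y) \<notin> B" using xy by (auto simp: S_def)
    then obtain n where n: "y \<in> V n" "V n \<subseteq> - {y. (x, y) \<in> B}"
      using basis[of "- {y. (x, y) \<in> B}" y] cl by (auto simp: open_Compl)
    have "p \<in> fst ` S (Suc n)" using p by blast
    then show False using xy n by (auto simp: S_def)
  qed
  ultimately have "borel_separable (\<lambda>k. fst ` S k)"
    by (intro novikov_separation continuous_on_fst continuous_on_id)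
  then obtain G where G: "\<And>k. G k \<in> sets borel" "\<And>k. fst ` S k \<subseteq> G k" "(\<Inter>k. G k) = {}"
    unfolding borel_separable_def by metis
  have C: "(\<forall>y'\<in>V n. (x, y') \<notin> B) \<and> y \<in> V n" if "(x, y) \<notin> G (Suc n)" for x y n
  proof -
    have "(x, y) \<notin> fst ` S (Suc n)" using G(2) that by blast
    then have "((x, y), y') \<notin> S (Suc n)" for y' by force
    then show ?thesis by (auto simp: S_def)
  qed
  have "\<exists>X. X \<in> sets borel \<and> fst ` (- G (Suc n)) \<subseteq> X \<and> X \<inter> fst ` (B \<inter> snd -` V n) = {}" for n
  proof -
    have "snd -` V n \<in> sets (borel :: ('x \<times> 'y) measure)"
      using V by (intro borel_open open_vimage continuous_on_snd continuous_on_id)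
    then have S1: "B \<inter> snd -` V n \<in> sets borel" using B by blast
    have S2: "- G (Suc n) \<in> sets borel" using G(1) by (rule borel_comp)
    have S3: "fst ` (- G (Suc n)) \<inter> fst ` (B \<inter> snd -` V n) = {}" using C by fastforce
    obtain X where "X \<in> sets borel" "fst ` (- G (Suc n)) \<subseteq> X" "X \<inter> fst ` (B \<inter> snd -` V n) = {}"
      by (rule lusin_separation[OF S2 S1 continuous_on_fst[OF continuous_on_id] S3])
    then show ?thesis by blast
  qed
  then obtain X where X: "\<And>n. X n \<in> sets borel" "\<And>n. fst ` (- G (Suc n)) \<subseteq> X n"
     "\<And>n. X n \<inter> fst ` (B \<inter> snd -` V n) = {}"
    by metis
  have "- B = (\<Union>n. X n \<times> V n)"
  proof (intro equalityI subsetI)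
    fix p assume "p \<in> - B"
    obtain x y where xy: "p = (x, y)" by (cases p)
    have "(p, y) \<in> S 0" using \<open>p \<in> - B\<close> by (simp add: S_def)
    then have "p \<in> G 0" using G(2)[of 0] by force
    then obtain k where "p \<notin> G k" "k \<noteq> 0" using G(3) by (metis INT_I empty_iff)
    then obtain n where "p \<notin> G (Suc n)" using not0_implies_Suc by blast
    then have "y \<in> V n" "x \<in> X n" using C[of x y n] X(2)[of n] xy by force+
    then show "p \<in> (\<Union>n. X n \<times> V n)" using xy by blast
  next
    fix p assume "p \<in> (\<Union>n. X n \<times> V n)"
    then obtain n x y where "p = (x, y)" "x \<in> X n" "y \<in> V n" by blast
    then show "p \<in> - B" using X(3)[of n] by force
  qed
  with X(1) show ?thesis using that by blast
qed

text \<open>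
  Write \<open>- B\<close> as a countable union of rectangles \<open>X n \<times> V n\<close>. The section at \<open>x\<close> is empty exactly if
  the \<open>V n\<close> with \<open>x \<in> X n\<close> cover \<open>K\<close>. By compactness finitely many of them suffice, and there are only
  countably many finite sets of indices.
\<close>

lemma borel_projection_closed_sections:
  fixes B :: "('x::polish_space \<times> 'y::polish_space) set"
  assumes B: "B \<in> sets borel" and cl: "\<And>x. closed {y. (x, y) \<in> B}"
    and K: "compact K" "snd ` B \<subseteq> K"
  shows "fst ` B \<in> sets borel"
proof -
  obtain \<A> :: "'y set set" where A: "countable \<A>" "topological_basis \<A>"
    using ex_countable_basis by blast
  have ne: "\<A> \<noteq> {}"
    using A(2) topological_basisE[of \<A> UNIV undefined] by auto
  define V where "V = from_nat_into \<A>"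
  have V: "open (V n)" for n
    using A(2) from_nat_into[OF ne, of n] by (auto simp: V_def topological_basis_open)
  have basis: "\<exists>n. y \<in> V n \<and> V n \<subseteq> U" if U: "open U" "y \<in> U" for U y
  proof -
    obtain W where "W \<in> \<A>" "y \<in> W" "W \<subseteq> U" using topological_basisE[OF A(2) U] by blast
    then show ?thesis using from_nat_into_surj[OF A(1)] unfolding V_def by metis
  qed
  obtain X where X: "\<And>n. X n \<in> sets borel" "- B = (\<Union>n. X n \<times> V n)"
    using kunugui_novikov[OF B V basis cl] by blast
  define \<F> where "\<F> = {F. finite F \<and> K \<subseteq> (\<Union>n\<in>F. V n)}"
  have "countable \<F>"
    by (rule countable_subset[OF _ countable_Collect_finite]) (auto simp: \<F>_def)
  have "- fst ` B = (\<Union>F\<in>\<F>. \<Inter>n\<in>F. X n)"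
  proof (intro equalityI subsetI)
    fix x assume x: "x \<in> - fst ` B"
    have "K \<subseteq> (\<Union>n\<in>{n. x \<in> X n}. V n)"
    proof
      fix y assume "y \<in> K"
      have "(x, y) \<in> - B" using x by force
      then show "y \<in> (\<Union>n\<in>{n. x \<in> X n}. V n)" unfolding X(2) by blast
    qed
    then obtain F where "F \<subseteq> {n. x \<in> X n}" "finite F" "K \<subseteq> (\<Union>n\<in>F. V n)"
      using compactE_image[OF K(1), of "{n. x \<in> X n}" V] V by metis
    then show "x \<in> (\<Union>F\<in>\<F>. \<Inter>n\<in>F. X n)" unfolding \<F>_def by blast
  next
    fix x assume "x \<in> (\<Union>F\<in>\<F>. \<Inter>n\<in>F. X n)"
    then obtain F where F: "K \<subseteq> (\<Union>n\<in>F. V n)" "\<forall>n\<in>F. x \<in> X n" by (auto simp: \<F>_def)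
    have "(x, y) \<notin> B" for y
    proof
      assume "(x, y) \<in> B"
      then have "y \<in> K" using K(2) by force
      then obtain n where "n \<in> F" "y \<in> V n" using F(1) by blast
      then have "(x, y) \<in> - B" unfolding X(2) using F(2) by blast
      with \<open>(x, y) \<in> B\<close> show False by blast
    qed
    then show "x \<in> - fst ` B" by force
  qed
  moreover have "(\<Inter>n\<in>F. X n) \<in> sets borel" for F
    using X(1) by (cases "F = {}") (auto intro!: sets.countable_INT'')
  ultimately have "- fst ` B \<in> sets borel"
    using \<open>countable \<F>\<close> by (auto intro!: sets.countable_UN')
  then show ?thesis by (metis borel_comp double_complement)
qed

text \<open>
  The coordinates of the embedding are the truncated distances to a dense sequence. Its range is Borel:
  by completeness, a limit \<open>z\<close> of points of the range lies in the range iff \<open>z\<close> has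
  arbitrarily small coordinates, since a small coordinate forces approximating points to be close
  to each other.
\<close>

lemma polish_embedding_hilbert_cube:
  obtains e :: "'y::polish_space \<Rightarrow> nat \<Rightarrow> real" and g
  where "continuous_on UNIV e" "range e \<in> sets borel" "\<And>y n. e y n \<in> {0..1}"
    "\<And>y. g (e y) = y" "continuous_on (range e) g"
proof -
  obtain d :: "nat \<Rightarrow> 'y" where d: "\<And>x e. e > 0 \<Longrightarrow> \<exists>i. dist x (d i) < e"
    using dense_sequence_exists by blast
  define e where "e y n = min 1 (dist y (d n))" for y n
  have le1: "1 / real (Suc k) \<le> 1" for k by simp
  have cont: "continuous_on UNIV e"
    unfolding e_def by (intro continuous_on_coordinatewise_then_product continuous_intros)
  have coord: "\<exists>n. e y n < 1 / Suc k" for y k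
  proof -
    obtain n where "dist y (d n) < 1 / Suc k" using d[of "1 / Suc k" y] by auto
    then have "e y n < 1 / Suc k" unfolding e_def by linarith
    then show ?thesis ..
  qed
  have near: "dist y y' < 2 / Suc k" if "e y n < 1 / Suc k" "e y' n < 1 / Suc k" for y y' n k
  proof -
    have "dist y (d n) < 1 / Suc k" "dist y' (d n) < 1 / Suc k"
      using that le1[of k] unfolding e_def by (simp_all add: min_def split: if_splits)
    moreover have "2 / Suc k = 1 / Suc k + 1 / real (Suc k)" by simp
    ultimately show ?thesis using dist_triangle2[of y y' "d n"] by linarith
  qed
  have small: "\<exists>k. 2 / Suc k < r" if r: "r > 0" for r :: real
  proof -
    obtain k where "inverse (Suc k) < r / 2" using reals_Archimedean[of "r / 2"] r by auto
    then show ?thesis by (intro exI[of _ k]) (auto simp: field_simps)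
  qed
  have inj: "inj e"
  proof (rule injI, rule ccontr)
    fix y y' assume eq: "e y = e y'" and "y \<noteq> y'"
    then obtain k where k: "2 / Suc k < dist y y'" using small[of "dist y y'"] by auto
    obtain n where "e y n < 1 / Suc k" using coord by blast
    with near[of y n k y'] eq k show False by simp
  qed
  define g where "g = inv e"
  have ge: "g (e y) = y" for y unfolding g_def using inj by simp
  have open_coord: "open {z :: nat \<Rightarrow> real. z n < c}" for n c
    by (rule open_Collect_less) auto
  have "continuous_on (range e) g"
    unfolding continuous_on_topological
  proof (intro ballI allI impI)
    fix z U assume "z \<in> range e" "open U" "g z \<in> U"
    then obtain y where y: "z = e y" "y \<in> U" using ge by auto
    then obtain r where r: "r > 0" "ball y r \<subseteq> U" using \<open>open U\<close> openE by blast
    obtain k where k: "2 / Suc k < r" using small[OF r(1)] by blast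
    obtain n where n: "e y n < 1 / Suc k" using coord by blast
    have "g z' \<in> U" if "z' \<in> range e" "z' n < 1 / Suc k" for z'
    proof -
      obtain y' where y': "z' = e y'" using \<open>z' \<in> range e\<close> by blast
      then have "dist y y' < r" using near[OF n, of y'] that k by simp
      then show ?thesis using r(2) y' ge by auto
    qed
    then show "\<exists>A. open A \<and> z \<in> A \<and> (\<forall>w\<in>range e. w \<in> A \<longrightarrow> g w \<in> U)"
      using n y(1) by (intro exI[of _ "{z. z n < 1 / Suc k}"]) (auto simp: open_coord)
  qed
  moreover have "range e = closure (range e) \<inter> (\<Inter>k. \<Union>n. {z. z n < 1 / Suc k})"
  proof (intro equalityI subsetI)
    fix z assume "z \<in> range e"
    then show "z \<in> closure (range e) \<inter> (\<Inter>k. \<Union>n. {z. z n < 1 / Suc k})"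
      using coord closure_subset by fastforce
  next
    fix z assume z: "z \<in> closure (range e) \<inter> (\<Inter>k. \<Union>n. {z. z n < 1 / Suc k})"
    then have "\<exists>s. (\<forall>j. s j \<in> range e) \<and> s \<longlonglongrightarrow> z"
      by (simp only: Int_iff closure_sequential)
    then obtain s where s: "\<And>j. s j \<in> range e" "s \<longlonglongrightarrow> z"
      by metis
    define y where "y j = g (s j)" for j
    have y: "s j = e (y j)" for j
    proof -
      obtain w where "s j = e w" using s(1)[of j] by blast
      then show ?thesis by (simp add: y_def ge)
    qed
    have "Cauchy y"
    proof (rule metric_CauchyI)
      fix r :: real assume "r > 0"
      then obtain k where k: "2 / Suc k < r" using small by blast
      obtain n where n: "z n < 1 / Suc k" using z by blast
      have "eventually (\<lambda>j. s j \<in> {z. z n < 1 / Suc k}) sequentially"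
        using topological_tendstoD[OF s(2) open_coord] n by simp
      then obtain N where "\<And>j. j \<ge> N \<Longrightarrow> e (y j) n < 1 / Suc k"
        unfolding eventually_sequentially y by auto
      then have "dist (y i) (y j) < r" if "i \<ge> N" "j \<ge> N" for i j
        using near[of "y i" n k "y j"] that k by fastforce
      then show "\<exists>N. \<forall>i\<ge>N. \<forall>j\<ge>N. dist (y i) (y j) < r" by blast
    qed
    then obtain l where l: "y \<longlonglongrightarrow> l" using Cauchy_convergent convergent_def by blast
    have "(\<lambda>j. e (y j)) \<longlonglongrightarrow> e l"
      by (rule continuous_on_tendsto_compose[OF cont l]) auto
    then have "s \<longlonglongrightarrow> e l" by (simp flip: y)
    then have "z = e l" using s(2) LIMSEQ_unique by blast
    then show "z \<in> range e" by blast
  qed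
  moreover have "closure (range e) \<inter> (\<Inter>k. \<Union>n. {z. z n < 1 / Suc k}) \<in> sets borel"
    using open_coord by (intro sets.Int sets.countable_INT' sets.countable_UN') auto
  ultimately have "range e \<in> sets borel" by (simp only:)
  moreover have "e y n \<in> {0..1}" for y n by (simp add: e_def)
  ultimately show ?thesis using that[OF cont _ _ ge] \<open>continuous_on (range e) g\<close> by blast
qed

lemma compact_hilbert_cube: "compact {z :: nat \<Rightarrow> real. \<forall>n. z n \<in> {0..1}}"
proof -
  have "compactin (product_topology (\<lambda>_. euclidean) UNIV) (PiE UNIV (\<lambda>_::nat. {0..1::real}))"
    unfolding compactin_PiE by (simp add: compactin_euclidean_iff)
  then show ?thesis
    by (simp add: euclidean_product_topology compactin_euclidean_iff PiE_def Pi_def)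
qed

text \<open>
  The embedding into the Hilbert cube carries the compact sections to closed subsets of one compact
  set, and it does not change the projection.
\<close>

theorem borel_projection_compact_sections:
  fixes B :: "('x::polish_space \<times> 'y::polish_space) set"
  assumes B: "B \<in> sets borel" and K: "\<And>x. compact {y. (x, y) \<in> B}"
  shows "fst ` B \<in> sets borel"
proof -
  obtain e :: "'y \<Rightarrow> nat \<Rightarrow> real" and g where e: "continuous_on UNIV e" "range e \<in> sets borel"
    "\<And>y n. e y n \<in> {0..1}" "\<And>y. g (e y) = y" "continuous_on (range e) g"
    using polish_embedding_hilbert_cube by metis
  define R where "R = (UNIV :: 'x set) \<times> range e"
  define B' where "B' = (\<lambda>(x, y). (x, e y)) ` B"
  have R: "R \<in> sets borel"
    unfolding R_def borel_prod[symmetric] using e(2) by (intro pair_measureI) auto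
  have "continuous_on R (\<lambda>p. (fst p, g (snd p)))"
    unfolding R_def by (intro continuous_intros continuous_on_compose2[OF e(5)]) auto
  then have m: "(\<lambda>p. (fst p, g (snd p))) \<in> borel_measurable (restrict_space borel R)"
    by (rule borel_measurable_continuous_on_restrict)
  have "(\<lambda>p. (fst p, g (snd p))) -` B \<inter> R \<in> sets (restrict_space borel R)"
    using measurable_sets[OF m B] by (simp add: space_restrict_space)
  then have "(\<lambda>p. (fst p, g (snd p))) -` B \<inter> R \<in> sets borel"
    using R by (simp add: sets_restrict_space_iff)
  also have "(\<lambda>p. (fst p, g (snd p))) -` B \<inter> R = B'"
    unfolding B'_def R_def using e(4) by force
  finally have "B' \<in> sets borel" .
  moreover have "closed {z. (x, z) \<in> B'}" for x
  proof -
    have "{z. (x, z) \<in> B'} = e ` {y. (x, y) \<in> B}" unfolding B'_def by force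
    moreover have "compact (e ` {y. (x, y) \<in> B})"
      by (intro compact_continuous_image continuous_on_subset[OF e(1)] K) auto
    ultimately show ?thesis by (simp add: compact_imp_closed)
  qed
  ultimately have "fst ` B' \<in> sets borel"
    by (rule borel_projection_closed_sections[OF _ _ compact_hilbert_cube]) (use e(3) in \<open>auto simp: B'_def\<close>)
  also have "fst ` B' = fst ` B" unfolding B'_def by force
  finally show ?thesis .
qed

text \<open>
  The sections are cut down step by step to the first ball of radius \<open>1 / Suc k\<close>, in an enumeration
  of balls with dense centres, that still meets them. This index is a Borel function of \<open>x\<close> by the
  projection theorem, and the centres of the chosen balls converge to the one point that remains.
\<close>

theorem borel_selector_compact_sections:
  fixes B :: "('x::polish_space \<times> 'y::polish_space) set"
  assumes B: "B \<in> sets borel" and K: "\<And>x. compact {y. (x, y) \<in> B}"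
  obtains \<phi> where "\<phi> \<in> borel_measurable borel" "\<And>x. x \<in> fst ` B \<Longrightarrow> (x, \<phi> x) \<in> B"
proof -
  obtain d :: "nat \<Rightarrow> 'y" where d: "\<And>x e. e > 0 \<Longrightarrow> \<exists>i. dist x (d i) < e"
    using dense_sequence_exists by blast
  define N where "N k A x = (LEAST n. \<exists>y. (x, y) \<in> A \<and> y \<in> cball (d n) (1 / Suc k))"
    for k x and A :: "('x \<times> 'y) set"
  define C where "C = rec_nat B (\<lambda>k A. {p \<in> A. snd p \<in> cball (d (N k A (fst p))) (1 / Suc k)})"
  have C0: "C 0 = B" by (simp add: C_def)
  have CS: "C (Suc k) = {p \<in> C k. snd p \<in> cball (d (N k (C k) (fst p))) (1 / Suc k)}" for k
    by (simp add: C_def)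
  have meas_N: "N k A \<in> measurable borel (count_space UNIV)"
    if A: "A \<in> sets borel" "\<And>x. compact {y. (x, y) \<in> A}" for k A
  proof -
    have "{x. \<exists>y. (x, y) \<in> A \<and> y \<in> cball (d n) (1 / Suc k)} \<in> sets borel" for n
    proof -
      have "fst ` (A \<inter> UNIV \<times> cball (d n) (1 / Suc k)) \<in> sets borel"
      proof (rule borel_projection_compact_sections)
        have "UNIV \<times> cball (d n) (1 / Suc k) \<in> sets (borel :: ('x \<times> 'y) measure)"
          by (intro borel_closed closed_Times) auto
        then show "A \<inter> UNIV \<times> cball (d n) (1 / Suc k) \<in> sets borel" using A(1) by blast
        fix x
        have "{y. (x, y) \<in> A \<inter> UNIV \<times> cball (d n) (1 / Suc k)} = {y. (x, y) \<in> A} \<inter> cball (d n) (1 / Suc k)"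
          by auto
        then show "compact {y. (x, y) \<in> A \<inter> UNIV \<times> cball (d n) (1 / Suc k)}"
          using A(2) by (simp add: compact_Int_closed)
      qed
      also have "fst ` (A \<inter> UNIV \<times> cball (d n) (1 / Suc k)) =
          {x. \<exists>y. (x, y) \<in> A \<and> y \<in> cball (d n) (1 / Suc k)}" by force
      finally show ?thesis .
    qed
    then show ?thesis unfolding N_def
      by (intro measurable_Least) (auto simp: pred_def)
  qed
  have C: "C k \<in> sets borel \<and> (\<forall>x. compact {y. (x, y) \<in> C k})" for k
  proof (induction k)
    case 0
    then show ?case using B K by (simp add: C0)
  next
    case (Suc k)
    let ?N = "N k (C k)"
    have N: "?N \<in> measurable borel (count_space UNIV)" using meas_N Suc by blast
    have "C (Suc k) = C k \<inter> (\<Union>n. (?N -` {n} \<inter> space borel) \<times> cball (d n) (1 / Suc k))"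
      unfolding CS by auto
    moreover have "(?N -` {n} \<inter> space borel) \<times> cball (d n) (1 / Suc k) \<in> sets borel" for n
      unfolding borel_prod[symmetric] by (intro pair_measureI measurable_sets[OF N]) auto
    ultimately have "C (Suc k) \<in> sets borel" using Suc by auto
    moreover have "{y. (x, y) \<in> C (Suc k)} = {y. (x, y) \<in> C k} \<inter> cball (d (?N x)) (1 / Suc k)" for x
      unfolding CS by auto
    ultimately show ?case using Suc by (simp add: compact_Int_closed)
  qed
  have ne: "\<exists>y. (x, y) \<in> C k" if "x \<in> fst ` B" for x k
  proof (induction k)
    case 0
    then show ?case using that by (force simp: C0)
  next
    case (Suc k)
    then obtain y where y: "(x, y) \<in> C k" by blast
    obtain n where "dist y (d n) < 1 / Suc k" using d[of "1 / Suc k" y] by auto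
    with y have "\<exists>n y. (x, y) \<in> C k \<and> y \<in> cball (d n) (1 / Suc k)"
      by (auto simp: dist_commute intro: less_imp_le)
    then have "\<exists>y. (x, y) \<in> C k \<and> y \<in> cball (d (N k (C k) x)) (1 / Suc k)"
      unfolding N_def by (rule LeastI_ex)
    then show ?case unfolding CS by auto
  qed
  have dec: "C l \<subseteq> C k" if "k \<le> l" for k l
    using that by (rule lift_Suc_antimono_le[rotated]) (auto simp: CS)
  have lim: "\<exists>y. (x, y) \<in> B \<and> (\<lambda>k. d (N k (C k) x)) \<longlonglongrightarrow> y" if x: "x \<in> fst ` B" for x
  proof -
    have close: "dist (d (N k (C k) x)) y \<le> 1 / Suc k" if "(x, y) \<in> C (Suc k)" for y k
      using that unfolding CS by simp
    have small: "\<exists>k. 2 / Suc k < r" if "r > 0" for r :: real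
    proof -
      obtain k where "inverse (Suc k) < r / 2" using reals_Archimedean[of "r / 2"] \<open>r > 0\<close> by auto
      then show ?thesis by (intro exI[of _ k]) (auto simp: field_simps)
    qed
    have diam: "\<exists>k. \<forall>y\<in>{y. (x, y) \<in> C k}. \<forall>y'\<in>{y. (x, y) \<in> C k}. dist y y' < r" if r: "r > 0" for r
    proof -
      obtain k where k: "2 / Suc k < r" using small[OF r] by blast
      have "dist y y' < r" if "(x, y) \<in> C (Suc k)" "(x, y') \<in> C (Suc k)" for y y'
      proof -
        have "2 / Suc k = 1 / Suc k + 1 / real (Suc k)" by simp
        then show ?thesis
          using close[OF that(1)] close[OF that(2)] k dist_triangle3[of y y' "d (N k (C k) x)"] by linarith
      qed
      then show ?thesis by blast
    qed
    have "\<exists>y. \<forall>k. y \<in> {y. (x, y) \<in> C k}"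
    proof -
      have "closed {y. (x, y) \<in> C k}" for k using C by (simp add: compact_imp_closed)
      moreover have "{y. (x, y) \<in> C k} \<noteq> {}" for k using ne[OF x] by blast
      moreover have "{y. (x, y) \<in> C l} \<subseteq> {y. (x, y) \<in> C k}" if "k \<le> l" for k l using dec[OF that] by blast
      ultimately show ?thesis
        using decreasing_closed_nest[of "\<lambda>k. {y. (x, y) \<in> C k}"] diam by metis
    qed
    then obtain y where y: "\<And>k. (x, y) \<in> C k" by blast
    have "(\<lambda>k. d (N k (C k) x)) \<longlonglongrightarrow> y"
    proof (rule metric_LIMSEQ_I)
      fix r :: real assume "r > 0"
      then obtain k where k: "2 / Suc k < r" using small by blast
      have "dist (d (N l (C l) x)) y < r" if "l \<ge> k" for l
      proof -
        have "1 / real (Suc l) \<le> 1 / Suc k" using that by (simp add: frac_le)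
        moreover have "1 / real (Suc k) \<le> 2 / Suc k" by (simp add: divide_right_mono)
        ultimately show ?thesis using close[OF y, of l] k by linarith
      qed
      then show "\<exists>no. \<forall>n\<ge>no. dist (d (N n (C n) x)) y < r" by blast
    qed
    then show ?thesis using y[of 0] C0 by auto
  qed
  define \<phi> where "\<phi> x = lim (\<lambda>k. d (N k (C k) x))" for x
  have conv: "(\<lambda>k. d (N k (C k) x)) \<longlonglongrightarrow> \<phi> x" for x
  proof (cases "x \<in> fst ` B")
    case True
    then show ?thesis using lim[OF True] unfolding \<phi>_def by (metis limI)
  next
    case False
    then have "(x, y) \<notin> C k" for y k using dec[of 0 k] C0 by force
    \<comment> \<open>Off the projection the chosen index is a fixed default value, so the centres are constant.\<close>
    then have "N k (C k) x = (LEAST n. False)" for k by (simp add: N_def)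
    then show ?thesis unfolding \<phi>_def by simp
  qed
  show ?thesis
  proof (rule that)
    have "(\<lambda>x. d (N k (C k) x)) \<in> borel_measurable borel" for k
      using meas_N C by (intro measurable_compose[of "N k (C k)" borel "count_space UNIV" d]) auto
    then show "\<phi> \<in> borel_measurable borel"
      by (rule borel_measurable_LIMSEQ_metric) (use conv in auto)
    show "(x, \<phi> x) \<in> B" if "x \<in> fst ` B" for x
      using lim[OF that] conv[of x] LIMSEQ_unique by blast
  qed
qed

section \<open>Minimization of inf-compact functions\<close>

definition compact_sublevels :: "'a::topological_space set \<Rightarrow> ('a \<Rightarrow> ennreal) \<Rightarrow> bool" where
  "compact_sublevels E h \<longleftrightarrow> (\<forall>l<\<infinity>. compact {a \<in> E. h a \<le> l})"

lemma compact_sublevels_iff_inf_compact_on: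
  "compact_sublevels E h \<longleftrightarrow> inf_compact_on E (\<lambda>a. enn2ereal (h a))"
proof
  assume *: "compact_sublevels E h"
  show "inf_compact_on E (\<lambda>a. enn2ereal (h a))"
    unfolding inf_compact_on_def
  proof
    fix l :: real
    show "compact {e \<in> E. enn2ereal (h e) \<le> ereal l}"
    proof (cases "l \<ge> 0")
      case True
      then have "{e \<in> E. enn2ereal (h e) \<le> ereal l} = {e \<in> E. h e \<le> ennreal l}"
        by (simp add: less_eq_ennreal.rep_eq enn2ereal_ennreal)
      then show ?thesis using * by (simp add: compact_sublevels_def)
    next
      case False
      have "\<not> enn2ereal (h e) \<le> ereal l" for e
        using enn2ereal_nonneg[of "h e"] False by (metis ereal_less_eq(5) order_trans)
      then show ?thesis by simp
    qed
  qed
next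
  assume *: "inf_compact_on E (\<lambda>a. enn2ereal (h a))"
  show "compact_sublevels E h"
    unfolding compact_sublevels_def
  proof (intro allI impI)
    fix l :: ennreal assume "l < \<infinity>"
    then obtain r where r: "l = ennreal r" "r \<ge> 0" by (cases l) auto
    then have "{e \<in> E. enn2ereal (h e) \<le> ereal r} = {e \<in> E. h e \<le> l}"
      by (simp add: less_eq_ennreal.rep_eq enn2ereal_ennreal)
    then show "compact {a \<in> E. h a \<le> l}" using * unfolding inf_compact_on_def by metis
  qed
qed

text \<open>
  The points whose \<open>n\<close>-th value exceeds the limit of the infima by at most \<open>1 / Suc n\<close> form a
  decreasing sequence of nonempty compact sets. A common point minimizes the limit function, up to
  an error that vanishes. This exchanges a monotone limit with a minimum.
\<close>

lemma compact_sublevels_INF_attained_of_SUP: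
  fixes h :: "nat \<Rightarrow> 'a::t2_space \<Rightarrow> ennreal"
  assumes cs: "\<And>n. compact_sublevels E (h n)" and mono: "\<And>a. a \<in> E \<Longrightarrow> incseq (\<lambda>n. h n a)"
    and ne: "E \<noteq> {}"
  shows "\<exists>a\<in>E. (SUP n. h n a) \<le> (SUP n. INF b\<in>E. h n b)"
proof (cases "(SUP n. INF b\<in>E. h n b) = \<infinity>")
  case True
  then show ?thesis unfolding True using ne by auto
next
  case False
  define m where "m = (SUP n. INF b\<in>E. h n b)"
  have m: "m < \<infinity>" using False unfolding m_def[symmetric] by (simp add: less_top)
  define K where "K n = {a \<in> E. h n a \<le> m + ennreal (1 / Suc n)}" for n
  have K: "compact (K n)" for n
    using cs m unfolding K_def compact_sublevels_def by simp
  have dec: "K l \<subseteq> K k" if "k \<le> l" for k l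
  proof
    fix a assume a: "a \<in> K l"
    then have "h k a \<le> h l a" using mono that by (auto simp: K_def incseq_def)
    also have "h l a \<le> m + ennreal (1 / Suc l)" using a by (simp add: K_def)
    also have "\<dots> \<le> m + ennreal (1 / Suc k)"
      using that by (intro add_left_mono ennreal_leI) (simp add: frac_le)
    finally show "a \<in> K k" using a by (simp add: K_def)
  qed
  have "K n \<noteq> {}" for n
  proof -
    have "(INF b\<in>E. h n b) \<le> m" unfolding m_def by (rule SUP_upper) simp
    also have "m < m + ennreal (1 / Suc n)"
      using m by (simp add: ennreal_zero_less_divide)
    finally obtain a where "a \<in> E" "h n a < m + ennreal (1 / Suc n)" by (auto simp: INF_less_iff)
    then show ?thesis by (auto simp: K_def intro: less_imp_le)
  qed
  have "K 0 \<inter> (\<Inter>n\<in>UNIV. K n) \<noteq> {}"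
  proof (rule compact_imp_fip_image[OF K])
    show "closed (K n)" for n using K by (rule compact_imp_closed)
    fix I' :: "nat set" assume I: "finite I'"
    have "K (Max (insert 0 I')) \<subseteq> K n" if "n \<in> insert 0 I'" for n
      using I that by (intro dec Max_ge) auto
    then have "K (Max (insert 0 I')) \<subseteq> K 0 \<inter> (\<Inter>n\<in>I'. K n)" by blast
    then show "K 0 \<inter> (\<Inter>n\<in>I'. K n) \<noteq> {}" using \<open>\<And>n. K n \<noteq> {}\<close> by blast
  qed
  then obtain a where a: "\<And>n. a \<in> K n" by blast
  have "h n a \<le> m" for n
  proof (rule ennreal_le_epsilon)
    fix e :: real assume "e > 0"
    then obtain k where k: "inverse (Suc k) < e" using reals_Archimedean by blast
    have "a \<in> E" using a[of 0] by (simp add: K_def)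
    then have "h n a \<le> h (max n k) a" using mono by (auto simp: incseq_def)
    also have "\<dots> \<le> m + ennreal (1 / Suc (max n k))" using a[of "max n k"] by (simp add: K_def)
    also have "1 / real (Suc (max n k)) \<le> 1 / Suc k" by (simp add: frac_le)
    also have "1 / real (Suc k) \<le> e" using k by (simp add: inverse_eq_divide)
    finally show "h n a \<le> m + ennreal e" by (simp add: add_left_mono ennreal_leI)
  qed
  then show ?thesis using a[of 0] unfolding m_def[symmetric] by (auto simp: K_def SUP_le_iff)
qed

lemma compact_sublevels_INF_attained:
  fixes h :: "'a::t2_space \<Rightarrow> ennreal"
  assumes "compact_sublevels E h" "E \<noteq> {}"
  shows "\<exists>a\<in>E. h a = (INF b\<in>E. h b)"
proof -
  obtain a where "a \<in> E" "h a \<le> (INF b\<in>E. h b)"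
    using compact_sublevels_INF_attained_of_SUP[of E "\<lambda>_. h"] assms by auto
  then show ?thesis by (metis INF_lower antisym)
qed

text \<open>
  Since minima are attained, the sublevel sets of the infimum are projections of the sublevel sets of
  \<open>h\<close>. The infimum over an empty section is \<open>\<infinity>\<close>.
\<close>

lemma borel_measurable_INF_section:
  fixes h :: "'x::polish_space \<times> 'a::polish_space \<Rightarrow> ennreal"
  assumes G: "G \<in> sets borel" and h: "h \<in> borel_measurable (restrict_space borel G)"
    and cs: "\<And>x. compact_sublevels {a. (x, a) \<in> G} (\<lambda>a. h (x, a))"
  shows "(\<lambda>x. INF a\<in>{a. (x, a) \<in> G}. h (x, a)) \<in> borel_measurable borel"
proof (rule borel_measurableI_le)
  fix l :: ennreal
  let ?m = "\<lambda>x. INF a\<in>{a. (x, a) \<in> G}. h (x, a)"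
  show "{x \<in> space borel. ?m x \<le> l} \<in> sets borel"
  proof (cases "l = \<infinity>")
    case False
    define B where "B = {p \<in> G. h p \<le> l}"
    have "{p \<in> space (restrict_space borel G). h p \<le> l} \<in> sets (restrict_space borel G)"
      using h by measurable
    then have B: "B \<in> sets borel"
      using G by (simp add: space_restrict_space sets_restrict_space_iff B_def)
    have sec: "{a. (x, a) \<in> B} = {a \<in> {a. (x, a) \<in> G}. h (x, a) \<le> l}" for x by (auto simp: B_def)
    have "fst ` B \<in> sets borel"
      using cs False by (intro borel_projection_compact_sections[OF B]) (simp add: sec compact_sublevels_def less_top)
    also have "fst ` B = {x \<in> space borel. ?m x \<le> l}"
    proof (intro equalityI subsetI)
      fix x assume "x \<in> fst ` B"
      then obtain a where "(x, a) \<in> G" "h (x, a) \<le> l" by (auto simp: B_def)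
      then show "x \<in> {x \<in> space borel. ?m x \<le> l}" by (auto intro: INF_lower2)
    next
      fix x assume x: "x \<in> {x \<in> space borel. ?m x \<le> l}"
      have "{a. (x, a) \<in> G} \<noteq> {}"
      proof
        assume "{a. (x, a) \<in> G} = {}"
        then have "?m x = \<infinity>" by (simp only: image_empty Inf_empty infinity_ennreal_def)
        then show False using x False by (simp add: top_unique)
      qed
      then obtain a where "(x, a) \<in> G" "h (x, a) = ?m x"
        using compact_sublevels_INF_attained[OF cs] by blast
      then show "x \<in> fst ` B" using x by (force simp: B_def)
    qed
    finally show ?thesis .
  qed simp
qed

text \<open>
  Where the infimum \<open>m x\<close> is finite, the minimizers at \<open>x\<close> are the sublevel set of \<open>h\<close> at level \<open>m x\<close>, hence compact, and
  measurability of \<open>m\<close> makes them the sections of a Borel set.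
\<close>

lemma borel_minimizer_exists:
  fixes h :: "'x::polish_space \<times> 'a::polish_space \<Rightarrow> ennreal"
  assumes G: "G \<in> sets borel" and h: "h \<in> borel_measurable (restrict_space borel G)"
    and cs: "\<And>x. compact_sublevels {a. (x, a) \<in> G} (\<lambda>a. h (x, a))"
  obtains \<phi> where "\<phi> \<in> borel_measurable borel"
    "\<And>x. (INF a\<in>{a. (x, a) \<in> G}. h (x, a)) < \<infinity> \<Longrightarrow>
        (x, \<phi> x) \<in> G \<and> h (x, \<phi> x) = (INF a\<in>{a. (x, a) \<in> G}. h (x, a))"
proof -
  define m where "m x = (INF a\<in>{a. (x, a) \<in> G}. h (x, a))" for x
  have m: "m \<in> borel_measurable borel"
    unfolding m_def[abs_def] by (rule borel_measurable_INF_section[OF assms])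
  define B where "B = {p \<in> G. h p \<le> m (fst p) \<and> m (fst p) < \<infinity>}"
  have mf: "(\<lambda>p. m (fst p)) \<in> borel_measurable (restrict_space borel G)"
    using m by (intro measurable_restrict_space1)
      (auto intro!: measurable_compose[OF borel_measurable_continuous_onI m] continuous_on_fst continuous_on_id)
  have "{p \<in> space (restrict_space borel G). h p \<le> m (fst p) \<and> m (fst p) < \<infinity>} \<in> sets (restrict_space borel G)"
    using h mf by measurable
  then have B: "B \<in> sets borel"
    using G by (simp add: space_restrict_space sets_restrict_space_iff B_def)
  have "compact {a. (x, a) \<in> B}" for x
  proof (cases "m x < \<infinity>")
    case True
    then have "{a. (x, a) \<in> B} = {a \<in> {a. (x, a) \<in> G}. h (x, a) \<le> m x}" by (auto simp: B_def)
    then show ?thesis using cs True by (simp add: compact_sublevels_def)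
  next
    case False
    then have "{a. (x, a) \<in> B} = {}" by (auto simp: B_def)
    then show ?thesis by simp
  qed
  then obtain \<phi> where \<phi>: "\<phi> \<in> borel_measurable borel" "\<And>x. x \<in> fst ` B \<Longrightarrow> (x, \<phi> x) \<in> B"
    using borel_selector_compact_sections[OF B] by metis
  have "(x, \<phi> x) \<in> G \<and> h (x, \<phi> x) = m x" if x: "m x < \<infinity>" for x
  proof -
    have "{a. (x, a) \<in> G} \<noteq> {}"
    proof
      assume "{a. (x, a) \<in> G} = {}"
      then have "m x = \<infinity>" by (simp only: m_def image_empty Inf_empty infinity_ennreal_def)
      then show False using x by simp
    qed
    then obtain a where "(x, a) \<in> G" "h (x, a) = m x"
      using compact_sublevels_INF_attained[OF cs] unfolding m_def by blast
    then have "(x, a) \<in> B" using x by (simp add: B_def)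
    then have "(x, \<phi> x) \<in> B" using \<phi>(2)[of x] by force
    then have "(x, \<phi> x) \<in> G" "h (x, \<phi> x) \<le> m x" by (auto simp: B_def)
    moreover have "m x \<le> h (x, \<phi> x)" unfolding m_def using \<open>(x, \<phi> x) \<in> G\<close> by (intro INF_lower) simp
    ultimately show ?thesis by simp
  qed
  then show ?thesis using that[OF \<phi>(1)] unfolding m_def by blast
qed

text \<open>
  At a point with \<open>c a \<le> l\<close> the sum is at most \<open>l\<close> iff for every \<open>r \<ge> 0\<close> either \<open>c a + r \<le> l\<close> or \<open>g a \<le> r\<close>. For each \<open>r\<close> the
  first condition defines a sublevel set of \<open>c\<close>, and the second a closed part of a compact set.
\<close>

lemma compact_sublevels_add_continuous:
  fixes c :: "'a::t2_space \<Rightarrow> ennreal" and g :: "'a \<Rightarrow> real"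
  assumes c: "compact_sublevels E c" and g: "continuous_on E g"
  shows "compact_sublevels E (\<lambda>a. c a + ennreal (g a))"
  unfolding compact_sublevels_def
proof (intro allI impI)
  fix l :: ennreal assume l: "l < \<infinity>"
  define C where "C = {a \<in> E. c a \<le> l}"
  have C: "compact C" using c l by (simp add: C_def compact_sublevels_def)
  define K where "K r = {a \<in> E. c a + ennreal r \<le> l} \<union> {a \<in> C. g a \<le> r}" for r
  have K: "compact (K r)" for r
  proof -
    have "compact {a \<in> E. c a + ennreal r \<le> l}"
    proof (cases "ennreal r \<le> l")
      case True
      then have "{a \<in> E. c a + ennreal r \<le> l} = {a \<in> E. c a \<le> l - ennreal r}"
        by (auto simp: ennreal_le_minus_iff add.commute)
      moreover have "l - ennreal r < \<infinity>" using l by (simp add: less_top[symmetric] ennreal_minus_eq_top)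
      ultimately show ?thesis using c by (simp add: compact_sublevels_def)
    next
      case False
      have "\<not> c a + ennreal r \<le> l" for a
        using False order_trans[of "ennreal r" "c a + ennreal r" l] by auto
      then have "{a \<in> E. c a + ennreal r \<le> l} = {}" by blast
      then show ?thesis by (simp only: compact_empty)
    qed
    moreover have "compact {a \<in> C. g a \<le> r}"
    proof -
      have "continuous_on C g" using g by (rule continuous_on_subset) (auto simp: C_def)
      then have "closedin (top_of_set C) (C \<inter> g -` {..r})"
        by (rule continuous_closedin_preimage) simp
      then have "compact (C \<inter> g -` {..r})" using C closedin_compact by blast
      moreover have "C \<inter> g -` {..r} = {a \<in> C. g a \<le> r}" by auto
      ultimately show ?thesis by simp
    qed
    ultimately show ?thesis unfolding K_def by (rule compact_Un)
  qed
  have "{a \<in> E. c a + ennreal (g a) \<le> l} = C \<inter> (\<Inter>r\<in>{0..}. K r)"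
  proof (intro equalityI subsetI)
    fix a assume a: "a \<in> {a \<in> E. c a + ennreal (g a) \<le> l}"
    then have "c a \<le> l" by (auto intro: order_trans[rotated])
    moreover have "c a + ennreal r \<le> l" if r: "r < g a" for r
    proof -
      have "c a + ennreal r \<le> c a + ennreal (g a)"
        using r by (intro add_left_mono ennreal_leI) simp
      then show ?thesis using a order_trans by blast
    qed
    ultimately show "a \<in> C \<inter> (\<Inter>r\<in>{0..}. K r)" using a by (force simp: C_def K_def)
  next
    fix a assume a: "a \<in> C \<inter> (\<Inter>r\<in>{0..}. K r)"
    then have aE: "a \<in> E" "c a \<le> l" by (auto simp: C_def)
    have "c a + ennreal (g a) \<le> l"
    proof (cases "g a > 0")
      case True
      obtain l' where l': "l = ennreal l'" "l' \<ge> 0" using l by (cases l) auto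
      obtain c' where c': "c a = ennreal c'" "c' \<ge> 0" using aE(2) l by (cases "c a") (auto simp: top_unique)
      have nonneg: "r \<le> l' - c'" if "r < g a" "r \<ge> 0" for r
      proof -
        have "c a + ennreal r \<le> l" using a that by (auto simp: K_def)
        then show ?thesis using l' c' that by (simp flip: ennreal_plus)
      qed
      have "c' \<le> l'" using aE(2) l' c' by simp
      have "g a \<le> l' - c'"
      proof (rule dense_le)
        fix r assume "r < g a"
        then show "r \<le> l' - c'" using nonneg[of r] \<open>c' \<le> l'\<close> by (cases "r \<ge> 0") auto
      qed
      then show ?thesis using l' c' True by (simp flip: ennreal_plus)
    qed (use aE in \<open>simp add: ennreal_neg\<close>)
    then show "a \<in> {a \<in> E. c a + ennreal (g a) \<le> l}" using aE by simp
  qed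
  moreover have "compact (C \<inter> (\<Inter>r\<in>{0..}. K r))"
    using C K by (intro compact_Int_closed closed_INT) (auto intro: compact_imp_closed)
  ultimately show "compact {a \<in> E. c a + ennreal (g a) \<le> l}" by simp
qed

lemma compact_sublevels_SUP:
  fixes h :: "nat \<Rightarrow> 'a::t2_space \<Rightarrow> ennreal"
  assumes "\<And>n. compact_sublevels E (h n)"
  shows "compact_sublevels E (\<lambda>a. SUP n. h n a)"
  unfolding compact_sublevels_def
proof (intro allI impI)
  fix l :: ennreal assume l: "l < \<infinity>"
  have K: "compact {a \<in> E. h n a \<le> l}" for n
    using assms l by (simp add: compact_sublevels_def)
  have "{a \<in> E. (SUP n. h n a) \<le> l} = {a \<in> E. h 0 a \<le> l} \<inter> (\<Inter>n. {a \<in> E. h n a \<le> l})"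
    by (auto simp: SUP_le_iff)
  moreover have "compact ({a \<in> E. h 0 a \<le> l} \<inter> (\<Inter>n. {a \<in> E. h n a \<le> l}))"
    using K by (intro compact_Int_closed closed_INT) (auto intro: compact_imp_closed)
  ultimately show "compact {a \<in> E. (SUP n. h n a) \<le> l}" by simp
qed

section \<open>The process controlled by a policy\<close>

locale markov_decision_process =
  fixes M :: "('x::polish_space, 'a::polish_space, 'z) mdp_scheme"
  assumes mdp: "is_mdp M"
begin

lemma states_borel: "states M \<in> sets borel" and actions_borel: "actions M \<in> sets borel"
  and feasible_nonempty: "x \<in> states M \<Longrightarrow> feasible M x \<noteq> {}"
  and feasible_subset: "x \<in> states M \<Longrightarrow> feasible M x \<subseteq> actions M"
  and feasible_borel: "x \<in> states M \<Longrightarrow> feasible M x \<in> sets borel"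
  and Gr_step: "Gr M \<in> sets (step_space M)"
  and stationary_exists: "\<exists>\<phi>. stationary_policy M \<phi>"
  and cost_measurable: "cost M \<in> borel_measurable (borel_on (Gr M))"
  and transition_measurable: "transition M \<in> borel_on (Gr M) \<rightarrow>\<^sub>M prob_algebra (state_space M)"
  using mdp unfolding is_mdp_def by auto

lemma space_state [simp]: "space (state_space M) = states M"
  and space_action [simp]: "space (action_space M) = actions M"
  and space_step [simp]: "space (step_space M) = states M \<times> actions M"
  by (simp_all add: state_space_def action_space_def step_space_def space_restrict_space)

lemma states_actions_borel: "states M \<times> actions M \<in> sets borel"
  unfolding borel_prod[symmetric] by (intro pair_measureI states_borel actions_borel)

lemma Gr_subset: "Gr M \<subseteq> states M \<times> actions M"
  using feasible_subset by (auto simp: graph_of_def)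

lemma Gr_borel: "Gr M \<in> sets borel"
  using Gr_step states_actions_borel by (simp add: step_space_def sets_restrict_space_iff)

lemma restrict_step_Gr: "restrict_space (step_space M) (Gr M) = borel_on (Gr M)"
proof -
  have "restrict_space (restrict_space borel (states M \<times> actions M)) (Gr M) =
      restrict_space borel ((states M \<times> actions M) \<inter> Gr M)"
    by (rule restrict_restrict_space) (use states_actions_borel Gr_borel in auto)
  then show ?thesis using Gr_subset by (simp add: step_space_def Int_absorb1)
qed

lemma measurable_fst_step: "fst \<in> step_space M \<rightarrow>\<^sub>M state_space M"
  unfolding step_space_def state_space_def
  by (intro measurable_restrict_space2 measurable_restrict_space1 borel_measurable_continuous_onI
      continuous_on_fst continuous_on_id) (auto simp: space_restrict_space)

lemma measurable_pair_step:
  assumes "f \<in> N \<rightarrow>\<^sub>M state_space M" "g \<in> N \<rightarrow>\<^sub>M action_space M"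
  shows "(\<lambda>z. (f z, g z)) \<in> N \<rightarrow>\<^sub>M step_space M"
  using assms unfolding step_space_def state_space_def action_space_def measurable_restrict_space2_iff
  by (auto intro: borel_measurable_Pair)

lemma transition_ext_measurable:
  "transition_ext M \<in> step_space M \<rightarrow>\<^sub>M prob_algebra (state_space M)"
proof -
  have *: "{p \<in> space (step_space M). p \<in> Gr M} = Gr M"
    using Gr_subset by auto
  have "(\<lambda>p. if p \<in> Gr M then transition M p else return (state_space M) (fst p))
      \<in> step_space M \<rightarrow>\<^sub>M prob_algebra (state_space M)"
  proof (subst measurable_If_restrict_space_iff)
    show "{p \<in> space (step_space M). p \<in> Gr M} \<in> sets (step_space M)"
      unfolding * by (rule Gr_step)
    have "(\<lambda>p. return (state_space M) (fst p)) \<in> step_space M \<rightarrow>\<^sub>M prob_algebra (state_space M)"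
      by (rule measurable_compose[OF measurable_fst_step measurable_return_prob_space])
    then show "transition M \<in> restrict_space (step_space M) {p. p \<in> Gr M} \<rightarrow>\<^sub>M prob_algebra (state_space M) \<and>
      (\<lambda>p. return (state_space M) (fst p)) \<in> restrict_space (step_space M) {p. p \<notin> Gr M} \<rightarrow>\<^sub>M prob_algebra (state_space M)"
      using transition_measurable by (simp add: restrict_step_Gr measurable_restrict_space1)
  qed
  then show ?thesis by (simp add: transition_ext_def[abs_def])
qed

lemma transition_prob:
  assumes "p \<in> Gr M"
  shows "prob_space (transition M p)" "sets (transition M p) = sets (state_space M)"
  using measurable_space[OF transition_measurable] assms by (auto simp: space_restrict_space space_prob_algebra)

lemma space_transition: "p \<in> Gr M \<Longrightarrow> space (transition M p) = states M"
  using transition_prob(2)[THEN sets_eq_imp_space_eq] by simp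

end

locale controlled_process = markov_decision_process M
  for M :: "('x::polish_space, 'a::polish_space, 'z) mdp_scheme" +
  fixes x :: 'x and \<pi> :: "nat \<Rightarrow> (nat \<Rightarrow> 'x \<times> 'a) \<times> 'x \<Rightarrow> 'a measure"
  assumes init: "x \<in> states M" and policy: "\<pi> \<in> policies M"
begin

lemma policy_measurable: "\<pi> t \<in> history_space M t \<rightarrow>\<^sub>M prob_algebra (action_space M)"
  and policy_feasible: "h \<in> space (history_space M t) \<Longrightarrow> emeasure (\<pi> t h) (feasible M (snd h)) = 1"
  using policy by (auto simp: policies_def)

text \<open>
  The kernel of the Ionescu Tulcea construction draws the next state and then the action. The
  two stages are separated here.
\<close>

definition state_kernel :: "nat \<Rightarrow> (nat \<Rightarrow> 'x \<times> 'a) \<Rightarrow> 'x measure" where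
  "state_kernel t \<omega> = (if t = 0 then return (state_space M) x else transition_ext M (\<omega> (t - 1)))"

lemma state_kernel_measurable:
  "state_kernel t \<in> PiM {0..<t} (\<lambda>_. step_space M) \<rightarrow>\<^sub>M prob_algebra (state_space M)"
proof (cases t)
  case 0
  have "return (state_space M) x \<in> space (prob_algebra (state_space M))"
    using init by (simp add: space_prob_algebra prob_space_return)
  then show ?thesis unfolding state_kernel_def[abs_def] 0 by simp
next
  case (Suc n)
  have "(\<lambda>\<omega>. \<omega> n) \<in> PiM {0..<t} (\<lambda>_. step_space M) \<rightarrow>\<^sub>M step_space M"
    by (rule measurable_component_singleton) (simp add: Suc)
  from measurable_compose[OF this transition_ext_measurable] show ?thesis
    unfolding state_kernel_def[abs_def] Suc by simp
qed

definition action_kernel :: "nat \<Rightarrow> (nat \<Rightarrow> 'x \<times> 'a) \<Rightarrow> 'x \<Rightarrow> ('x \<times> 'a) measure" where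
  "action_kernel t \<omega> y = \<pi> t (\<omega>, y) \<bind> (\<lambda>a. return (step_space M) (y, a))"

lemma step_kernel_eq: "step_kernel M x \<pi> t \<omega> = state_kernel t \<omega> \<bind> action_kernel t \<omega>"
  by (simp add: step_kernel_def state_kernel_def action_kernel_def[abs_def])

lemma action_kernel_measurable:
  "(\<lambda>(\<omega>, y). action_kernel t \<omega> y) \<in>
     PiM {0..<t} (\<lambda>_. step_space M) \<Otimes>\<^sub>M state_space M \<rightarrow>\<^sub>M prob_algebra (step_space M)"
proof -
  have "(\<lambda>h. \<pi> t h \<bind> (\<lambda>a. return (step_space M) (snd h, a)))
    \<in> history_space M t \<rightarrow>\<^sub>M prob_algebra (step_space M)"
  proof (rule measurable_bind_prob_space2[OF policy_measurable])
    have "(\<lambda>p. (snd (fst p), snd p)) \<in> history_space M t \<Otimes>\<^sub>M action_space M \<rightarrow>\<^sub>M step_space M"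
      unfolding history_space_def by (intro measurable_pair_step) measurable
    from measurable_compose[OF this measurable_return_prob_space]
    show "(\<lambda>(h, a). return (step_space M) (snd h, a))
      \<in> history_space M t \<Otimes>\<^sub>M action_space M \<rightarrow>\<^sub>M prob_algebra (step_space M)"
      by (simp add: case_prod_beta')
  qed
  then show ?thesis by (simp add: history_space_def action_kernel_def case_prod_beta')
qed

lemma step_kernel_measurable:
  "step_kernel M x \<pi> t \<in> PiM {0..<t} (\<lambda>_. step_space M) \<rightarrow>\<^sub>M prob_algebra (step_space M)"
  unfolding step_kernel_eq[abs_def]
  by (rule measurable_bind_prob_space2[OF state_kernel_measurable action_kernel_measurable])

lemma Ionescu_Tulcea_step_kernel: "Ionescu_Tulcea (step_kernel M x \<pi>) (\<lambda>_. step_space M)"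
  unfolding Ionescu_Tulcea_def
proof (intro conjI allI impI)
  fix i
  show "step_kernel M x \<pi> i \<in> PiM {0..<i} (\<lambda>_. step_space M) \<rightarrow>\<^sub>M subprob_algebra (step_space M)"
    by (rule measurable_prob_algebraD[OF step_kernel_measurable])
  fix \<omega> assume "\<omega> \<in> space (PiM {0..<i} (\<lambda>_. step_space M))"
  then show "prob_space (step_kernel M x \<pi> i \<omega>)"
    using measurable_space[OF step_kernel_measurable] by (force simp: space_prob_algebra)
qed

sublocale IT: Ionescu_Tulcea "step_kernel M x \<pi>" "\<lambda>_. step_space M"
  by (rule Ionescu_Tulcea_step_kernel)

abbreviation law :: "(nat \<Rightarrow> 'x \<times> 'a) measure" where
  "law \<equiv> trajectory_law M x \<pi>"

lemma law_eq: "law = IT.PF.lim"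
  by (simp add: trajectory_law_def)

lemma sets_law [measurable_cong]: "sets law = sets (PiM UNIV (\<lambda>_. step_space M))"
  by (simp add: law_eq)

lemma space_law: "space law = space (PiM UNIV (\<lambda>_. step_space M))"
  by (simp add: law_eq)

lemma space_law_step: "\<omega> \<in> space law \<Longrightarrow> \<omega> t \<in> states M \<times> actions M"
  by (auto simp: space_law space_PiM PiE_iff)

lemma coordinate_measurable: "(\<lambda>\<omega>. \<omega> t) \<in> law \<rightarrow>\<^sub>M step_space M"
  using measurable_component_singleton[of t UNIV "\<lambda>_. step_space M"]
  by (simp add: measurable_cong_sets[OF sets_law refl])

lemma prefix_measurable: "(\<lambda>\<omega>. restrict \<omega> {0..<n}) \<in> law \<rightarrow>\<^sub>M PiM {0..<n} (\<lambda>_. step_space M)"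
  using measurable_restrict_subset[of "{0..<n}" UNIV "\<lambda>_. step_space M"]
  by (simp add: measurable_cong_sets[OF sets_law refl])

lemma nn_integral_prefix:
  assumes H: "H \<in> borel_measurable (PiM {0..<n} (\<lambda>_. step_space M))"
  shows "(\<integral>\<^sup>+\<omega>. H (restrict \<omega> {0..<n}) \<partial>law) = (\<integral>\<^sup>+\<omega>. H \<omega> \<partial>IT.C 0 n (\<lambda>_. undefined))"
proof -
  let ?P = "PiM {0..<n} (\<lambda>_. step_space M)"
  have sC: "sets (IT.C 0 n (\<lambda>_. undefined)) = sets ?P"
    by (subst IT.sets_C) simp_all
  have "IT.CI {0..<n} = IT.C 0 n (\<lambda>_. undefined)"
  proof (rule measure_eqI)
    show "sets (IT.CI {0..<n}) = sets (IT.C 0 n (\<lambda>_. undefined))"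
      by (simp add: IT.CI_def sC)
    fix X assume "X \<in> sets (IT.CI {0..<n})"
    then have X: "X \<in> sets ?P" by (simp add: IT.CI_def)
    show "emeasure (IT.CI {0..<n}) X = emeasure (IT.C 0 n (\<lambda>_. undefined)) X"
      using X sets.sets_into_space[OF X] by (subst IT.emeasure_CI[of _ n]) (auto simp: prod_emb_id space_PiM)
  qed
  then have "(\<integral>\<^sup>+\<omega>. H \<omega> \<partial>IT.C 0 n (\<lambda>_. undefined)) = (\<integral>\<^sup>+\<omega>. H \<omega> \<partial>distr law ?P (\<lambda>\<omega>. restrict \<omega> {0..<n}))"
    by (simp add: IT.distr_lim law_eq)
  also have "\<dots> = (\<integral>\<^sup>+\<omega>. H (restrict \<omega> {0..<n}) \<partial>law)"
    by (rule nn_integral_distr[OF prefix_measurable]) (simp add: H)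
  finally show ?thesis ..
qed

lemma emeasure_law: "emeasure law (space law) = 1"
  using nn_integral_prefix[of "\<lambda>_. 1" 0]
    prob_space.emeasure_space_1[OF IT.prob_space_C[of "\<lambda>_. undefined" 0 0]]
  by (simp del: IT.C.simps)

text \<open>
  The prefix of length \<open>Suc t\<close> arises from the prefix of length \<open>t\<close> by one application of the
  kernel, and the law of a prefix is a finite iterate of kernels.
\<close>

lemma nn_integral_coordinate_kernel:
  assumes F: "F \<in> borel_measurable (step_space M)"
  shows "(\<integral>\<^sup>+\<omega>. F (\<omega> t) \<partial>law) = (\<integral>\<^sup>+\<omega>. (\<integral>\<^sup>+z. F z \<partial>step_kernel M x \<pi> t (restrict \<omega> {0..<t})) \<partial>law)"
proof -
  let ?u = "\<lambda>_::nat. undefined :: 'x \<times> 'a"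
  let ?P = "\<lambda>n. PiM {0..<n} (\<lambda>_. step_space M)"
  have Ft: "(\<lambda>\<omega>. F (\<omega> t)) \<in> borel_measurable (?P (Suc t))"
    by (rule measurable_compose[OF measurable_component_singleton[of t "{0..<Suc t}" "\<lambda>_. step_space M"] F]) simp
  have K: "(\<lambda>\<omega>. \<integral>\<^sup>+z. F z \<partial>step_kernel M x \<pi> t \<omega>) \<in> borel_measurable (?P t)"
    by (rule measurable_compose[OF IT.P nn_integral_measurable_subprob_algebra[OF F]])
  have sC: "sets (IT.C 0 t ?u) = sets (?P t)"
    by (subst IT.sets_C) simp_all
  have "(\<integral>\<^sup>+\<omega>. F (\<omega> t) \<partial>law) = (\<integral>\<^sup>+\<omega>. F (\<omega> t) \<partial>IT.C 0 (Suc t) ?u)"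
    using nn_integral_prefix[OF Ft] by simp
  also have "\<dots> = (\<integral>\<^sup>+\<omega>. \<integral>\<^sup>+\<omega>'. F (\<omega>' t) \<partial>IT.eP t \<omega> \<partial>IT.C 0 t ?u)"
    using Ft IT.measurable_eP[of t]
    by (simp, subst nn_integral_bind[where B="?P (Suc t)"]) (auto simp: measurable_cong_sets[OF sC refl])
  also have "\<dots> = (\<integral>\<^sup>+\<omega>. \<integral>\<^sup>+z. F z \<partial>step_kernel M x \<pi> t \<omega> \<partial>IT.C 0 t ?u)"
    using Ft by (intro nn_integral_cong) (auto simp: sets_eq_imp_space_eq[OF sC] IT.nn_integral_eP)
  also have "\<dots> = (\<integral>\<^sup>+\<omega>. (\<integral>\<^sup>+z. F z \<partial>step_kernel M x \<pi> t (restrict \<omega> {0..<t})) \<partial>law)"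
    by (rule nn_integral_prefix[OF K, symmetric])
  finally show ?thesis .
qed

lemma nn_integral_step_kernel:
  assumes F: "F \<in> borel_measurable (step_space M)" and \<omega>: "\<omega> \<in> space (PiM {0..<t} (\<lambda>_. step_space M))"
  shows "(\<integral>\<^sup>+z. F z \<partial>step_kernel M x \<pi> t \<omega>) = (\<integral>\<^sup>+y. (\<integral>\<^sup>+a. F (y, a) \<partial>\<pi> t (\<omega>, y)) \<partial>state_kernel t \<omega>)"
proof -
  have sK: "sets (state_kernel t \<omega>) = sets (state_space M)"
    using measurable_space[OF state_kernel_measurable \<omega>] by (simp add: space_prob_algebra)
  have "action_kernel t \<omega> \<in> state_space M \<rightarrow>\<^sub>M prob_algebra (step_space M)"
    using measurable_compose[OF measurable_Pair1'[OF \<omega>] action_kernel_measurable] by simp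
  then have aK: "action_kernel t \<omega> \<in> state_kernel t \<omega> \<rightarrow>\<^sub>M subprob_algebra (step_space M)"
    using measurable_prob_algebraD by (simp add: measurable_cong_sets[OF sK refl])
  have "(\<integral>\<^sup>+z. F z \<partial>step_kernel M x \<pi> t \<omega>) = (\<integral>\<^sup>+y. \<integral>\<^sup>+z. F z \<partial>action_kernel t \<omega> y \<partial>state_kernel t \<omega>)"
    unfolding step_kernel_eq by (rule nn_integral_bind[OF F aK])
  also have "\<dots> = (\<integral>\<^sup>+y. (\<integral>\<^sup>+a. F (y, a) \<partial>\<pi> t (\<omega>, y)) \<partial>state_kernel t \<omega>)"
  proof (rule nn_integral_cong)
    fix y assume "y \<in> space (state_kernel t \<omega>)"
    then have y: "y \<in> states M" using sets_eq_imp_space_eq[OF sK] by simp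
    then have h: "(\<omega>, y) \<in> space (history_space M t)"
      using \<omega> by (simp add: history_space_def space_pair_measure)
    then have s\<pi>: "sets (\<pi> t (\<omega>, y)) = sets (action_space M)"
      using measurable_space[OF policy_measurable h] by (simp add: space_prob_algebra)
    have pair: "(\<lambda>a. (y, a)) \<in> \<pi> t (\<omega>, y) \<rightarrow>\<^sub>M step_space M"
      unfolding measurable_cong_sets[OF s\<pi> refl] using y by (intro measurable_pair_step) simp_all
    have "(\<integral>\<^sup>+z. F z \<partial>action_kernel t \<omega> y) = (\<integral>\<^sup>+a. \<integral>\<^sup>+z. F z \<partial>return (step_space M) (y, a) \<partial>\<pi> t (\<omega>, y))"
      unfolding action_kernel_def
      by (rule nn_integral_bind[OF F measurable_compose[OF pair return_measurable]])
    also have "\<dots> = (\<integral>\<^sup>+a. F (y, a) \<partial>\<pi> t (\<omega>, y))"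
      using y F sets_eq_imp_space_eq[OF s\<pi>] by (intro nn_integral_cong nn_integral_return) simp_all
    finally show "(\<integral>\<^sup>+z. F z \<partial>action_kernel t \<omega> y) = (\<integral>\<^sup>+a. F (y, a) \<partial>\<pi> t (\<omega>, y))" .
  qed
  finally show ?thesis .
qed

lemma prefix_in_space: "\<omega> \<in> space law \<Longrightarrow> restrict \<omega> {0..<t} \<in> space (PiM {0..<t} (\<lambda>_. step_space M))"
  using measurable_space[OF prefix_measurable] by blast

lemma state_kernel_restrict: "state_kernel t (restrict \<omega> {0..<t}) = state_kernel t \<omega>"
  by (simp add: state_kernel_def)

lemma space_state_kernel: "\<omega> \<in> space law \<Longrightarrow> space (state_kernel t \<omega>) = states M"
  using measurable_space[OF state_kernel_measurable prefix_in_space[of \<omega> t]] 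
  by (simp add: space_prob_algebra state_kernel_restrict) (metis sets_eq_imp_space_eq space_state)

lemma nn_integral_coordinate:
  assumes F: "F \<in> borel_measurable (step_space M)"
  shows "(\<integral>\<^sup>+\<omega>. F (\<omega> t) \<partial>law) =
    (\<integral>\<^sup>+\<omega>. (\<integral>\<^sup>+y. (\<integral>\<^sup>+a. F (y, a) \<partial>\<pi> t (restrict \<omega> {0..<t}, y)) \<partial>state_kernel t \<omega>) \<partial>law)"
  unfolding nn_integral_coordinate_kernel[OF F]
  by (intro nn_integral_cong) (simp add: nn_integral_step_kernel[OF F prefix_in_space] state_kernel_restrict)

lemma policy_prob: "\<omega> \<in> space law \<Longrightarrow> y \<in> states M \<Longrightarrow> 
   (restrict \<omega> {0..<t}, y) \<in> space (history_space M t) \<and>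
   prob_space (\<pi> t (restrict \<omega> {0..<t}, y)) \<and> 
    sets (\<pi> t (restrict \<omega> {0..<t}, y)) = sets (action_space M)"
  using measurable_space[OF policy_measurable[of t], of "(restrict \<omega> {0..<t}, y)"] prefix_in_space[of \<omega> t]
  by (simp add: space_prob_algebra history_space_def space_pair_measure)

lemma nn_integral_state:
  assumes f: "f \<in> borel_measurable (state_space M)"
  shows "(\<integral>\<^sup>+\<omega>. f (fst (\<omega> t)) \<partial>law) = (\<integral>\<^sup>+\<omega>. (\<integral>\<^sup>+y. f y \<partial>state_kernel t \<omega>) \<partial>law)"
  unfolding nn_integral_coordinate[OF measurable_compose[OF measurable_fst_step f]] fst_conv
  using policy_prob
  by (intro nn_integral_cong) (simp add: space_state_kernel prob_space.emeasure_space_1)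

lemma nn_integral_state_0:
  assumes f: "f \<in> borel_measurable (state_space M)"
  shows "(\<integral>\<^sup>+\<omega>. f (fst (\<omega> 0)) \<partial>law) = f x"
  using f init by (simp add: nn_integral_state[OF f] state_kernel_def nn_integral_return emeasure_law)

lemma AE_law_Gr: "AE \<omega> in law. \<omega> t \<in> Gr M"
proof -
  let ?F = "\<lambda>p. if p \<in> Gr M then 0 else (1::ennreal)"
  have F: "?F \<in> borel_measurable (step_space M)"
    using Gr_step Gr_subset by (intro measurable_If_set) (auto simp: Int_absorb2)
  have "(\<integral>\<^sup>+\<omega>. ?F (\<omega> t) \<partial>law) = (\<integral>\<^sup>+\<omega>. 0 \<partial>law)"
    unfolding nn_integral_coordinate[OF F]
  proof (rule nn_integral_cong)
    fix \<omega> assume \<omega>: "\<omega> \<in> space law"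
    have "(\<integral>\<^sup>+a. ?F (y, a) \<partial>\<pi> t (restrict \<omega> {0..<t}, y)) = 0" if y: "y \<in> states M" for y
    proof -
      let ?p = "\<pi> t (restrict \<omega> {0..<t}, y)"
      interpret p: prob_space ?p using policy_prob[OF \<omega> y] by blast
      have "feasible M y \<in> sets (action_space M)"
        using feasible_borel[OF y] feasible_subset[OF y] actions_borel
        by (simp add: action_space_def sets_restrict_space_iff)
      then have "AE a in ?p. a \<in> feasible M y"
        using policy_feasible[of "(restrict \<omega> {0..<t}, y)" t] policy_prob[OF \<omega> y]
        by (subst p.AE_in_set_eq_1) (simp_all add: measure_def)
      then have "AE a in ?p. ?F (y, a) = 0"
        by eventually_elim (use y in \<open>simp add: graph_of_def\<close>)
      then have "(\<integral>\<^sup>+a. ?F (y, a) \<partial>?p) = (\<integral>\<^sup>+a. 0 \<partial>?p)"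
        by (rule nn_integral_cong_AE)
      then show ?thesis by simp
    qed
    then have "(\<integral>\<^sup>+y. \<integral>\<^sup>+a. ?F (y, a) \<partial>\<pi> t (restrict \<omega> {0..<t}, y) \<partial>state_kernel t \<omega>) = (\<integral>\<^sup>+y. 0 \<partial>state_kernel t \<omega>)"
      by (intro nn_integral_cong) (simp add: space_state_kernel[OF \<omega>])
    then show "(\<integral>\<^sup>+y. \<integral>\<^sup>+a. ?F (y, a) \<partial>\<pi> t (restrict \<omega> {0..<t}, y) \<partial>state_kernel t \<omega>) = 0"
      by simp
  qed
  then have "AE \<omega> in law. ?F (\<omega> t) = 0"
    using measurable_compose[OF coordinate_measurable F, of t] by (simp add: nn_integral_0_iff_AE)
  then show ?thesis by eventually_elim (auto split: if_splits)
qed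

text \<open>
  Given the step at time \<open>t\<close>, the next state has law \<open>transition M (\<omega> t)\<close>. Together with the
  initial state and the almost sure feasibility of the steps, this one-step identity carries the later
  estimates of expected costs.
\<close>

lemma nn_integral_state_Suc:
  assumes f: "f \<in> borel_measurable (state_space M)"
  shows "(\<integral>\<^sup>+\<omega>. f (fst (\<omega> (Suc t))) \<partial>law) = (\<integral>\<^sup>+\<omega>. (\<integral>\<^sup>+y. f y \<partial>transition M (\<omega> t)) \<partial>law)"
proof -
  have "AE \<omega> in law. (\<integral>\<^sup>+y. f y \<partial>state_kernel (Suc t) \<omega>) = (\<integral>\<^sup>+y. f y \<partial>transition M (\<omega> t))"
    using AE_law_Gr[of t] by eventually_elim (simp add: state_kernel_def transition_ext_def)
  then show ?thesis unfolding nn_integral_state[OF f] by (rule nn_integral_cong_AE)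
qed

end

context markov_decision_process
begin

lemma of_stationary_policy:
  assumes "stationary_policy M \<phi>"
  shows "of_stationary M \<phi> \<in> policies M"
  unfolding policies_def
proof (intro CollectI allI conjI ballI)
  have \<phi>: "\<phi> \<in> state_space M \<rightarrow>\<^sub>M action_space M" "\<And>x. x \<in> states M \<Longrightarrow> \<phi> x \<in> feasible M x"
    using assms by (auto simp: stationary_policy_def)
  fix t
  have snd: "snd \<in> history_space M t \<rightarrow>\<^sub>M state_space M"
    by (simp add: history_space_def)
  show "of_stationary M \<phi> t \<in> history_space M t \<rightarrow>\<^sub>M prob_algebra (action_space M)"
    unfolding of_stationary_def[abs_def]
    by (rule measurable_compose[OF measurable_compose[OF snd \<phi>(1)] measurable_return_prob_space])
  fix h assume "h \<in> space (history_space M t)"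
  then have y: "snd h \<in> states M" using measurable_space[OF snd] by simp
  then have "feasible M (snd h) \<in> sets (action_space M)"
    using feasible_borel feasible_subset actions_borel by (simp add: action_space_def sets_restrict_space_iff)
  then show "emeasure (of_stationary M \<phi> t h) (feasible M (snd h)) = 1"
    using \<phi>(2)[OF y] by (simp add: of_stationary_def)
qed

text \<open>
  Under a stationary policy the action kernel is a point mass, so an integrand evaluated at the
  step and its substitution along the policy have the same conditional expectation.
\<close>

lemma nn_integral_stationary:
  assumes \<phi>: "stationary_policy M \<phi>" and x: "x \<in> states M" and F: "F \<in> borel_measurable (step_space M)"
  shows "(\<integral>\<^sup>+\<omega>. F (\<omega> t) \<partial>trajectory_law M x (of_stationary M \<phi>)) =
    (\<integral>\<^sup>+\<omega>. F (fst (\<omega> t), \<phi> (fst (\<omega> t))) \<partial>trajectory_law M x (of_stationary M \<phi>))"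
proof -
  interpret controlled_process M x "of_stationary M \<phi>"
    by unfold_locales (use x of_stationary_policy[OF \<phi>] in auto)
  have m: "\<phi> \<in> state_space M \<rightarrow>\<^sub>M action_space M" using \<phi> by (auto simp: stationary_policy_def)
  have G: "(\<lambda>y. F (y, \<phi> y)) \<in> borel_measurable (state_space M)"
    by (rule measurable_compose[OF measurable_pair_step[OF measurable_ident_sets[OF refl] m] F])
  have "(\<integral>\<^sup>+a. F (y, a) \<partial>return (action_space M) (\<phi> y)) = F (y, \<phi> y)" if y: "y \<in> states M" for y
  proof (rule nn_integral_return)
    show "\<phi> y \<in> space (action_space M)" using measurable_space[OF m] y by simp
    show "(\<lambda>a. F (y, a)) \<in> borel_measurable (action_space M)"
      using y by (intro measurable_compose[OF measurable_pair_step F]) simp_all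
  qed
  then show ?thesis
    unfolding nn_integral_coordinate[OF F] nn_integral_state[OF G]
    by (intro nn_integral_cong) (simp add: of_stationary_def space_state_kernel)
qed

end

section \<open>The Bellman operator\<close>

context markov_decision_process
begin

definition bellman :: "real \<Rightarrow> ('x \<Rightarrow> ennreal) \<Rightarrow> 'x \<Rightarrow> ennreal" where
  "bellman \<alpha> f x = (INF a\<in>feasible M x. eta M \<alpha> f (x, a))"

lemma Gr_section: "{a. (x, a) \<in> Gr M} = (if x \<in> states M then feasible M x else {})"
  by (auto simp: graph_of_def)

lemma measurable_transition:
  assumes "f \<in> borel_measurable (state_space M)" "p \<in> Gr M"
  shows "f \<in> borel_measurable (transition M p)"
  using assms(1) by (simp add: measurable_cong_sets[OF transition_prob(2)[OF assms(2)] refl])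

lemma eta_measurable:
  assumes f: "f \<in> borel_measurable (state_space M)"
  shows "eta M \<alpha> f \<in> borel_measurable (borel_on (Gr M))"
proof -
  have "(\<lambda>p. \<integral>\<^sup>+z. f z \<partial>transition M p) \<in> borel_measurable (borel_on (Gr M))"
    by (rule measurable_compose[OF measurable_prob_algebraD[OF transition_measurable]
          nn_integral_measurable_subprob_algebra[OF f]])
  then show ?thesis
    unfolding eta_def[abs_def] using cost_measurable by measurable
qed

lemma eta_mono:
  assumes "p \<in> Gr M" "\<And>y. y \<in> states M \<Longrightarrow> f y \<le> g y" "\<alpha> \<le> \<beta>"
  shows "eta M \<alpha> f p \<le> eta M \<beta> g p"
  unfolding eta_def using assms
  by (intro add_left_mono mult_mono nn_integral_mono ennreal_leI) (auto simp: space_transition)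

lemma eta_cong:
  assumes "p \<in> Gr M" "\<And>y. y \<in> states M \<Longrightarrow> f y = g y"
  shows "eta M \<alpha> f p = eta M \<alpha> g p"
  using assms by (intro antisym eta_mono) auto

lemma bellman_mono:
  assumes "x \<in> states M" "\<And>y. y \<in> states M \<Longrightarrow> f y \<le> g y" "\<alpha> \<le> \<beta>"
  shows "bellman \<alpha> f x \<le> bellman \<beta> g x"
  unfolding bellman_def
proof (rule INF_mono)
  fix a assume "a \<in> feasible M x"
  then have "eta M \<alpha> f (x, a) \<le> eta M \<beta> g (x, a)"
    using assms by (intro eta_mono) (auto simp: graph_of_def)
  then show "\<exists>b\<in>feasible M x. eta M \<alpha> f (x, b) \<le> eta M \<beta> g (x, a)"
    using \<open>a \<in> feasible M x\<close> by blast
qed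

lemma bellman_le_eta: "(x, a) \<in> Gr M \<Longrightarrow> bellman \<alpha> f x \<le> eta M \<alpha> f (x, a)"
  unfolding bellman_def by (intro INF_lower) (simp add: graph_of_def)

lemma mult_SUP_ennreal:
  fixes a b :: "nat \<Rightarrow> ennreal"
  assumes "incseq a" "incseq b"
  shows "(SUP n. a n) * (SUP n. b n) = (SUP n. a n * b n)"
proof (rule antisym)
  have "(SUP n. a n) * (SUP n. b n) = (SUP m. a m * (SUP n. b n))"
    by (rule SUP_mult_right_ennreal)
  also have "\<dots> = (SUP m. SUP n. a m * b n)"
    by (simp only: SUP_mult_left_ennreal)
  also have "\<dots> \<le> (SUP n. a n * b n)"
  proof (intro SUP_least)
    fix m n
    have "a m * b n \<le> a (max m n) * b (max m n)"
      using assms by (intro mult_mono) (auto simp: incseq_def)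
    also have "\<dots> \<le> (SUP n. a n * b n)" by (rule SUP_upper) simp
    finally show "a m * b n \<le> (SUP n. a n * b n)" .
  qed
  finally show "(SUP n. a n) * (SUP n. b n) \<le> (SUP n. a n * b n)" .
  show "(SUP n. a n * b n) \<le> (SUP n. a n) * (SUP n. b n)"
    by (intro SUP_least mult_mono SUP_upper) auto
qed

lemma eta_SUP:
  assumes p: "p \<in> Gr M" and f: "\<And>n. f n \<in> borel_measurable (state_space M)"
    and inc: "\<And>y. y \<in> states M \<Longrightarrow> incseq (\<lambda>n. f n y)"
    and \<alpha>: "incseq \<alpha>" "ennreal \<beta> = (SUP n. ennreal (\<alpha> n))"
  shows "eta M \<beta> (\<lambda>y. SUP n. f n y) p = (SUP n. eta M (\<alpha> n) (f n) p)"
proof -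
  let ?q = "transition M p"
  have "(\<integral>\<^sup>+y. (SUP n. f n y) \<partial>?q) = (SUP n. \<integral>\<^sup>+y. f n y \<partial>?q)"
    using inc p
    by (intro nn_integral_monotone_convergence_SUP_AE measurable_transition f AE_I2)
       (auto simp: space_transition incseq_Suc_iff)
  moreover have "incseq (\<lambda>n. \<integral>\<^sup>+y. f n y \<partial>?q)"
    using inc p by (auto simp: incseq_def space_transition intro!: nn_integral_mono)
  moreover have "incseq (\<lambda>n. ennreal (\<alpha> n))" using \<alpha>(1) by (auto simp: incseq_def intro: ennreal_leI)
  ultimately have "ennreal \<beta> * (\<integral>\<^sup>+y. (SUP n. f n y) \<partial>?q) = (SUP n. ennreal (\<alpha> n) * (\<integral>\<^sup>+y. f n y \<partial>?q))"
    using \<alpha>(2) by (simp add: mult_SUP_ennreal)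
  then show ?thesis by (simp add: eta_def ennreal_SUP_add_right)
qed

end

locale setwise_mdp = markov_decision_process M
  for M :: "('x::polish_space, 'a::polish_space, 'z) mdp_scheme" +
  assumes S_star: "assumption_S_star M"
begin

text \<open>
  The integral of \<open>f\<close> is the supremum of the integrals of the truncations of \<open>f\<close> at \<open>n\<close>. These are
  bounded, so by setwise continuity their integrals are continuous in the action.
\<close>

lemma eta_compact_sublevels:
  assumes x: "x \<in> states M" and f: "f \<in> borel_measurable (state_space M)" and \<alpha>: "0 \<le> \<alpha>"
  shows "compact_sublevels (feasible M x) (\<lambda>a. eta M \<alpha> f (x, a))"
proof -
  define fn where "fn n z = enn2real (min (f z) (of_nat n))" for n :: nat and z
  define g where "g n a = \<alpha> * (\<integral>z. fn n z \<partial>transition M (x, a))" for n a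
  have fin: "min (f z) (of_nat n) < top" for z n
    by (rule min.strict_coboundedI2) (simp add: ennreal_of_nat_eq_real_of_nat)
  have fn: "ennreal (fn n z) = min (f z) (of_nat n)" for n z
    using fin by (simp add: fn_def)
  have fn_bound: "0 \<le> fn n z" "fn n z \<le> real n" for n z
  proof -
    have "enn2real (min (f z) (of_nat n)) \<le> enn2real (of_nat n)"
      by (rule enn2real_mono) (simp_all add: ennreal_of_nat_eq_real_of_nat)
    then show "fn n z \<le> real n" by (simp add: fn_def)
  qed (simp add: fn_def)
  have fn_meas: "fn n \<in> borel_measurable (state_space M)" for n
    unfolding fn_def[abs_def] using f by measurable
  have "bounded (fn n ` states M)" for n
    unfolding bounded_iff using fn_bound by (intro exI[of _ "real n"]) auto
  then have "continuous_on (feasible M x) (g n)" for n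
    using S_star x fn_meas unfolding assumption_S_star_def g_def[abs_def]
    by (intro continuous_on_mult_left) blast
  then have cs: "compact_sublevels (feasible M x) (\<lambda>a. cost M (x, a) + ennreal (g n a))" for n
    using S_star x
    by (intro compact_sublevels_add_continuous)
       (auto simp: compact_sublevels_iff_inf_compact_on assumption_S_star_def)
  have eq: "eta M \<alpha> f (x, a) = (SUP n. cost M (x, a) + ennreal (g n a))" if a: "a \<in> feasible M x" for a
  proof -
    let ?q = "transition M (x, a)"
    have p: "(x, a) \<in> Gr M" using a x by (simp add: graph_of_def)
    interpret q: prob_space ?q by (rule transition_prob[OF p])
    have m: "fn n \<in> borel_measurable ?q" for n using fn_meas p by (rule measurable_transition)
    have int: "integrable ?q (fn n)" for n
      by (rule q.integrable_const_bound[of _ "real n"]) (use fn_bound m in auto)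
    have g: "ennreal (g n a) = ennreal \<alpha> * (\<integral>\<^sup>+z. ennreal (fn n z) \<partial>?q)" for n
      using int fn_bound \<alpha> by (simp add: g_def ennreal_mult' nn_integral_eq_integral)
    have "f z = (SUP n. ennreal (fn n z))" for z
    proof -
      have "(SUP n. ennreal (fn n z)) = inf (f z) (SUP n. of_nat n)"
        unfolding inf_SUP by (simp add: fn inf_min)
      then show ?thesis by (simp add: ennreal_SUP_of_nat_eq_top)
    qed
    then have "(\<integral>\<^sup>+z. f z \<partial>?q) = (\<integral>\<^sup>+z. (SUP n. ennreal (fn n z)) \<partial>?q)" by simp
    also have "\<dots> = (SUP n. \<integral>\<^sup>+z. ennreal (fn n z) \<partial>?q)"
    proof (rule nn_integral_monotone_convergence_SUP)
      show "incseq (\<lambda>n z. ennreal (fn n z))"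
        unfolding incseq_def le_fun_def fn by (intro allI impI min.mono order_refl of_nat_mono)
      show "(\<lambda>z. ennreal (fn n z)) \<in> borel_measurable ?q" for n
        using m by measurable
    qed
    finally show ?thesis
      by (simp add: eta_def g SUP_mult_left_ennreal ennreal_SUP_add_right)
  qed
  have "{a \<in> feasible M x. eta M \<alpha> f (x, a) \<le> l} =
      {a \<in> feasible M x. (SUP n. cost M (x, a) + ennreal (g n a)) \<le> l}" for l
    using eq by auto
  then show ?thesis using compact_sublevels_SUP[OF cs] by (simp add: compact_sublevels_def)
qed

lemma eta_compact_sublevels_section:
  assumes "f \<in> borel_measurable (state_space M)" "0 \<le> \<alpha>"
  shows "compact_sublevels {a. (x, a) \<in> Gr M} (\<lambda>a. eta M \<alpha> f (x, a))"
  using assms eta_compact_sublevels by (simp add: Gr_section compact_sublevels_def)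

lemma bellman_measurable:
  assumes f: "f \<in> borel_measurable (state_space M)" and \<alpha>: "0 \<le> \<alpha>"
  shows "bellman \<alpha> f \<in> borel_measurable (state_space M)"
proof -
  have "(\<lambda>x. INF a\<in>{a. (x, a) \<in> Gr M}. eta M \<alpha> f (x, a)) \<in> borel_measurable (state_space M)"
    unfolding state_space_def
    by (intro measurable_restrict_space1 borel_measurable_INF_section Gr_borel eta_measurable[OF f]
        eta_compact_sublevels_section[OF f \<alpha>])
  then show ?thesis
    by (rule measurable_cong[THEN iffD1, rotated]) (simp add: bellman_def Gr_section)
qed

lemma bellman_attained:
  assumes "x \<in> states M" "f \<in> borel_measurable (state_space M)" "0 \<le> \<alpha>"
  shows "\<exists>a\<in>feasible M x. eta M \<alpha> f (x, a) = bellman \<alpha> f x"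
  unfolding bellman_def
  by (rule compact_sublevels_INF_attained[OF eta_compact_sublevels[OF assms] feasible_nonempty[OF assms(1)]])

text \<open>
  Where the minimum is finite, \<open>borel_minimizer_exists\<close> applies. Where it is infinite, every feasible action is a minimizer, and an arbitrary stationary policy is used.
\<close>

lemma bellman_selector:
  assumes f: "f \<in> borel_measurable (state_space M)" and \<alpha>: "0 \<le> \<alpha>"
  obtains \<phi> where "stationary_policy M \<phi>" "\<And>x. x \<in> states M \<Longrightarrow> eta M \<alpha> f (x, \<phi> x) = bellman \<alpha> f x"
proof -
  obtain \<phi>0 where \<phi>0: "stationary_policy M \<phi>0" using stationary_exists by blast
  obtain \<phi>1 where \<phi>1: "\<phi>1 \<in> borel_measurable borel"
    "\<And>x. (INF a\<in>{a. (x, a) \<in> Gr M}. eta M \<alpha> f (x, a)) < \<infinity> \<Longrightarrow>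
        (x, \<phi>1 x) \<in> Gr M \<and> eta M \<alpha> f (x, \<phi>1 x) = (INF a\<in>{a. (x, a) \<in> Gr M}. eta M \<alpha> f (x, a))"
    using borel_minimizer_exists[OF Gr_borel eta_measurable[OF f] eta_compact_sublevels_section[OF f \<alpha>]]
    by metis
  have \<phi>1_opt: "\<phi>1 x \<in> feasible M x \<and> eta M \<alpha> f (x, \<phi>1 x) = bellman \<alpha> f x"
    if "x \<in> states M" "bellman \<alpha> f x < \<infinity>" for x
    using \<phi>1(2)[of x] that by (simp add: bellman_def Gr_section) (simp add: graph_of_def)
  define \<phi> where "\<phi> x = (if bellman \<alpha> f x < \<infinity> then \<phi>1 x else \<phi>0 x)" for x
  have feas: "\<phi> x \<in> feasible M x" if "x \<in> states M" for x
    using \<phi>0 \<phi>1_opt that by (auto simp: \<phi>_def stationary_policy_def)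
  have "\<phi>0 \<in> borel_measurable (state_space M)"
    using \<phi>0 by (simp add: stationary_policy_def action_space_def measurable_restrict_space2_iff)
  moreover have "\<phi>1 \<in> borel_measurable (state_space M)"
    using \<phi>1(1) unfolding state_space_def by (rule measurable_restrict_space1)
  ultimately have "\<phi> \<in> borel_measurable (state_space M)"
    using bellman_measurable[OF f \<alpha>] unfolding \<phi>_def[abs_def] by measurable
  then have "stationary_policy M \<phi>"
    using feas feasible_subset unfolding stationary_policy_def action_space_def measurable_restrict_space2_iff
    by auto
  moreover have "eta M \<alpha> f (x, \<phi> x) = bellman \<alpha> f x" if x: "x \<in> states M" for x
  proof (cases "bellman \<alpha> f x < \<infinity>")
    case True
    then show ?thesis using \<phi>1_opt[OF x] by (simp add: \<phi>_def)
  next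
    case False
    have "bellman \<alpha> f x \<le> eta M \<alpha> f (x, \<phi> x)"
      using feas[OF x] x by (intro bellman_le_eta) (simp add: graph_of_def)
    then show ?thesis using False by (simp add: less_top[symmetric] top_unique)
  qed
  ultimately show ?thesis by (rule that)
qed

text \<open>
  By \<open>compact_sublevels_INF_attained_of_SUP\<close>, some action is at least as good in the limit as the optimal
  actions along the sequence. Passing to the limit in both the discount factor and the function is what links value iteration to
  the discounted value, and the discounted problems to the average-cost problem.
\<close>

lemma bellman_SUP:
  assumes x: "x \<in> states M" and f: "\<And>n. f n \<in> borel_measurable (state_space M)"
    and inc: "\<And>y. y \<in> states M \<Longrightarrow> incseq (\<lambda>n. f n y)"
    and \<alpha>: "incseq \<alpha>" "\<And>n. 0 \<le> \<alpha> n" "ennreal \<beta> = (SUP n. ennreal (\<alpha> n))"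
  shows "bellman \<beta> (\<lambda>y. SUP n. f n y) x \<le> (SUP n. bellman (\<alpha> n) (f n) x)"
proof -
  have "\<exists>a\<in>feasible M x. (SUP n. eta M (\<alpha> n) (f n) (x, a)) \<le> (SUP n. INF b\<in>feasible M x. eta M (\<alpha> n) (f n) (x, b))"
  proof (rule compact_sublevels_INF_attained_of_SUP)
    show "compact_sublevels (feasible M x) (\<lambda>a. eta M (\<alpha> n) (f n) (x, a))" for n
      using x f \<alpha>(2) by (rule eta_compact_sublevels)
    show "incseq (\<lambda>n. eta M (\<alpha> n) (f n) (x, a))" if "a \<in> feasible M x" for a
      unfolding incseq_def using that x inc \<alpha>(1)
      by (intro allI impI eta_mono) (auto simp: incseq_def graph_of_def)
  qed (rule feasible_nonempty[OF x])
  then obtain a where a: "a \<in> feasible M x" "(SUP n. eta M (\<alpha> n) (f n) (x, a)) \<le> (SUP n. bellman (\<alpha> n) (f n) x)"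
    unfolding bellman_def by blast
  have p: "(x, a) \<in> Gr M" using a x by (simp add: graph_of_def)
  have "bellman \<beta> (\<lambda>y. SUP n. f n y) x \<le> eta M \<beta> (\<lambda>y. SUP n. f n y) (x, a)"
    by (rule bellman_le_eta[OF p])
  also have "\<dots> = (SUP n. eta M (\<alpha> n) (f n) (x, a))"
    by (rule eta_SUP[OF p f inc \<alpha>(1,3)])
  finally show ?thesis using a(2) by simp
qed

end

section \<open>Expected costs\<close>

context controlled_process
begin

definition expected_cost :: "nat \<Rightarrow> ennreal" where
  "expected_cost t = (\<integral>\<^sup>+\<omega>. cost M (\<omega> t) \<partial>law)"

text \<open>
  Outside the graph of feasible pairs \<open>cost M\<close> is an arbitrary function and need not be measurable. The
  modification is measurable everywhere, and the two agree along almost every trajectory.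
\<close>

definition stage_cost :: "'x \<times> 'a \<Rightarrow> ennreal" where
  "stage_cost p = (if p \<in> Gr M then cost M p else 0)"

lemma stage_cost_measurable: "stage_cost \<in> borel_measurable (step_space M)"
proof -
  have *: "{p \<in> space (step_space M). p \<in> Gr M} = Gr M" using Gr_subset by auto
  show ?thesis
    unfolding stage_cost_def[abs_def]
  proof (subst measurable_If_restrict_space_iff)
    show "{p \<in> space (step_space M). p \<in> Gr M} \<in> sets (step_space M)"
      unfolding * by (rule Gr_step)
  qed (simp add: restrict_step_Gr cost_measurable)
qed

lemma AE_cost: "AE \<omega> in law. \<forall>t. cost M (\<omega> t) = stage_cost (\<omega> t)"
  unfolding AE_all_countable
proof
  fix t show "AE \<omega> in law. cost M (\<omega> t) = stage_cost (\<omega> t)"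
    using AE_law_Gr[of t] by eventually_elim (simp add: stage_cost_def)
qed

lemma stage_cost_coordinate: "(\<lambda>\<omega>. stage_cost (\<omega> t)) \<in> borel_measurable law"
  by (rule measurable_compose[OF coordinate_measurable stage_cost_measurable])

lemma expected_cost_eq: "expected_cost t = (\<integral>\<^sup>+\<omega>. stage_cost (\<omega> t) \<partial>law)"
  unfolding expected_cost_def by (intro nn_integral_cong_AE eventually_mono[OF AE_cost]) simp

lemma finite_cost_eq: "finite_cost M T \<alpha> \<pi> x = (\<Sum>t<T. ennreal (\<alpha> ^ t) * expected_cost t)"
proof -
  have "finite_cost M T \<alpha> \<pi> x = (\<integral>\<^sup>+\<omega>. (\<Sum>t<T. ennreal (\<alpha> ^ t) * stage_cost (\<omega> t)) \<partial>law)"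
    unfolding finite_cost_def by (intro nn_integral_cong_AE eventually_mono[OF AE_cost]) simp
  also have "\<dots> = (\<Sum>t<T. ennreal (\<alpha> ^ t) * expected_cost t)"
    using stage_cost_coordinate by (simp add: nn_integral_sum nn_integral_cmult expected_cost_eq)
  finally show ?thesis .
qed

lemma discounted_cost_eq: "discounted_cost M \<alpha> \<pi> x = (\<Sum>t. ennreal (\<alpha> ^ t) * expected_cost t)"
proof -
  have "discounted_cost M \<alpha> \<pi> x = (\<integral>\<^sup>+\<omega>. (\<Sum>t. ennreal (\<alpha> ^ t) * stage_cost (\<omega> t)) \<partial>law)"
    unfolding discounted_cost_def by (intro nn_integral_cong_AE eventually_mono[OF AE_cost]) simp
  also have "\<dots> = (\<Sum>t. ennreal (\<alpha> ^ t) * expected_cost t)"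
    using stage_cost_coordinate by (simp add: nn_integral_suminf nn_integral_cmult expected_cost_eq)
  finally show ?thesis .
qed

definition expected_state :: "('x \<Rightarrow> ennreal) \<Rightarrow> nat \<Rightarrow> ennreal" where
  "expected_state f t = (\<integral>\<^sup>+\<omega>. f (fst (\<omega> t)) \<partial>law)"

text \<open>
  Likewise \<open>eta M\<close> with cost and transition kernel extended measurably to infeasible pairs.
\<close>

definition eta_ext :: "real \<Rightarrow> ('x \<Rightarrow> ennreal) \<Rightarrow> 'x \<times> 'a \<Rightarrow> ennreal" where
  "eta_ext \<alpha> f p = stage_cost p + ennreal \<alpha> * (\<integral>\<^sup>+z. f z \<partial>transition_ext M p)"

lemma eta_ext_Gr: "p \<in> Gr M \<Longrightarrow> eta_ext \<alpha> f p = eta M \<alpha> f p"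
  by (simp add: eta_ext_def eta_def stage_cost_def transition_ext_def)

lemma transition_ext_integral_measurable:
  assumes "f \<in> borel_measurable (state_space M)"
  shows "(\<lambda>p. \<integral>\<^sup>+z. f z \<partial>transition_ext M p) \<in> borel_measurable (step_space M)"
  by (rule measurable_compose[OF measurable_prob_algebraD[OF transition_ext_measurable]
      nn_integral_measurable_subprob_algebra[OF assms]])

lemma eta_ext_measurable:
  assumes "f \<in> borel_measurable (state_space M)"
  shows "eta_ext \<alpha> f \<in> borel_measurable (step_space M)"
  unfolding eta_ext_def[abs_def]
  using transition_ext_integral_measurable[OF assms] stage_cost_measurable by measurable

lemma expected_eta_ext:
  assumes f: "f \<in> borel_measurable (state_space M)"
  shows "(\<integral>\<^sup>+\<omega>. eta_ext \<alpha> f (\<omega> t) \<partial>law) = expected_cost t + ennreal \<alpha> * expected_state f (Suc t)"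
proof -
  have m: "(\<lambda>\<omega>. \<integral>\<^sup>+z. f z \<partial>transition_ext M (\<omega> t)) \<in> borel_measurable law"
    by (rule measurable_compose[OF coordinate_measurable transition_ext_integral_measurable[OF f]])
  have "expected_state f (Suc t) = (\<integral>\<^sup>+\<omega>. (\<integral>\<^sup>+z. f z \<partial>transition_ext M (\<omega> t)) \<partial>law)"
    unfolding expected_state_def nn_integral_state_Suc[OF f]
    by (intro nn_integral_cong_AE eventually_mono[OF AE_law_Gr[of t]]) (simp add: transition_ext_def)
  then show ?thesis
    using m stage_cost_coordinate
    by (simp add: eta_ext_def nn_integral_add nn_integral_cmult expected_cost_eq)
qed

lemma expected_state_0:
  "f \<in> borel_measurable (state_space M) \<Longrightarrow> expected_state f 0 = f x"
  by (simp add: expected_state_def nn_integral_state_0)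

lemma expected_state_le:
  assumes f: "f \<in> borel_measurable (state_space M)"
    and le: "\<And>p. p \<in> Gr M \<Longrightarrow> g (fst p) \<le> eta M \<alpha> f p"
  shows "expected_state g t \<le> expected_cost t + ennreal \<alpha> * expected_state f (Suc t)"
proof -
  have "expected_state g t \<le> (\<integral>\<^sup>+\<omega>. eta_ext \<alpha> f (\<omega> t) \<partial>law)"
    unfolding expected_state_def
    by (intro nn_integral_mono_AE eventually_mono[OF AE_law_Gr[of t]]) (simp add: eta_ext_Gr le)
  then show ?thesis by (simp add: expected_eta_ext[OF f])
qed

end

context markov_decision_process
begin

text \<open>
  Taking expectations of the hypothesis at time \<open>t\<close> yields
  \<open>E c\<^sub>t + \<alpha> E g(x\<^sub>t\<^sub>+\<^sub>1) \<le> w + E g(x\<^sub>t)\<close>. Multiplied by \<open>\<alpha>\<^sup>t\<close> and summed, the terms in \<open>g\<close> telescope.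
\<close>

lemma stationary_cost_le:
  assumes \<phi>: "stationary_policy M \<phi>" and x: "x \<in> states M" and \<alpha>: "0 \<le> \<alpha>"
    and g: "g \<in> borel_measurable (state_space M)"
    and le: "\<And>y. y \<in> states M \<Longrightarrow> eta M \<alpha> g (y, \<phi> y) \<le> w + g y"
  shows "finite_cost M T \<alpha> (of_stationary M \<phi>) x \<le> (\<Sum>t<T. ennreal (\<alpha> ^ t) * w) + g x"
proof -
  interpret controlled_process M x "of_stationary M \<phi>"
    by unfold_locales (use x of_stationary_policy[OF \<phi>] in auto)
  have gm: "(\<lambda>\<omega>. g (fst (\<omega> t))) \<in> borel_measurable law" for t
    by (rule measurable_compose[OF coordinate_measurable measurable_compose[OF measurable_fst_step g]])
  have step: "expected_cost t + ennreal \<alpha> * expected_state g (Suc t) \<le> w + expected_state g t" for t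
  proof -
    have "expected_cost t + ennreal \<alpha> * expected_state g (Suc t) =
        (\<integral>\<^sup>+\<omega>. eta_ext \<alpha> g (fst (\<omega> t), \<phi> (fst (\<omega> t))) \<partial>law)"
      unfolding expected_eta_ext[OF g, symmetric]
      by (rule nn_integral_stationary[OF \<phi> x eta_ext_measurable[OF g]])
    also have "\<dots> \<le> (\<integral>\<^sup>+\<omega>. w + g (fst (\<omega> t)) \<partial>law)"
    proof (rule nn_integral_mono)
      fix \<omega> assume "\<omega> \<in> space law"
      then have y: "fst (\<omega> t) \<in> states M" using space_law_step[of \<omega> t] by auto
      then have "(fst (\<omega> t), \<phi> (fst (\<omega> t))) \<in> Gr M"
        using \<phi> by (simp add: stationary_policy_def graph_of_def)
      then show "eta_ext \<alpha> g (fst (\<omega> t), \<phi> (fst (\<omega> t))) \<le> w + g (fst (\<omega> t))"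
        using le[OF y] by (simp add: eta_ext_Gr)
    qed
    also have "\<dots> = w + expected_state g t"
      using gm by (simp add: nn_integral_add expected_state_def emeasure_law)
    finally show ?thesis .
  qed
  have "(\<Sum>t<T. ennreal (\<alpha> ^ t) * expected_cost t) + ennreal (\<alpha> ^ T) * expected_state g T
      \<le> (\<Sum>t<T. ennreal (\<alpha> ^ t) * w) + g x"
  proof (induction T)
    case 0
    then show ?case by (simp add: expected_state_0[OF g])
  next
    case (Suc T)
    have "ennreal (\<alpha> ^ T) * expected_cost T + ennreal (\<alpha> ^ Suc T) * expected_state g (Suc T) =
        ennreal (\<alpha> ^ T) * (expected_cost T + ennreal \<alpha> * expected_state g (Suc T))"
      using \<alpha> by (simp add: distrib_left ennreal_mult mult_ac)
    also have "\<dots> \<le> ennreal (\<alpha> ^ T) * (w + expected_state g T)"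
      by (intro mult_left_mono step) simp
    also have "\<dots> = ennreal (\<alpha> ^ T) * w + ennreal (\<alpha> ^ T) * expected_state g T"
      by (simp add: distrib_left)
    finally have "(\<Sum>t<Suc T. ennreal (\<alpha> ^ t) * expected_cost t) + ennreal (\<alpha> ^ Suc T) * expected_state g (Suc T) \<le>
       ennreal (\<alpha> ^ T) * w + ((\<Sum>t<T. ennreal (\<alpha> ^ t) * expected_cost t) + ennreal (\<alpha> ^ T) * expected_state g T)"
      by (simp add: add_ac add_left_mono)
    also have "\<dots> \<le> ennreal (\<alpha> ^ T) * w + ((\<Sum>t<T. ennreal (\<alpha> ^ t) * w) + g x)"
      by (intro add_left_mono Suc)
    finally show ?case by (simp add: add_ac)
  qed
  moreover have "finite_cost M T \<alpha> (of_stationary M \<phi>) x \<le>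
      (\<Sum>t<T. ennreal (\<alpha> ^ t) * expected_cost t) + ennreal (\<alpha> ^ T) * expected_state g T"
    by (simp add: finite_cost_eq)
  ultimately show ?thesis by (rule order_trans[rotated])
qed

end

section \<open>Discounted costs\<close>

context setwise_mdp
begin

primrec value_iter :: "real \<Rightarrow> nat \<Rightarrow> 'x \<Rightarrow> ennreal" where
  "value_iter \<alpha> 0 = (\<lambda>_. 0)"
| "value_iter \<alpha> (Suc n) = bellman \<alpha> (value_iter \<alpha> n)"

lemma value_iter_measurable: "0 \<le> \<alpha> \<Longrightarrow> value_iter \<alpha> n \<in> borel_measurable (state_space M)"
  by (induction n) (auto intro: bellman_measurable)

lemma value_iter_incseq: "y \<in> states M \<Longrightarrow> incseq (\<lambda>n. value_iter \<alpha> n y)"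
proof (rule incseq_SucI)
  fix n assume "y \<in> states M"
  then show "value_iter \<alpha> n y \<le> value_iter \<alpha> (Suc n) y"
  proof (induction n arbitrary: y)
    case (Suc n)
    have "bellman \<alpha> (value_iter \<alpha> n) y \<le> bellman \<alpha> (value_iter \<alpha> (Suc n)) y"
      using Suc by (intro bellman_mono) auto
    then show ?case by simp
  qed simp
qed

lemma bellman_value_iter_le: "bellman \<alpha> (value_iter \<alpha> n) y \<le> (SUP n. value_iter \<alpha> n y)"
  using SUP_upper[of "Suc n" UNIV "\<lambda>n. value_iter \<alpha> n y"] by simp

text \<open>
  The \<open>n\<close>-th iterate is a lower bound for the cost of \<open>n\<close> steps from any time on, as it is
  at most the cost of one step plus the discounted previous iterate at the next state.
\<close>

lemma value_iter_le_cost: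
  assumes x: "x \<in> states M" and \<pi>: "\<pi> \<in> policies M" and \<alpha>: "0 \<le> \<alpha>"
  shows "value_iter \<alpha> n x \<le> finite_cost M n \<alpha> \<pi> x"
proof -
  interpret controlled_process M x \<pi> by unfold_locales (use x \<pi> in auto)
  have "expected_state (value_iter \<alpha> n) t \<le> (\<Sum>s<n. ennreal (\<alpha> ^ s) * expected_cost (t + s))" for t
  proof (induction n arbitrary: t)
    case (Suc n)
    have "expected_state (value_iter \<alpha> (Suc n)) t \<le> expected_cost t + ennreal \<alpha> * expected_state (value_iter \<alpha> n) (Suc t)"
      using value_iter_measurable[OF \<alpha>] by (rule expected_state_le) (auto intro: bellman_le_eta)
    also have "\<dots> \<le> expected_cost t + ennreal \<alpha> * (\<Sum>s<n. ennreal (\<alpha> ^ s) * expected_cost (Suc t + s))"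
      by (intro add_left_mono mult_left_mono Suc) simp
    also have "\<dots> = (\<Sum>s<Suc n. ennreal (\<alpha> ^ s) * expected_cost (t + s))"
      using \<alpha> by (subst sum.lessThan_Suc_shift) (simp add: sum_distrib_left ennreal_mult mult_ac)
    finally show ?case .
  qed (simp add: expected_state_def)
  from this[of 0] show ?thesis
    by (simp add: expected_state_0[OF value_iter_measurable[OF \<alpha>]] finite_cost_eq)
qed

lemma finite_cost_le_discounted_cost:
  assumes x: "x \<in> states M" and \<pi>: "\<pi> \<in> policies M"
  shows "finite_cost M n \<alpha> \<pi> x \<le> discounted_cost M \<alpha> \<pi> x"
proof -
  interpret controlled_process M x \<pi> by unfold_locales (use x \<pi> in auto)
  show ?thesis unfolding finite_cost_eq discounted_cost_eq by (rule sum_le_suminf) auto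
qed

text \<open>
  The iterates bound every policy from below. Conversely their supremum \<open>V\<close> satisfies
  \<open>bellman \<alpha> V \<le> V\<close> by \<open>bellman_SUP\<close>, and a policy that minimizes in \<open>bellman \<alpha> V\<close> costs at
  most \<open>V\<close>.
\<close>

theorem discounted_value_eq_SUP:
  assumes x: "x \<in> states M" and \<alpha>: "0 \<le> \<alpha>"
  shows "discounted_value M \<alpha> x = (SUP n. value_iter \<alpha> n x)"
proof (rule antisym)
  show "(SUP n. value_iter \<alpha> n x) \<le> discounted_value M \<alpha> x"
    unfolding discounted_value_def
    using value_iter_le_cost[OF x _ \<alpha>] finite_cost_le_discounted_cost[OF x]
    by (intro SUP_least INF_greatest) (blast intro: order_trans)
  define V where "V y = (SUP n. value_iter \<alpha> n y)" for y
  have V: "V \<in> borel_measurable (state_space M)"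
    unfolding V_def[abs_def] using value_iter_measurable[OF \<alpha>] by measurable
  have V_le: "bellman \<alpha> V y \<le> V y" if y: "y \<in> states M" for y
  proof -
    have "bellman \<alpha> V y \<le> (SUP n. bellman \<alpha> (value_iter \<alpha> n) y)"
      unfolding V_def[abs_def]
      by (rule bellman_SUP[OF y value_iter_measurable[OF \<alpha>] value_iter_incseq]) (use \<alpha> in auto)
    also have "\<dots> \<le> V y" unfolding V_def by (intro SUP_least bellman_value_iter_le)
    finally show ?thesis .
  qed
  obtain \<phi> where \<phi>: "stationary_policy M \<phi>" "\<And>y. y \<in> states M \<Longrightarrow> eta M \<alpha> V (y, \<phi> y) = bellman \<alpha> V y"
    using bellman_selector[OF V \<alpha>] by blast
  interpret controlled_process M x "of_stationary M \<phi>"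
    by unfold_locales (use x of_stationary_policy[OF \<phi>(1)] in auto)
  have "finite_cost M T \<alpha> (of_stationary M \<phi>) x \<le> V x" for T
    using stationary_cost_le[OF \<phi>(1) x \<alpha> V, of 0 T] V_le \<phi>(2) by simp
  then have "discounted_cost M \<alpha> (of_stationary M \<phi>) x \<le> V x"
    unfolding discounted_cost_eq finite_cost_eq by (intro suminf_le_const) auto
  then show "discounted_value M \<alpha> x \<le> (SUP n. value_iter \<alpha> n x)"
    unfolding discounted_value_def V_def[symmetric]
    by (rule INF_lower2[OF of_stationary_policy[OF \<phi>(1)]])
qed

lemma discounted_value_measurable:
  assumes \<alpha>: "0 \<le> \<alpha>"
  shows "discounted_value M \<alpha> \<in> borel_measurable (state_space M)"
proof -
  have "(\<lambda>x. SUP n. value_iter \<alpha> n x) \<in> borel_measurable (state_space M)"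
    by (intro borel_measurable_SUP value_iter_measurable[OF \<alpha>]) simp
  then show ?thesis
    by (rule measurable_cong[THEN iffD1, rotated]) (simp add: discounted_value_eq_SUP[OF _ \<alpha>])
qed

theorem discounted_optimality_inequality:
  assumes x: "x \<in> states M" and \<alpha>: "0 \<le> \<alpha>"
  shows "bellman \<alpha> (discounted_value M \<alpha>) x \<le> discounted_value M \<alpha> x"
proof -
  have "bellman \<alpha> (discounted_value M \<alpha>) x \<le> bellman \<alpha> (\<lambda>y. SUP n. value_iter \<alpha> n y) x"
    using x by (intro bellman_mono) (auto simp: discounted_value_eq_SUP[OF _ \<alpha>])
  also have "\<dots> \<le> (SUP n. bellman \<alpha> (value_iter \<alpha> n) x)"
    by (rule bellman_SUP[OF x value_iter_measurable[OF \<alpha>] value_iter_incseq]) (use \<alpha> in auto)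
  also have "\<dots> \<le> discounted_value M \<alpha> x"
    unfolding discounted_value_eq_SUP[OF x \<alpha>] by (intro SUP_least bellman_value_iter_le)
  finally show ?thesis .
qed

end

section \<open>Abel means and Cesaro means\<close>

text \<open>
  Summation by parts in the form of an induction: passing from \<open>T\<close> to \<open>Suc T\<close> multiplies a nonnegative
  partial sum by one more factor \<open>\<alpha> \<le> 1\<close>.
\<close>

lemma discounted_sum_ge_scaled_sum:
  fixes d :: "nat \<Rightarrow> real"
  assumes S: "\<And>T. (\<Sum>t<T. d t) \<ge> 0" and \<alpha>: "0 \<le> \<alpha>" "\<alpha> \<le> 1"
  shows "(\<Sum>t<T. \<alpha> ^ t * d t) \<ge> \<alpha> ^ T * (\<Sum>t<T. d t)"
proof (induction T)
  case (Suc T)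
  have "\<alpha> ^ Suc T * (\<Sum>t<Suc T. d t) \<le> \<alpha> ^ T * (\<Sum>t<Suc T. d t)"
    using S[of "Suc T"] \<alpha> by (intro mult_right_mono) (auto intro: mult_left_le_one_le)
  also have "\<dots> = \<alpha> ^ T * (\<Sum>t<T. d t) + \<alpha> ^ T * d T" by (simp add: distrib_left)
  finally show ?case using Suc by simp
qed simp

text \<open>
  The partial sums of \<open>a\<close> are dominated by those of the sequence \<open>B + L, L, L, \<dots>\<close>. The preceding lemma,
  applied to the difference, transfers the domination to the discounted sums.
\<close>

lemma discounted_sum_le:
  fixes a :: "nat \<Rightarrow> ennreal"
  assumes S: "\<And>T. (\<Sum>t<T. a t) \<le> ennreal (B + L * real T)"
    and BL: "0 \<le> B" "0 \<le> L" and \<alpha>: "0 \<le> \<alpha>" "\<alpha> < 1"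
  shows "(\<Sum>t. ennreal (\<alpha> ^ t) * a t) \<le> ennreal (B + L / (1 - \<alpha>))"
proof (rule suminf_le_const)
  fix T
  have fin: "a t < \<infinity>" for t
  proof -
    have "a t \<le> (\<Sum>t<Suc t. a t)" by simp
    also note S[of "Suc t"]
    finally show ?thesis by (simp add: le_less_trans[OF _ ennreal_less_top])
  qed
  define r where "r t = enn2real (a t)" for t
  have a: "a t = ennreal (r t)" for t using fin by (simp add: r_def)
  have r0: "r t \<ge> 0" for t by (simp add: r_def)
  define d where "d t = (if t = 0 then B + L else L) - r t" for t
  have b: "(\<Sum>t<T. if t = 0 then B + L else L) = (if T = 0 then 0 else B + L * real T)" for T
    by (induction T) (auto simp: algebra_simps)
  have "(\<Sum>t<T. d t) \<ge> 0" for T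
  proof -
    have "ennreal (\<Sum>t<T. r t) \<le> ennreal (B + L * real T)"
      using S[of T] r0 by (simp add: a sum_ennreal)
    then have "(\<Sum>t<T. r t) \<le> B + L * real T"
      using BL by (subst (asm) ennreal_le_iff) auto
    then show ?thesis unfolding d_def sum_subtractf b by auto
  qed
  then have "0 \<le> (\<Sum>t<T. \<alpha> ^ t * d t)"
    using discounted_sum_ge_scaled_sum[of d \<alpha> T] \<alpha> by (meson less_imp_le mult_nonneg_nonneg order_trans zero_le_power)
  then have "(\<Sum>t<T. \<alpha> ^ t * r t) \<le> (\<Sum>t<T. \<alpha> ^ t * (if t = 0 then B + L else L))"
    by (simp add: d_def right_diff_distrib sum_subtractf)
  also have "\<dots> \<le> B + L * (\<Sum>t<T. \<alpha> ^ t)"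
    by (induction T) (auto simp: BL distrib_left mult_ac)
  also have "(\<Sum>t<T. \<alpha> ^ t) \<le> 1 / (1 - \<alpha>)"
    using \<alpha> by (subst sum_gp_strict) (auto simp: divide_right_mono)
  then have "B + L * (\<Sum>t<T. \<alpha> ^ t) \<le> B + L / (1 - \<alpha>)"
    using mult_left_mono[OF _ BL(2)] by fastforce
  finally have "(\<Sum>t<T. \<alpha> ^ t * r t) \<le> B + L / (1 - \<alpha>)" .
  moreover have "ennreal (\<alpha> ^ t) * a t = ennreal (\<alpha> ^ t * r t)" for t
    using \<alpha> r0 by (simp add: a ennreal_mult)
  then have "(\<Sum>t<T. ennreal (\<alpha> ^ t) * a t) = ennreal (\<Sum>t<T. \<alpha> ^ t * r t)"
    using \<alpha> r0 by simp
  ultimately show "(\<Sum>t<T. ennreal (\<alpha> ^ t) * a t) \<le> ennreal (B + L / (1 - \<alpha>))"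
    by (simp add: ennreal_leI)
qed simp

lemma limsup_average_bound:
  fixes a :: "nat \<Rightarrow> ennreal"
  assumes L: "limsup (\<lambda>T. (\<Sum>t<T. a t) / of_nat T) < ennreal L" "0 \<le> L"
  obtains B where "0 \<le> B" "\<And>T. (\<Sum>t<T. a t) \<le> ennreal (B + L * real T)"
proof -
  obtain N where N: "\<And>T. T \<ge> N \<Longrightarrow> (\<Sum>t<T. a t) / of_nat T < ennreal L"
    using Limsup_lessD[OF L(1)] unfolding eventually_sequentially by blast
  have le: "(\<Sum>t<T. a t) \<le> ennreal (L * real T)" if T: "T \<ge> N" "T > 0" for T
  proof -
    have "(\<Sum>t<T. a t) = (\<Sum>t<T. a t) / of_nat T * of_nat T"
      using T by (simp add: ennreal_divide_times ennreal_of_nat_eq_real_of_nat)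
    also have "\<dots> \<le> ennreal L * of_nat T"
      using N[OF T(1)] by (intro mult_right_mono) auto
    also have "\<dots> = ennreal (L * real T)"
      using L(2) by (simp add: ennreal_mult ennreal_of_nat_eq_real_of_nat)
    finally show ?thesis .
  qed
  define B where "B = L * real (Suc N)"
  have B: "0 \<le> B" using L(2) by (simp add: B_def)
  show ?thesis
  proof (rule that[OF B])
    fix T
    show "(\<Sum>t<T. a t) \<le> ennreal (B + L * real T)"
    proof (cases "T \<ge> N \<and> T > 0")
      case True
      then have "(\<Sum>t<T. a t) \<le> ennreal (L * real T)" by (simp add: le)
      also have "\<dots> \<le> ennreal (B + L * real T)" using B by (intro ennreal_leI) simp
      finally show ?thesis .
    next
      case False
      have "(\<Sum>t<T. a t) \<le> (\<Sum>t<Suc N. a t)"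
        using False by (intro sum_mono2) auto
      also have "\<dots> \<le> ennreal B" unfolding B_def by (rule le) auto
      also have "\<dots> \<le> ennreal (B + L * real T)" using L(2) by (intro ennreal_leI) simp
      finally show ?thesis .
    qed
  qed
qed

theorem limsup_abel_le_limsup_cesaro:
  fixes a :: "nat \<Rightarrow> ennreal"
  shows "Limsup (at_left 1) (\<lambda>\<alpha>. ennreal (1 - \<alpha>) * (\<Sum>t. ennreal (\<alpha> ^ t) * a t))
    \<le> limsup (\<lambda>T. (\<Sum>t<T. a t) / of_nat T)"
proof (rule dense_ge)
  fix l assume l: "limsup (\<lambda>T. (\<Sum>t<T. a t) / of_nat T) < l"
  show "Limsup (at_left 1) (\<lambda>\<alpha>. ennreal (1 - \<alpha>) * (\<Sum>t. ennreal (\<alpha> ^ t) * a t)) \<le> l"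
  proof (cases l)
    case (real L)
    obtain B where B: "0 \<le> B" "\<And>T. (\<Sum>t<T. a t) \<le> ennreal (B + L * real T)"
      using limsup_average_bound[of a L] l real by blast
    have "Limsup (at_left 1) (\<lambda>\<alpha>. ennreal (1 - \<alpha>) * (\<Sum>t. ennreal (\<alpha> ^ t) * a t))
      \<le> Limsup (at_left 1) (\<lambda>\<alpha>. ennreal ((1 - \<alpha>) * B + L))"
    proof (rule Limsup_mono)
      have "eventually (\<lambda>\<alpha>. \<alpha> \<in> {0<..<1}) (at_left (1::real))"
        by (rule eventually_at_leftI[of 0]) auto
      then show "\<forall>\<^sub>F \<alpha> in at_left 1. ennreal (1 - \<alpha>) * (\<Sum>t. ennreal (\<alpha> ^ t) * a t) \<le> ennreal ((1 - \<alpha>) * B + L)"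
      proof eventually_elim
        fix \<alpha> :: real assume \<alpha>: "\<alpha> \<in> {0<..<1}"
        have "ennreal (1 - \<alpha>) * (\<Sum>t. ennreal (\<alpha> ^ t) * a t) \<le> ennreal (1 - \<alpha>) * ennreal (B + L / (1 - \<alpha>))"
          using B real \<alpha> by (intro mult_left_mono discounted_sum_le) auto
        also have "\<dots> = ennreal ((1 - \<alpha>) * (B + L / (1 - \<alpha>)))"
          using B real \<alpha> by (subst ennreal_mult) auto
        also have "(1 - \<alpha>) * (B + L / (1 - \<alpha>)) = (1 - \<alpha>) * B + L"
          using \<alpha> by (simp add: distrib_left)
        finally show "ennreal (1 - \<alpha>) * (\<Sum>t. ennreal (\<alpha> ^ t) * a t) \<le> ennreal ((1 - \<alpha>) * B + L)" .
      qed
    qed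
    also have "\<dots> = ennreal ((1 - 1) * B + L)"
      by (intro lim_imp_Limsup tendsto_intros) auto
    finally show ?thesis using real by simp
  qed simp
qed

lemma discounted_sum_finite:
  fixes a :: "nat \<Rightarrow> ennreal"
  assumes "limsup (\<lambda>T. (\<Sum>t<T. a t) / of_nat T) < \<infinity>" and \<alpha>: "0 \<le> \<alpha>" "\<alpha> < 1"
  shows "(\<Sum>t. ennreal (\<alpha> ^ t) * a t) < \<infinity>"
proof -
  obtain l where l: "limsup (\<lambda>T. (\<Sum>t<T. a t) / of_nat T) < l" "l < \<infinity>"
    using dense[OF assms(1)] by blast
  then obtain L where L: "l = ennreal L" "0 \<le> L" by (cases l) auto
  obtain B where "0 \<le> B" "\<And>T. (\<Sum>t<T. a t) \<le> ennreal (B + L * real T)"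
    using limsup_average_bound[of a L] l L by blast
  then have "(\<Sum>t. ennreal (\<alpha> ^ t) * a t) \<le> ennreal (B + L / (1 - \<alpha>))"
    using \<alpha> L by (intro discounted_sum_le) auto
  then show ?thesis by (simp add: le_less_trans[OF _ ennreal_less_top])
qed

section \<open>Infima over uncountably many discount factors\<close>

lemma Liminf_at_left_1_eq_SUP:
  fixes f :: "real \<Rightarrow> ennreal" and b :: "nat \<Rightarrow> real"
  assumes b: "\<And>n. b n < 1" "b \<longlonglongrightarrow> 1"
  shows "Liminf (at_left 1) f = (SUP n. INF \<alpha>\<in>{b n..<1}. f \<alpha>)"
proof (rule antisym)
  show "Liminf (at_left 1) f \<le> (SUP n. INF \<alpha>\<in>{b n..<1}. f \<alpha>)"
    unfolding Liminf_def
  proof (intro SUP_least)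
    fix P assume "P \<in> {P. eventually P (at_left (1::real))}"
    then obtain c where c: "c < 1" "\<And>\<alpha>. c < \<alpha> \<Longrightarrow> \<alpha> < 1 \<Longrightarrow> P \<alpha>"
      by (auto simp: eventually_at_left_field)
    obtain n where "c < b n"
      using order_tendstoD(1)[OF b(2) c(1)] by (auto simp: eventually_sequentially)
    then have "(INF \<alpha>\<in>Collect P. f \<alpha>) \<le> (INF \<alpha>\<in>{b n..<1}. f \<alpha>)"
      using c by (intro INF_superset_mono) auto
    also have "\<dots> \<le> (SUP n. INF \<alpha>\<in>{b n..<1}. f \<alpha>)" by (rule SUP_upper) simp
    finally show "(INF \<alpha>\<in>Collect P. f \<alpha>) \<le> (SUP n. INF \<alpha>\<in>{b n..<1}. f \<alpha>)" .
  qed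
  show "(SUP n. INF \<alpha>\<in>{b n..<1}. f \<alpha>) \<le> Liminf (at_left 1) f"
  proof (intro SUP_least Liminf_bounded)
    fix n
    have "eventually (\<lambda>\<alpha>. \<alpha> \<in> {b n<..<1}) (at_left 1)"
      by (rule eventually_at_leftI[OF _ b(1)]) auto
    then show "\<forall>\<^sub>F \<alpha> in at_left 1. (INF \<alpha>\<in>{b n..<1}. f \<alpha>) \<le> f \<alpha>"
      by eventually_elim (auto intro: INF_lower)
  qed
qed

lemma ennreal_minus_le_minus_add:
  fixes a b c e :: ennreal
  assumes "c \<le> b + e" "b < \<infinity>" shows "a - b \<le> (a - c) + e"
proof -
  have "a \<le> (a - c) + c"
  proof (cases "c \<le> a")
    case True
    then show ?thesis by (simp add: diff_add_cancel_ennreal)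
  next
    case False
    then show ?thesis by (intro add_increasing) auto
  qed
  also have "\<dots> \<le> (a - c) + (b + e)" using assms(1) by (rule add_left_mono)
  finally show ?thesis using assms(2) by (simp add: ennreal_minus_le_iff add_ac)
qed

text \<open>
  At a point \<open>\<alpha>\<close> where \<open>m\<close> is continuous, a rational \<open>r < \<alpha>\<close> close to \<open>\<alpha>\<close> satisfies
  \<open>v r - m r \<le> v \<alpha> - m r\<close>, and the right-hand side is close to \<open>v \<alpha> - m \<alpha>\<close>. Hence the rationals, the
  discontinuities of \<open>m\<close> and the left end point suffice. That this set is the same for all \<open>v\<close> is what makes
  the infimum measurable when \<open>v\<close> depends on a state.
\<close>

lemma countable_INF_difference_of_mono:
  fixes m :: "real \<Rightarrow> real"
  assumes m: "mono_on {0..<1} m" and b: "0 \<le> b"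
  obtains D where "countable D" "D \<subseteq> {b..<1}"
    "\<And>v :: real \<Rightarrow> ennreal. mono_on {0..<1} v \<Longrightarrow>
      (INF \<alpha>\<in>{b..<1}. v \<alpha> - ennreal (m \<alpha>)) = (INF \<alpha>\<in>D. v \<alpha> - ennreal (m \<alpha>))"
proof -
  define C where "C = {\<alpha> \<in> {0..<1}. \<not> continuous (at \<alpha> within {0..<1}) m}"
  define D where "D = {b..<1} \<inter> (\<rat> \<union> C \<union> {b})"
  have "countable C" unfolding C_def by (rule mono_on_ctble_discont[OF m])
  then have "countable D" unfolding D_def by (simp add: countable_rat)
  moreover have "D \<subseteq> {b..<1}" by (simp add: D_def)
  moreover have "(INF \<alpha>\<in>{b..<1}. v \<alpha> - ennreal (m \<alpha>)) = (INF \<alpha>\<in>D. v \<alpha> - ennreal (m \<alpha>))"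
    if v: "mono_on {0..<1} v" for v :: "real \<Rightarrow> ennreal"
  proof (rule antisym)
    show "(INF \<alpha>\<in>{b..<1}. v \<alpha> - ennreal (m \<alpha>)) \<le> (INF \<alpha>\<in>D. v \<alpha> - ennreal (m \<alpha>))"
      by (rule INF_superset_mono) (auto simp: D_def)
    show "(INF \<alpha>\<in>D. v \<alpha> - ennreal (m \<alpha>)) \<le> (INF \<alpha>\<in>{b..<1}. v \<alpha> - ennreal (m \<alpha>))"
    proof (rule INF_greatest)
      fix \<alpha> assume \<alpha>: "\<alpha> \<in> {b..<1}"
      show "(INF \<alpha>\<in>D. v \<alpha> - ennreal (m \<alpha>)) \<le> v \<alpha> - ennreal (m \<alpha>)"
      proof (cases "\<alpha> \<in> D")
        case True
        then show ?thesis by (rule INF_lower)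
      next
        case False
        then have "\<alpha> > b" "\<alpha> < 1" "\<alpha> \<notin> C" using \<alpha> by (auto simp: D_def)
        then have cont: "continuous (at \<alpha> within {0..<1}) m" using b by (auto simp: C_def)
        show ?thesis
        proof (rule ennreal_le_epsilon)
          fix e :: real assume "e > 0"
          obtain d where d: "d > 0" "\<And>r. r \<in> {0..<1} \<Longrightarrow> dist r \<alpha> < d \<Longrightarrow> dist (m r) (m \<alpha>) < e"
            using cont \<open>e > 0\<close> unfolding continuous_within_eps_delta by blast
          obtain r where r: "r \<in> \<rat>" "max b (\<alpha> - d) < r" "r < \<alpha>"
            using Rats_dense_in_real[of "max b (\<alpha> - d)" \<alpha>] \<open>\<alpha> > b\<close> d(1) by auto
          have r01: "r \<in> {0..<1}" using r b \<open>\<alpha> < 1\<close> by auto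
          have "m \<alpha> \<le> m r + e" using d(2)[OF r01] r by (simp add: dist_real_def)
          then have me: "ennreal (m \<alpha>) \<le> ennreal (m r) + ennreal e"
          proof (cases "m r \<ge> 0")
            case True
            then show ?thesis using \<open>m \<alpha> \<le> m r + e\<close> \<open>e > 0\<close> by (simp add: ennreal_leI flip: ennreal_plus)
          next
            case False
            then have "ennreal (m \<alpha>) \<le> ennreal e" using \<open>m \<alpha> \<le> m r + e\<close> by (intro ennreal_leI) simp
            then show ?thesis by (simp add: add_increasing)
          qed
          have "r \<in> D" using r \<alpha> by (auto simp: D_def)
          then have "(INF \<alpha>\<in>D. v \<alpha> - ennreal (m \<alpha>)) \<le> v r - ennreal (m r)" by (rule INF_lower)
          also have "\<dots> \<le> v \<alpha> - ennreal (m r)"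
            using v r01 r \<open>\<alpha> < 1\<close> by (intro ennreal_minus_mono) (auto simp: mono_on_def)
          also have "\<dots> \<le> v \<alpha> - ennreal (m \<alpha>) + ennreal e"
            by (rule ennreal_minus_le_minus_add[OF me]) simp
          finally show "(INF \<alpha>\<in>D. v \<alpha> - ennreal (m \<alpha>)) \<le> v \<alpha> - ennreal (m \<alpha>) + ennreal e" .
        qed
      qed
    qed
  qed
  ultimately show ?thesis by (rule that)
qed

section \<open>Average costs\<close>

context markov_decision_process
begin

lemma discounted_value_mono:
  assumes x: "x \<in> states M" and \<alpha>: "0 \<le> \<alpha>" "\<alpha> \<le> \<beta>"
  shows "discounted_value M \<alpha> x \<le> discounted_value M \<beta> x"
  unfolding discounted_value_def
proof (rule INF_mono)
  fix \<pi> assume \<pi>: "\<pi> \<in> policies M"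
  interpret controlled_process M x \<pi> by unfold_locales (use x \<pi> in auto)
  have "discounted_cost M \<alpha> \<pi> x \<le> discounted_cost M \<beta> \<pi> x"
    unfolding discounted_cost_eq using \<alpha>
    by (intro suminf_le mult_right_mono ennreal_leI power_mono) auto
  then show "\<exists>\<pi>'\<in>policies M. discounted_cost M \<alpha> \<pi>' x \<le> discounted_cost M \<beta> \<pi> x" using \<pi> by blast
qed

lemma min_discounted_value_mono:
  assumes "0 \<le> \<alpha>" "\<alpha> \<le> \<beta>"
  shows "min_discounted_value M \<alpha> \<le> min_discounted_value M \<beta>"
  unfolding min_discounted_value_def using discounted_value_mono[OF _ assms]
  by (intro INF_mono) blast

lemma min_discounted_value_le: "x \<in> states M \<Longrightarrow> min_discounted_value M \<alpha> \<le> discounted_value M \<alpha> x"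
  unfolding min_discounted_value_def by (rule INF_lower)

lemma average_cost_eq:
  assumes "x \<in> states M" "\<pi> \<in> policies M"
  shows "average_cost M \<pi> x = limsup (\<lambda>T. (\<Sum>t<T. controlled_process.expected_cost M x \<pi> t) / of_nat T)"
proof -
  interpret controlled_process M x \<pi> by unfold_locales (use assms in auto)
  show ?thesis by (simp add: average_cost_def finite_cost_eq)
qed

lemma Limsup_discounted_value_le_average_cost:
  assumes x: "x \<in> states M" and \<pi>: "\<pi> \<in> policies M"
  shows "Limsup (at_left 1) (\<lambda>\<alpha>. ennreal (1 - \<alpha>) * discounted_value M \<alpha> x) \<le> average_cost M \<pi> x"
proof -
  interpret controlled_process M x \<pi> by unfold_locales (use x \<pi> in auto)
  have "Limsup (at_left 1) (\<lambda>\<alpha>. ennreal (1 - \<alpha>) * discounted_value M \<alpha> x)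
     \<le> Limsup (at_left 1) (\<lambda>\<alpha>. ennreal (1 - \<alpha>) * discounted_cost M \<alpha> \<pi> x)"
    unfolding discounted_value_def
    by (intro Limsup_mono always_eventually allI mult_left_mono INF_lower \<pi>) simp
  also have "\<dots> \<le> average_cost M \<pi> x"
    unfolding average_cost_eq[OF x \<pi>] discounted_cost_eq by (rule limsup_abel_le_limsup_cesaro)
  finally show ?thesis .
qed

lemma w_bar_le_Limsup:
  assumes x: "x \<in> states M"
  shows "w_bar M \<le> Limsup (at_left 1) (\<lambda>\<alpha>. ennreal (1 - \<alpha>) * discounted_value M \<alpha> x)"
  unfolding w_bar_def
  by (intro Limsup_mono always_eventually allI mult_left_mono min_discounted_value_le x) simp

lemma Limsup_le_average_value:
  assumes x: "x \<in> states M"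
  shows "Limsup (at_left 1) (\<lambda>\<alpha>. ennreal (1 - \<alpha>) * discounted_value M \<alpha> x) \<le> average_value M x"
  unfolding average_value_def by (intro INF_greatest Limsup_discounted_value_le_average_cost x)

lemma w_bar_le_w_star: "w_bar M \<le> w_star M"
  unfolding w_star_def
  using w_bar_le_Limsup Limsup_le_average_value by (intro INF_greatest) (blast intro: order_trans)

lemma min_discounted_value_finite:
  assumes w: "w_star M < \<infinity>" and \<alpha>: "0 \<le> \<alpha>" "\<alpha> < 1"
  shows "min_discounted_value M \<alpha> < \<infinity>"
proof -
  obtain x where x: "x \<in> states M" "average_value M x < \<infinity>"
    using w unfolding w_star_def INF_less_iff by blast
  then obtain \<pi> where \<pi>: "\<pi> \<in> policies M" "average_cost M \<pi> x < \<infinity>"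
    unfolding average_value_def INF_less_iff by blast
  interpret controlled_process M x \<pi> by unfold_locales (use x \<pi> in auto)
  have "min_discounted_value M \<alpha> \<le> discounted_value M \<alpha> x" using x(1) by (rule min_discounted_value_le)
  also have "\<dots> \<le> discounted_cost M \<alpha> \<pi> x" unfolding discounted_value_def by (rule INF_lower[OF \<pi>(1)])
  also have "\<dots> < \<infinity>"
    using discounted_sum_finite[OF _ \<alpha>] \<pi>(2) unfolding average_cost_eq[OF x(1) \<pi>(1)] discounted_cost_eq by blast
  finally show ?thesis .
qed

text \<open>
  The bound \<open>T w + u x\<close> for the cost of \<open>T\<close> steps is divided by \<open>T\<close>.
\<close>

lemma average_cost_le_of_ineq:
  assumes \<phi>: "stationary_policy M \<phi>" and x: "x \<in> states M"
    and u: "u \<in> borel_measurable (state_space M)" "u x < \<infinity>"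
    and le: "\<And>y. y \<in> states M \<Longrightarrow> eta M 1 u (y, \<phi> y) \<le> w + u y"
  shows "average_cost M (of_stationary M \<phi>) x \<le> w"
proof -
  have "average_cost M (of_stationary M \<phi>) x \<le> limsup (\<lambda>T. w + u x / of_nat T)"
    unfolding average_cost_def
  proof (rule Limsup_mono, rule eventually_sequentiallyI[of 1])
    fix T :: nat assume T: "1 \<le> T"
    have "finite_cost M T 1 (of_stationary M \<phi>) x \<le> of_nat T * w + u x"
      using stationary_cost_le[OF \<phi> x _ u(1) le, of T] by simp
    then have "finite_cost M T 1 (of_stationary M \<phi>) x / of_nat T \<le> (of_nat T * w + u x) / of_nat T"
      by (rule divide_right_mono_ennreal)
    also have "\<dots> = w + u x / of_nat T"
      using T by (simp add: add_divide_distrib_ennreal mult_divide_eq_ennreal mult.commute[of "of_nat T"])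
    finally show "finite_cost M T 1 (of_stationary M \<phi>) x / of_nat T \<le> w + u x / of_nat T" .
  qed
  also have "limsup (\<lambda>T. w + u x / of_nat T) = w + 0"
  proof (rule lim_imp_Limsup)
    obtain r where r: "u x = ennreal r" "r \<ge> 0" using u(2) by (cases "u x") auto
    have "(\<lambda>T. ennreal (r / real T)) \<longlonglongrightarrow> ennreal 0"
      by (intro tendsto_ennrealI lim_const_over_n)
    moreover have "\<forall>\<^sub>F T in sequentially. ennreal (r / real T) = u x / of_nat T"
      using r by (intro eventually_sequentiallyI[of 1]) (simp add: divide_ennreal ennreal_of_nat_eq_real_of_nat)
    ultimately have "(\<lambda>T. u x / of_nat T) \<longlonglongrightarrow> 0"
      by (simp add: tendsto_cong)
    then show "(\<lambda>T. w + u x / of_nat T) \<longlonglongrightarrow> w + 0"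
      by (intro tendsto_add tendsto_const)
  qed simp
  finally show ?thesis by simp
qed

end

locale average_cost_mdp = setwise_mdp M
  for M :: "('x::polish_space, 'a::polish_space, 'z) mdp_scheme" +
  assumes w_star_finite: "w_star M < \<infinity>" and B: "assumption_B M"
begin

lemma w_bar_finite: "w_bar M < \<infinity>"
  using w_bar_le_w_star w_star_finite by (rule le_less_trans)

lemma u_finite: "x \<in> states M \<Longrightarrow> u_fun M x < \<infinity>"
  using B by (simp add: assumption_B_def)

lemma relative_value_add:
  "x \<in> states M \<Longrightarrow> min_discounted_value M \<alpha> + relative_value M \<alpha> x = discounted_value M \<alpha> x"
  using min_discounted_value_le[of x \<alpha>] by (simp add: relative_value_def)

lemma relative_value_measurable:
  "0 \<le> \<alpha> \<Longrightarrow> relative_value M \<alpha> \<in> borel_measurable (state_space M)"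
  unfolding relative_value_def[abs_def] using discounted_value_measurable by measurable

text \<open>
  For an action that minimizes the right-hand side of the discounted problem, the constant
  \<open>min_discounted_value M \<alpha>\<close> is pulled out of the integral, where it appears with the factor \<open>\<alpha>\<close>,
  and cancelled.
\<close>

lemma bellman_relative_value_le:
  assumes x: "x \<in> states M" and \<alpha>: "0 \<le> \<alpha>" "\<alpha> < 1"
  shows "bellman \<alpha> (relative_value M \<alpha>) x \<le> ennreal (1 - \<alpha>) * min_discounted_value M \<alpha> + relative_value M \<alpha> x"
proof -
  let ?m = "min_discounted_value M \<alpha>" and ?u = "relative_value M \<alpha>"
  obtain a where a: "a \<in> feasible M x" "eta M \<alpha> (discounted_value M \<alpha>) (x, a) = bellman \<alpha> (discounted_value M \<alpha>) x"
    using bellman_attained[OF x discounted_value_measurable] \<alpha> by blast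
  have p: "(x, a) \<in> Gr M" using x a by (simp add: graph_of_def)
  interpret q: prob_space "transition M (x, a)" by (rule transition_prob[OF p])
  have "eta M \<alpha> (discounted_value M \<alpha>) (x, a) = eta M \<alpha> (\<lambda>y. ?m + ?u y) (x, a)"
    by (rule eta_cong[OF p]) (simp add: relative_value_add)
  also have "\<dots> = ennreal \<alpha> * ?m + eta M \<alpha> ?u (x, a)"
    using measurable_transition[OF relative_value_measurable p] \<alpha>
    by (simp add: eta_def nn_integral_add q.emeasure_space_1 distrib_left add_ac)
  finally have "ennreal \<alpha> * ?m + eta M \<alpha> ?u (x, a) \<le> discounted_value M \<alpha> x"
    using a discounted_optimality_inequality[OF x \<alpha>(1)] by simp
  also have "\<dots> = ennreal (\<alpha> + (1 - \<alpha>)) * ?m + ?u x"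
    using x by (simp add: relative_value_add)
  also have "\<dots> = ennreal \<alpha> * ?m + (ennreal (1 - \<alpha>) * ?m + ?u x)"
    using \<alpha> by (subst ennreal_plus) (auto simp: distrib_right add_ac)
  finally have "eta M \<alpha> ?u (x, a) \<le> ennreal (1 - \<alpha>) * ?m + ?u x"
    using min_discounted_value_finite[OF w_star_finite \<alpha>]
    by (auto simp: ennreal_add_left_cancel_le ennreal_mult_eq_top_iff)
  then show ?thesis using bellman_le_eta[OF p] order_trans by blast
qed

definition discount :: "nat \<Rightarrow> real" where
  "discount n = 1 - 1 / Suc n"

lemma discount_bounds: "0 \<le> discount n" "discount n < 1"
  by (simp_all add: discount_def)

lemma discount_incseq: "incseq discount"
  by (auto simp: incseq_def discount_def frac_le)

lemma discount_tendsto: "discount \<longlonglongrightarrow> 1"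
proof -
  have "(\<lambda>n. 1 - 1 / real (Suc n)) \<longlonglongrightarrow> 1 - 0"
    by (intro tendsto_intros LIMSEQ_inverse_real_of_nat[unfolded inverse_eq_divide])
  then show ?thesis by (simp add: discount_def[abs_def])
qed

definition u_lower :: "nat \<Rightarrow> 'x \<Rightarrow> ennreal" where
  "u_lower n x = (INF \<alpha>\<in>{discount n..<1}. relative_value M \<alpha> x)"

lemma u_fun_eq_SUP: "u_fun M x = (SUP n. u_lower n x)"
  unfolding u_fun_def u_lower_def
  by (rule Liminf_at_left_1_eq_SUP[OF discount_bounds(2) discount_tendsto])

lemma u_lower_incseq: "incseq (\<lambda>n. u_lower n x)"
  unfolding incseq_def u_lower_def
proof (intro allI impI INF_superset_mono order_refl)
  fix m n :: nat assume "m \<le> n"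
  then show "{discount n..<1} \<subseteq> {discount m..<1}" using discount_incseq by (auto simp: incseq_def intro: order_trans)
qed

lemma u_lower_measurable: "u_lower n \<in> borel_measurable (state_space M)"
proof -
  define m where "m \<alpha> = enn2real (min_discounted_value M \<alpha>)" for \<alpha>
  have m: "min_discounted_value M \<alpha> = ennreal (m \<alpha>)" if "\<alpha> \<in> {0..<1}" for \<alpha>
    using min_discounted_value_finite[OF w_star_finite] that by (simp add: m_def)
  have "mono_on {0..<1} m"
  proof (rule mono_onI)
    fix \<alpha> \<beta> :: real assume "\<alpha> \<in> {0..<1}" "\<beta> \<in> {0..<1}" "\<alpha> \<le> \<beta>"
    then show "m \<alpha> \<le> m \<beta>" unfolding m_def
      using min_discounted_value_mono min_discounted_value_finite[OF w_star_finite]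
      by (intro enn2real_mono) auto
  qed
  then obtain D where D: "countable D" "D \<subseteq> {discount n..<1}"
    "\<And>v :: real \<Rightarrow> ennreal. mono_on {0..<1} v \<Longrightarrow>
      (INF \<alpha>\<in>{discount n..<1}. v \<alpha> - ennreal (m \<alpha>)) = (INF \<alpha>\<in>D. v \<alpha> - ennreal (m \<alpha>))"
    using countable_INF_difference_of_mono[OF _ discount_bounds(1)] by blast
  have D01: "D \<subseteq> {0..<1}" and I01: "{discount n..<1} \<subseteq> {0..<1}" using D(2) discount_bounds(1)[of n] by auto
  have "u_lower n x = (INF \<alpha>\<in>D. relative_value M \<alpha> x)" if x: "x \<in> states M" for x
  proof -
    have "mono_on {0..<1} (\<lambda>\<alpha>. discounted_value M \<alpha> x)"
      using discounted_value_mono[OF x] by (intro mono_onI) auto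
    note INF_eq = D(3)[OF this]
    have e: "relative_value M \<alpha> x = discounted_value M \<alpha> x - ennreal (m \<alpha>)" if "\<alpha> \<in> {0..<1}" for \<alpha>
      using m[OF that] by (simp add: relative_value_def)
    have "u_lower n x = (INF \<alpha>\<in>{discount n..<1}. discounted_value M \<alpha> x - ennreal (m \<alpha>))"
      unfolding u_lower_def by (intro INF_cong refl e) (use I01 in blast)
    also note INF_eq
    also have "(INF \<alpha>\<in>D. discounted_value M \<alpha> x - ennreal (m \<alpha>)) = (INF \<alpha>\<in>D. relative_value M \<alpha> x)"
      by (intro INF_cong refl e[symmetric]) (use D01 in blast)
    finally show ?thesis .
  qed
  moreover have "(\<lambda>x. INF \<alpha>\<in>D. relative_value M \<alpha> x) \<in> borel_measurable (state_space M)"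
    using D(1) D01 by (intro borel_measurable_INF relative_value_measurable) auto
  ultimately show ?thesis
    by (subst measurable_cong[where g="\<lambda>x. INF \<alpha>\<in>D. relative_value M \<alpha> x"]) auto
qed

lemma u_measurable: "u_fun M \<in> borel_measurable (state_space M)"
proof -
  have "(\<lambda>x. SUP n. u_lower n x) \<in> borel_measurable (state_space M)"
    by (intro borel_measurable_SUP u_lower_measurable) simp
  then show ?thesis by (simp add: u_fun_eq_SUP[abs_def])
qed

text \<open>
  For \<open>\<alpha>\<close> close to \<open>1\<close> the constant in \<open>bellman_relative_value_le\<close> is at most \<open>w_bar M + e\<close>. As
  \<open>u_lower n\<close> lies below \<open>relative_value M \<alpha>\<close> for all \<open>\<alpha> \<ge> discount n\<close>, taking the infimum over these
  \<open>\<alpha>\<close> replaces both occurrences of the relative value by \<open>u_lower n\<close>, and \<open>bellman_SUP\<close> lets \<open>n\<close> tend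
  to infinity.
\<close>

theorem average_optimality_inequality:
  assumes x: "x \<in> states M"
  shows "bellman 1 (u_fun M) x \<le> w_bar M + u_fun M x"
proof (rule ennreal_le_epsilon)
  fix e :: real assume "0 < e"
  have "w_bar M < w_bar M + ennreal e"
    using w_bar_finite \<open>0 < e\<close> by simp
  from Limsup_lessD[OF this[unfolded w_bar_def]]
  have "\<forall>\<^sub>F \<alpha> in at_left 1. ennreal (1 - \<alpha>) * min_discounted_value M \<alpha> < w_bar M + ennreal e"
    by (simp add: w_bar_def)
  then obtain c where c: "c < 1"
      "\<And>\<alpha>. c < \<alpha> \<Longrightarrow> \<alpha> < 1 \<Longrightarrow> ennreal (1 - \<alpha>) * min_discounted_value M \<alpha> < w_bar M + ennreal e"
    by (auto simp: eventually_at_left_field)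
  obtain N where N: "\<And>n. n \<ge> N \<Longrightarrow> c < discount n"
    using order_tendstoD(1)[OF discount_tendsto c(1)] by (auto simp: eventually_sequentially)
  let ?w = "w_bar M + ennreal e"
  have wfin: "?w < \<infinity>" using w_bar_finite by simp
  have bound: "bellman (discount n) (u_lower n) x \<le> ?w + u_fun M x" if n: "n \<ge> N" for n
  proof -
    have "bellman (discount n) (u_lower n) x \<le> ?w + relative_value M \<alpha> x" if \<alpha>: "\<alpha> \<in> {discount n..<1}" for \<alpha>
    proof -
      have \<alpha>01: "0 \<le> \<alpha>" "\<alpha> < 1" "c < \<alpha>" using \<alpha> discount_bounds(1)[of n] N[OF n] by auto
      have "bellman (discount n) (u_lower n) x \<le> bellman \<alpha> (relative_value M \<alpha>) x"
        using \<alpha> by (intro bellman_mono x) (auto simp: u_lower_def intro: INF_lower)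
      also have "\<dots> \<le> ennreal (1 - \<alpha>) * min_discounted_value M \<alpha> + relative_value M \<alpha> x"
        by (rule bellman_relative_value_le[OF x \<alpha>01(1,2)])
      also have "\<dots> \<le> ?w + relative_value M \<alpha> x"
        using c(2)[OF \<alpha>01(3,2)] by (intro add_right_mono) simp
      finally show ?thesis .
    qed
    then have "bellman (discount n) (u_lower n) x - ?w \<le> u_lower n x"
      unfolding u_lower_def[of n x] using wfin
      by (intro INF_greatest) (auto simp: ennreal_minus_le_iff)
    also have "\<dots> \<le> u_fun M x" unfolding u_fun_eq_SUP by (rule SUP_upper) simp
    finally show ?thesis using wfin by (simp add: ennreal_minus_le_iff)
  qed
  have one: "ennreal 1 = (SUP n. ennreal (discount n))"
  proof -
    have "incseq (\<lambda>n. ennreal (discount n))"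
      using discount_incseq by (auto simp: incseq_def intro: ennreal_leI)
    then have "(\<lambda>n. ennreal (discount n)) \<longlonglongrightarrow> (SUP n. ennreal (discount n))"
      by (rule LIMSEQ_SUP)
    moreover have "(\<lambda>n. ennreal (discount n)) \<longlonglongrightarrow> ennreal 1"
      by (intro tendsto_ennrealI discount_tendsto)
    ultimately show ?thesis using LIMSEQ_unique by blast
  qed
  have "bellman 1 (u_fun M) x = bellman 1 (\<lambda>y. SUP n. u_lower n y) x"
    by (simp add: u_fun_eq_SUP[abs_def])
  also have "\<dots> \<le> (SUP n. bellman (discount n) (u_lower n) x)"
    by (rule bellman_SUP[OF x u_lower_measurable u_lower_incseq discount_incseq discount_bounds(1) one])
  also have "\<dots> \<le> ?w + u_fun M x"
  proof (rule SUP_least)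
    fix n
    have "bellman (discount n) (u_lower n) x \<le> bellman (discount (max n N)) (u_lower (max n N)) x"
      using u_lower_incseq discount_incseq by (intro bellman_mono x) (auto simp: incseq_def)
    also have "\<dots> \<le> ?w + u_fun M x" by (rule bound) simp
    finally show "bellman (discount n) (u_lower n) x \<le> ?w + u_fun M x" .
  qed
  finally show "bellman 1 (u_fun M) x \<le> w_bar M + u_fun M x + ennreal e"
    by (simp add: add_ac)
qed

text \<open>
  The chain \<open>w_bar \<le> limsup (1 - \<alpha>) v\<^sub>\<alpha> \<le> average_value \<le> average_cost \<le> w_bar\<close> collapses; the last
  step is the inequality that \<open>\<phi>\<close> satisfies.
\<close>

lemma optimal_of_ineq:
  assumes \<phi>: "stationary_policy M \<phi>" and ineq: "satisfies_ineq M \<phi>"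
  shows "satisfies_values M \<phi>" "average_optimal M (of_stationary M \<phi>)"
proof -
  let ?L = "\<lambda>x. Limsup (at_left 1) (\<lambda>\<alpha>. ennreal (1 - \<alpha>) * discounted_value M \<alpha> x)"
  have \<pi>: "of_stationary M \<phi> \<in> policies M" by (rule of_stationary_policy[OF \<phi>])
  have upper: "average_cost M (of_stationary M \<phi>) x \<le> w_bar M" if x: "x \<in> states M" for x
    using ineq by (intro average_cost_le_of_ineq[OF \<phi> x u_measurable u_finite[OF x]])
      (simp add: satisfies_ineq_def)
  have val_le: "average_value M x \<le> average_cost M (of_stationary M \<phi>) x" for x
    unfolding average_value_def by (rule INF_lower[OF \<pi>])
  have eqs: "average_cost M (of_stationary M \<phi>) x = w_bar M" "average_value M x = w_bar M" "?L x = w_bar M"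
    if x: "x \<in> states M" for x
    using upper[OF x] val_le[of x] w_bar_le_Limsup[OF x] Limsup_le_average_value[OF x] by auto
  obtain x0 where x0: "x0 \<in> states M"
    using w_star_finite unfolding w_star_def INF_less_iff by blast
  have "w_star M = w_bar M"
    unfolding w_star_def using x0 eqs(2) by (intro antisym INF_greatest INF_lower2[OF x0]) auto
  then show "satisfies_values M \<phi>" using eqs by (simp add: satisfies_values_def)
  show "average_optimal M (of_stationary M \<phi>)" using eqs \<pi> by (simp add: average_optimal_def)
qed

lemma ineq_actions_compact: "x \<in> states M \<Longrightarrow> compact (ineq_actions M x)"
  using eta_compact_sublevels[OF _ u_measurable, of x 1] w_bar_finite u_finite
  by (simp add: compact_sublevels_def ineq_actions_def)

lemma min_actions_eq:
  assumes "x \<in> states M"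
  shows "min_actions M x = {a \<in> feasible M x. eta M 1 (u_fun M) (x, a) \<le> bellman 1 (u_fun M) x}"
  by (auto simp: min_actions_def is_arg_min_def bellman_def not_less le_INF_iff)

lemma bellman_u_finite:
  assumes x: "x \<in> states M" shows "bellman 1 (u_fun M) x < \<infinity>"
  using average_optimality_inequality[OF x] w_bar_finite u_finite[OF x]
  by (auto intro: le_less_trans)

lemma min_actions_compact: "x \<in> states M \<Longrightarrow> compact (min_actions M x)"
  using eta_compact_sublevels[OF _ u_measurable, of x 1] bellman_u_finite
  by (simp add: compact_sublevels_def min_actions_eq)

lemma min_actions_subset: "x \<in> states M \<Longrightarrow> min_actions M x \<subseteq> ineq_actions M x"
  using average_optimality_inequality[of x]
  by (auto simp: min_actions_eq ineq_actions_def intro: order_trans)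

lemma graph_ineq_actions: "graph_of M (ineq_actions M) \<in> sets (borel_on (states M \<times> actions M))"
proof -
  have u: "(\<lambda>p. u_fun M (fst p)) \<in> borel_measurable (borel_on (Gr M))"
    unfolding restrict_step_Gr[symmetric]
    by (intro measurable_restrict_space1 measurable_compose[OF measurable_fst_step u_measurable])
  have "{p \<in> space (borel_on (Gr M)). eta M 1 (u_fun M) p \<le> w_bar M + u_fun M (fst p)} \<in> sets (borel_on (Gr M))"
    using eta_measurable[OF u_measurable, of 1] u by measurable
  moreover have "graph_of M (ineq_actions M) =
      {p \<in> space (borel_on (Gr M)). eta M 1 (u_fun M) p \<le> w_bar M + u_fun M (fst p)}"
    by (auto simp: graph_of_def ineq_actions_def space_restrict_space)
  ultimately have "graph_of M (ineq_actions M) \<in> sets borel" "graph_of M (ineq_actions M) \<subseteq> Gr M"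
    using Gr_borel by (auto simp: sets_restrict_space_iff space_restrict_space)
  then show ?thesis
    using states_actions_borel Gr_subset by (simp add: sets_restrict_space_iff)
qed

lemma minimizing_policy_exists:
  "\<exists>\<phi>. stationary_policy M \<phi> \<and> (\<forall>x\<in>states M. \<phi> x \<in> min_actions M x)"
proof -
  obtain \<phi> where \<phi>: "stationary_policy M \<phi>"
    "\<And>x. x \<in> states M \<Longrightarrow> eta M 1 (u_fun M) (x, \<phi> x) = bellman 1 (u_fun M) x"
    using bellman_selector[OF u_measurable, of 1] by auto
  then have "\<forall>x\<in>states M. \<phi> x \<in> min_actions M x"
    by (auto simp: min_actions_eq stationary_policy_def)
  then show ?thesis using \<phi>(1) by blast
qed

end

theorem theorem3p3:
  fixes M :: "('x::polish_space, 'a::polish_space) mdp"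
  assumes "is_mdp M"
    and "w_star M < \<infinity>"
    and "assumption_S_star M"
    and "assumption_B M"
  shows
    "(\<exists>\<phi>. stationary_policy M \<phi> \<and> average_optimal M (of_stationary M \<phi>) \<and>
        satisfies_ineq M \<phi> \<and> satisfies_values M \<phi>) \<and>
     \<comment> \<open>(a)\<close>
     (u_fun M \<in> borel_measurable (borel_on (states M)) \<and>
        (\<forall>x\<in>states M. 0 \<le> u_fun M x \<and> u_fun M x < \<infinity>)) \<and>
     \<comment> \<open>(b)\<close>
     ((\<forall>x\<in>states M. ineq_actions M x \<noteq> {}) \<and>
        graph_of M (ineq_actions M) \<in> sets (borel_on (states M \<times> actions M)) \<and>
        (\<forall>x\<in>states M. compact (ineq_actions M x))) \<and>
     \<comment> \<open>(c)\<close>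
     (\<forall>\<phi>. stationary_policy M \<phi> \<and> (\<forall>x\<in>states M. \<phi> x \<in> ineq_actions M x) \<longrightarrow>
        satisfies_ineq M \<phi> \<and> satisfies_values M \<phi> \<and> average_optimal M (of_stationary M \<phi>)) \<and>
     \<comment> \<open>(d)\<close>
     ((\<forall>x\<in>states M. compact (min_actions M x) \<and> min_actions M x \<subseteq> ineq_actions M x) \<and>
        (\<exists>\<phi>. stationary_policy M \<phi> \<and> (\<forall>x\<in>states M. \<phi> x \<in> min_actions M x)))"
proof -
  interpret average_cost_mdp M
    using assms by unfold_locales
  have c: "satisfies_ineq M \<phi> \<and> satisfies_values M \<phi> \<and> average_optimal M (of_stationary M \<phi>)"
    if "stationary_policy M \<phi>" "\<forall>x\<in>states M. \<phi> x \<in> ineq_actions M x" for \<phi>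
  proof -
    have ineq: "satisfies_ineq M \<phi>" using that(2) by (simp add: satisfies_ineq_def ineq_actions_def)
    then show ?thesis using optimal_of_ineq[OF that(1)] by blast
  qed
  obtain \<phi> where \<phi>: "stationary_policy M \<phi>" "\<forall>x\<in>states M. \<phi> x \<in> min_actions M x"
    using minimizing_policy_exists by blast
  then have \<phi>_ineq: "\<forall>x\<in>states M. \<phi> x \<in> ineq_actions M x" using min_actions_subset by blast
  show ?thesis
  proof (intro conjI allI impI ballI)
    show "\<exists>\<phi>. stationary_policy M \<phi> \<and> average_optimal M (of_stationary M \<phi>) \<and>
        satisfies_ineq M \<phi> \<and> satisfies_values M \<phi>"
      using c[OF \<phi>(1) \<phi>_ineq] \<phi>(1) by blast
    show "u_fun M \<in> borel_measurable (borel_on (states M))"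
      using u_measurable by (simp add: state_space_def)
    show "\<exists>\<phi>. stationary_policy M \<phi> \<and> (\<forall>x\<in>states M. \<phi> x \<in> min_actions M x)"
      using \<phi> by blast
    show "ineq_actions M x \<noteq> {}" if "x \<in> states M" for x using \<phi>_ineq that by blast
  qed (use u_finite c graph_ineq_actions ineq_actions_compact min_actions_compact min_actions_subset in auto)
qed

end
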